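(* Let $b=p_1^{l_1}\cdots p_s^{l_s}$ with $s\ge 2$, where $p_1,\ldots,p_s$ are distinct primes and $l_1,\ldots,l_s\geq 1$ are integers, and put $b_i=p_i^{l_i}$. For each $i=1,\ldots,s$ let $f_i\colon\mathbb{Z}_{p_i}\to\mathbb{Q}_{p_i}$ be an analytic function that is not identically zero, and let $f=(f_1,\ldots,f_s)$. Let $\mathcal{R}_f=\mathcal{R}_{f_1}\times\cdots\times\mathcal{R}_{f_s}\subset\mathbb{Z}_b$, where $\mathcal{R}_{f_i}$ is the set of roots of $f_i$ in $\mathbb{Z}_{p_i}$. Then the sequence $(\nu_b(f(n)))_{n\ge0}$ is (a) periodic if $\mathcal{R}_f=\varnothing$, and a power of $b$ can be chosen as a period; (b) strictly $k$-regular if $\mathcal{R}_f=\{\theta\}$ for some $\theta\in\mathbb{Q}\cap\mathbb{Z}_b$, where $k=b_1^{w_1}\cdots b_s^{w_s}$ and $w_1,\ldots,w_s$ are positive integers satisfying $w_1m_{f_1}(\theta)=\cdots=w_sm_{f_s}(\theta)$; (c) not regular otherwise.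
   Context: $\mathbb{N}=\{0,1,2,\ldots\}$. A function $\mathbb{Z}_p\to\mathbb{Q}_p$ is analytic if it is given by a single Taylor (power) series convergent on all of $\mathbb{Z}_p$; $m_{f_i}(\theta)$ denotes the multiplicity of $\theta$ as a root of $f_i$. Put $\mathbb{Z}_b=\mathbb{Z}_{p_1}\times\cdots\times\mathbb{Z}_{p_s}$ and $\mathbb{Q}_b=\mathbb{Q}_{p_1}\times\cdots\times\mathbb{Q}_{p_s}$; $\mathbb{Q}$ is identified with its diagonal image in $\mathbb{Q}_b$ under $x\mapsto(x,\ldots,x)$. For $n\in\mathbb{N}$, $f(n)=(f_1(n),\ldots,f_s(n))\in\mathbb{Q}_b$. For $x=(x_1,\ldots,x_s)\in\mathbb{Q}_b$ put $\nu_b(x)=\min_{1\le i\le s}\lfloor\nu_{p_i}(x_i)/l_i\rfloor$, with $\nu_{p_i}(0)=+\infty$. For an integer $k\ge2$, the $k$-kernel of $\mathbf{a}=(a_n)_{n\ge0}$ is $\{(a_{k^in+j})_{n\ge0}: i\ge0,\ 0\le j\le k^i-1\}$. A sequence with values in a $\mathbb{Z}$-module $R$ is $k$-regular if the $\mathbb{Z}$-submodule of $R^{\mathbb{N}}$ generated by its $k$-kernel is finitely generated. It is regular if it is $k$-regular for some $k\ge2$. It is strictly $k$-regular if it is $k$-regular and is not $m$-regular for any integer $m\ge2$ multiplicatively independent of $k$ (i.e. with $k^a\neq m^c$ for all integers $a,c\ge1$). A period need not be minimal. Convention: $f(n)=0$ may happen for finitely many $n\in\mathbb{N}$; the terms $+\infty$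 occurring at such $n$ are replaced by arbitrary integers, which does not affect regularity. *)

theory Defs
  imports
    "HOL-Computational_Algebra.Computational_Algebra"
    "HOL-Algebra.QuotRing"
    "HOL-Library.Extended"
    "HOL-Library.Function_Algebras"
    "HOL-Library.FuncSet"
begin

section \<open>The field of p-adic numbers\<close>

definition val_rat :: "nat \<Rightarrow> rat \<Rightarrow> int extended" where
  "val_rat p x =
     (if x = 0 then \<infinity>
      else Fin (int (multiplicity (int p) (fst (quotient_of x)))
              - int (multiplicity (int p) (snd (quotient_of x)))))"

definition padic_Cauchy :: "nat \<Rightarrow> (nat \<Rightarrow> rat) \<Rightarrow> bool" where
  "padic_Cauchy p X \<longleftrightarrow>
     (\<forall>k. \<exists>N. \<forall>m\<ge>N. \<forall>n\<ge>N. Fin k \<le> val_rat p (X m - X n))"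

definition padic_null :: "nat \<Rightarrow> (nat \<Rightarrow> rat) set" where
  "padic_null p = {X. \<forall>k. \<forall>\<^sub>F n in sequentially. Fin k \<le> val_rat p (X n)}"

definition Cauchy_ring :: "nat \<Rightarrow> (nat \<Rightarrow> rat) ring" where
  "Cauchy_ring p =
     \<lparr>carrier = {X. padic_Cauchy p X},
      mult = (\<lambda>X Y n. X n * Y n), one = (\<lambda>_. 1),
      zero = (\<lambda>_. 0), add = (\<lambda>X Y n. X n + Y n)\<rparr>"

text \<open>
  \<open>Qp p\<close> is the completion of the rationals for the p-adic valuation: Cauchy sequences modulo null
  sequences. All these fields live on one HOL type, so that a family of them can be indexed by the
  primes \<open>p\<close>.
\<close>

type_synonym padic = "(nat \<Rightarrow> rat) set"

definition Qp :: "nat \<Rightarrow> padic ring" where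
  "Qp p = Cauchy_ring p Quot padic_null p"

definition of_rat_Qp :: "nat \<Rightarrow> rat \<Rightarrow> padic" where
  "of_rat_Qp p q = padic_null p +>\<^bsub>Cauchy_ring p\<^esub> (\<lambda>_. q)"

text \<open>
  The valuations along a Cauchy sequence that is not null are eventually constant, and their
  eventual value depends only on the class. The zero class contains the constant sequence 0, of
  valuation \<open>\<infinity>\<close>, and none of its members has an eventually constant finite valuation.
\<close>

definition val_Qp :: "nat \<Rightarrow> padic \<Rightarrow> int extended" where
  "val_Qp p x = (THE v. \<exists>X\<in>x. \<forall>\<^sub>F n in sequentially. val_rat p (X n) = v)"

definition Zp :: "nat \<Rightarrow> padic set" where
  "Zp p = {x \<in> carrier (Qp p). 0 \<le> val_Qp p x}"

definition padic_tendsto :: "nat \<Rightarrow> (nat \<Rightarrow> padic) \<Rightarrow> padic \<Rightarrow> bool" where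
  "padic_tendsto p S x \<longleftrightarrow>
     (\<forall>k. \<forall>\<^sub>F n in sequentially. Fin k \<le> val_Qp p (S n \<ominus>\<^bsub>Qp p\<^esub> x))"


section \<open>Analytic functions on the p-adic integers\<close>

text \<open>Only the values of \<open>f\<close> on \<open>Zp p\<close> matter; elsewhere \<open>f\<close> is arbitrary.\<close>

definition analytic_Zp :: "nat \<Rightarrow> (padic \<Rightarrow> padic) \<Rightarrow> bool" where
  "analytic_Zp p f \<longleftrightarrow>
     f \<in> Zp p \<rightarrow> carrier (Qp p) \<and>
     (\<exists>c. (\<forall>j. c j \<in> carrier (Qp p)) \<and>
       (\<forall>x\<in>Zp p. padic_tendsto p
          (\<lambda>N. \<Oplus>\<^bsub>Qp p\<^esub>j\<in>{..<N}. c j \<otimes>\<^bsub>Qp p\<^esub> x [^]\<^bsub>Qp p\<^esub> j) (f x)))"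

definition roots_Zp :: "nat \<Rightarrow> (padic \<Rightarrow> padic) \<Rightarrow> padic set" where
  "roots_Zp p f = {x \<in> Zp p. f x = \<zero>\<^bsub>Qp p\<^esub>}"

text \<open>
  The multiplicity of \<open>t\<close> as a root of \<open>f\<close> is the largest \<open>m\<close> such that \<open>(x - t)^m\<close> divides \<open>f\<close>
  among analytic functions. Such a largest \<open>m\<close> exists when \<open>f\<close> is analytic and not identically
  zero.
\<close>

definition root_mult :: "nat \<Rightarrow> (padic \<Rightarrow> padic) \<Rightarrow> padic \<Rightarrow> nat" where
  "root_mult p f t =
     (GREATEST m. \<exists>g. analytic_Zp p g \<and>
        (\<forall>x\<in>Zp p. f x = (x \<ominus>\<^bsub>Qp p\<^esub> t) [^]\<^bsub>Qp p\<^esub> m \<otimes>\<^bsub>Qp p\<^esub> g x))"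


section \<open>Products over the prime divisors of b\<close>

text \<open>
  An element of the product of the \<open>Qp (p i)\<close>, for \<open>i = 1, \<dots>, s\<close>, is an extensional function on
  \<open>{1..s}\<close>.
\<close>

definition Zb :: "nat \<Rightarrow> (nat \<Rightarrow> nat) \<Rightarrow> (nat \<Rightarrow> padic) set" where
  "Zb s p = (\<Pi>\<^sub>E i\<in>{1..s}. Zp (p i))"

definition diag :: "nat \<Rightarrow> (nat \<Rightarrow> nat) \<Rightarrow> rat \<Rightarrow> nat \<Rightarrow> padic" where
  "diag s p q = (\<lambda>i\<in>{1..s}. of_rat_Qp (p i) q)"

definition eval_b :: "nat \<Rightarrow> (nat \<Rightarrow> padic \<Rightarrow> padic) \<Rightarrow> (nat \<Rightarrow> padic) \<Rightarrow> nat \<Rightarrow> padic" where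
  "eval_b s f x = (\<lambda>i\<in>{1..s}. f i (x i))"

definition roots_b :: "nat \<Rightarrow> (nat \<Rightarrow> nat) \<Rightarrow> (nat \<Rightarrow> padic \<Rightarrow> padic) \<Rightarrow> (nat \<Rightarrow> padic) set" where
  "roots_b s p f = (\<Pi>\<^sub>E i\<in>{1..s}. roots_Zp (p i) (f i))"

text \<open>The floor of \<open>v / l\<close>, with \<open>\<infinity>\<close> for \<open>v = \<infinity>\<close>; the value \<open>-\<infinity>\<close> never occurs as a valuation.\<close>

definition floor_div :: "int extended \<Rightarrow> nat \<Rightarrow> int extended" where
  "floor_div v l = (case v of Fin z \<Rightarrow> Fin (z div int l) | \<infinity> \<Rightarrow> \<infinity> | -\<infinity> \<Rightarrow> -\<infinity>)"

definition val_b ::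
    "nat \<Rightarrow> (nat \<Rightarrow> nat) \<Rightarrow> (nat \<Rightarrow> nat) \<Rightarrow> (nat \<Rightarrow> padic) \<Rightarrow> int extended" where
  "val_b s p l x = Min ((\<lambda>i. floor_div (val_Qp (p i) (x i)) (l i)) ` {1..s})"


section \<open>Regular sequences of integers\<close>

text \<open>
  Values are taken in the module of integers; submodules of the module of integer sequences are spans
  for the pointwise scalar multiplication.
\<close>

interpretation int_seq: module "\<lambda>(c::int) (g::nat \<Rightarrow> int) n. c * g n"
  by unfold_locales (auto simp: algebra_simps)

definition kernel :: "nat \<Rightarrow> (nat \<Rightarrow> int) \<Rightarrow> (nat \<Rightarrow> int) set" where
  "kernel k a = {\<lambda>n. a (k ^ i * n + j) | i j. j \<le> k ^ i - 1}"

definition k_regular :: "nat \<Rightarrow> (nat \<Rightarrow> int) \<Rightarrow> bool" where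
  "k_regular k a \<longleftrightarrow> (\<exists>B. finite B \<and> int_seq.span B = int_seq.span (kernel k a))"

definition regular :: "(nat \<Rightarrow> int) \<Rightarrow> bool" where
  "regular a \<longleftrightarrow> (\<exists>k\<ge>2. k_regular k a)"

definition mult_indep :: "nat \<Rightarrow> nat \<Rightarrow> bool" where
  "mult_indep k m \<longleftrightarrow> (\<forall>a\<ge>1. \<forall>c\<ge>1. k ^ a \<noteq> m ^ c)"

definition strictly_k_regular :: "nat \<Rightarrow> (nat \<Rightarrow> int) \<Rightarrow> bool" where
  "strictly_k_regular k a \<longleftrightarrow>
     k_regular k a \<and> (\<forall>m\<ge>2. mult_indep k m \<longrightarrow> \<not> k_regular m a)"

definition has_period :: "nat \<Rightarrow> (nat \<Rightarrow> int) \<Rightarrow> bool" where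
  "has_period t a \<longleftrightarrow> 0 < t \<and> (\<forall>n. a (n + t) = a n)"

end

theory Submission
  imports Defs "HOL-Number_Theory.Cong"
begin

text \<open>
  A point \<open>x\<close> of the product of the \<open>Zp (p i)\<close> is a singularity of a sequence \<open>g\<close> if \<open>g n\<close> is unbounded as
  \<open>n\<close> tends to \<open>x\<close>. The sequence \<open>a\<close> is singular exactly at the common roots, and \<open>n \<mapsto> a (k ^ i * n + j)\<close>
  exactly at the \<open>x\<close> for which \<open>k ^ i * x + j\<close> is a common root. If \<open>a\<close> is \<open>k\<close>-regular, finitely many kernel
  sequences generate all of them, so only finitely many \<open>x\<close> are singularities of kernel sequences.
  Counting preimages shows that every prime factor of \<open>k\<close> is one of the \<open>p i\<close>, and the pigeonhole
  principle gives \<open>k ^ i * x + j = k ^ i' * x + j'\<close> with \<open>i \<noteq> i'\<close> for some \<open>x\<close> above a given common root, which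
  is therefore a diagonal rational point. If there are several common roots, mixing their coordinates
  yields one off the diagonal.

  If the only common root is the rational \<open>\<theta>\<close>, then \<open>a n\<close> is the minimum of the floors of
  \<open>(m i * v (n - \<theta>) + h i n) / l i\<close>, with \<open>v\<close> the \<open>p i\<close>-adic valuation, \<open>m i\<close> the multiplicity and
  \<open>h i\<close> periodic. Near \<open>\<theta>\<close>, multiplication of \<open>n - \<theta>\<close> by \<open>k\<close> raises all terms by the same amount
  precisely when \<open>m i\<close> times the exponent of \<open>p i\<close> in \<open>k\<close>, divided by \<open>l i\<close>, does not depend on \<open>i\<close>.
  For the stated \<open>k\<close> this holds and the kernel is spanned by finitely many sequences; when it fails, the
  thresholds at which one term of the minimum overtakes another drift to infinity along the kernel.

  Everything p-adic is computed on representing Cauchy sequences of rationals, which live in the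
  commutative ring \<open>nat \<Rightarrow> rat\<close>, modulo null sequences.
\<close>

section \<open>The p-adic valuation on the rationals\<close>

text \<open>Regularity is refuted through submodules: the sequences bounded near a point, and those
  constant on a suitable set of indices, each form one, so a property of finitely many generators
  spreads to the whole kernel. The exponents of k come from the following count. If q^i x + j =
  \<theta>, then q^i n + j - \<theta> = q^i (n - x), so with e_r the exponent of p_r in q, the r-th
  term of the minimum grows with i at slope m_r e_r / l_r. Equal slopes say that the e_r are
  proportional to l_r / m_r. The exponents l_r w_r of k have this property because w_r m_r is
  constant, and integers above 1 with proportional exponent vectors have a common power. Hence only
  bases multiplicatively dependent on k survive. Two nuisances shape the details: the valuations h_r
  of the cofactors are only locally constant, which brings in a precision N and a bound M; and the
  value of \<open>a\<close> at a common integer zero is arbitrary, so estimates must avoid such an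
  index or absorb it by a sequence supported at one point.\<close>

definition rball :: "nat \<Rightarrow> int \<Rightarrow> rat set" where
  "rball p k = {x. Fin k \<le> val_rat p x}"

lemma val_rat_0 [simp]: "val_rat p 0 = \<infinity>"
  by (simp add: val_rat_def)

lemma val_rat_eq_Fin: "x \<noteq> 0 \<Longrightarrow> \<exists>v. val_rat p x = Fin v"
  by (simp add: val_rat_def)

lemma val_rat_eq_infinity_iff [simp]: "val_rat p x = \<infinity> \<longleftrightarrow> x = 0"
  by (simp add: val_rat_def)

lemma val_rat_ne_Minf [simp]: "val_rat p x \<noteq> -\<infinity>"
  by (simp add: val_rat_def)

text \<open>\<open>quotient_of\<close> only knows lowest terms. Cross-multiplying them with a / b
  and taking multiplicities shows that every fraction gives the same difference, so products can be
  computed without reducing.\<close>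

lemma val_rat_frac:
  assumes "prime p" "a \<noteq> 0" "b \<noteq> 0"
  shows "val_rat p (of_int a / of_int b) =
    Fin (int (multiplicity (int p) a) - int (multiplicity (int p) b))"
proof -
  let ?x = "of_int a / of_int b :: rat"
  obtain c d where cd: "quotient_of ?x = (c, d)" by force
  have "d > 0" using quotient_of_denom_pos[OF cd] .
  have x: "?x = of_int c / of_int d" using quotient_of_div[OF cd] .
  have "?x \<noteq> 0" using assms by simp
  then have "c \<noteq> 0" using x by auto
  have "of_int (a * d) = (of_int (c * b) :: rat)"
    using x \<open>d > 0\<close> assms by (simp add: field_simps)
  then have "a * d = c * b" by (simp only: of_int_eq_iff)
  moreover have "prime_elem (int p)" using assms(1) by simp
  ultimately have "multiplicity (int p) a + multiplicity (int p) d
      = multiplicity (int p) c + multiplicity (int p) b"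
    using assms \<open>d > 0\<close> \<open>c \<noteq> 0\<close> prime_elem_multiplicity_mult_distrib
    by (metis less_irrefl)
  then show ?thesis using \<open>?x \<noteq> 0\<close> cd by (simp add: val_rat_def)
qed

lemma rat_fracE:
  fixes x :: rat
  obtains a b :: int where "x = of_int a / of_int b" "b \<noteq> 0"
  using quotient_of_div[of x] quotient_of_denom_pos[of x]
  by (metis less_irrefl prod.collapse)

lemma val_rat_mult:
  assumes p: "prime p" shows "val_rat p (x * y) = val_rat p x + val_rat p y"
proof (cases "x = 0 \<or> y = 0")
  case True
  then show ?thesis
    using val_rat_eq_Fin by (metis mult_zero_left mult_zero_right plus_extended.simps(2-4) val_rat_0)
next
  case False
  obtain a b where x: "x = of_int a / of_int b" "b \<noteq> 0" by (rule rat_fracE)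
  obtain c d where y: "y = of_int c / of_int d" "d \<noteq> 0" by (rule rat_fracE)
  have nz: "a \<noteq> 0" "c \<noteq> 0" using False x y by auto
  have "x * y = of_int (a * c) / of_int (b * d)" using x y by simp
  then have "val_rat p (x * y) =
      Fin (int (multiplicity (int p) (a * c)) - int (multiplicity (int p) (b * d)))"
    using val_rat_frac[OF p, of "a * c" "b * d"] nz x y by simp
  also have "\<dots> = Fin (int (multiplicity (int p) a) - int (multiplicity (int p) b))
      + Fin (int (multiplicity (int p) c) - int (multiplicity (int p) d))"
    using p nz x y by (simp add: prime_elem_multiplicity_mult_distrib)
  finally show ?thesis using val_rat_frac[OF p] nz x y by simp
qed

lemma val_rat_of_int_ge_iff:
  assumes p: "prime p"
  shows "Fin (int k) \<le> val_rat p (of_int a) \<longleftrightarrow> int p ^ k dvd a"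
proof (cases "a = 0")
  case False
  have "\<not> is_unit (int p)" using p by (simp add: prime_nat_iff)
  then show ?thesis
    using val_rat_frac[OF p False, of 1] False power_dvd_iff_le_multiplicity[of a "int p" k] by simp
qed auto

lemma val_rat_1 [simp]: "prime p \<Longrightarrow> val_rat p 1 = Fin 0"
  using val_rat_frac[of p 1 1] by simp

lemma val_rat_minus [simp]: "prime p \<Longrightarrow> val_rat p (- x) = val_rat p x"
proof -
  assume p: "prime p"
  have "val_rat p (-1) = Fin 0" using val_rat_frac[OF p, of "-1" 1] by simp
  then have "val_rat p (-1 * x) = Fin 0 + val_rat p x"
    by (simp only: val_rat_mult[OF p])
  moreover have "Fin 0 + val_rat p x = val_rat p x"
    by (metis add.left_neutral zero_extended_def)
  ultimately show ?thesis by simp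
qed

section \<open>Balls around 0 as fractional ideals, and the ultrametric inequality\<close>

lemma rball_0 [simp]: "0 \<in> rball p k"
  by (simp add: rball_def)

lemma rball_mono: "x \<in> rball p k \<Longrightarrow> k' \<le> k \<Longrightarrow> x \<in> rball p k'"
  unfolding rball_def by (auto intro: order_trans[rotated])

lemma rball_of_int_iff: "prime p \<Longrightarrow> of_int a \<in> rball p (int k) \<longleftrightarrow> int p ^ k dvd a"
  by (simp add: rball_def val_rat_of_int_ge_iff)

lemma rball_of_int: "prime p \<Longrightarrow> of_int a \<in> rball p 0"
  using rball_of_int_iff[of p a 0] by simp

lemma rball_of_nat: "prime p \<Longrightarrow> of_nat n \<in> rball p 0"
  using rball_of_int[of p "int n"] by simp

lemma rball_mult:
  assumes p: "prime p" and x: "x \<in> rball p k" and y: "y \<in> rball p l"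
  shows "x * y \<in> rball p (k + l)"
proof (cases "x = 0 \<or> y = 0")
  case False
  then obtain v w where "val_rat p x = Fin v" "val_rat p y = Fin w"
    using val_rat_eq_Fin by metis
  then show ?thesis using x y by (simp add: rball_def val_rat_mult[OF p])
qed auto

lemma rball_uminus: "prime p \<Longrightarrow> x \<in> rball p k \<Longrightarrow> - x \<in> rball p k"
  by (simp add: rball_def)

lemma rball_prime_powi:
  assumes p: "prime p"
  shows "val_rat p (of_nat p powi k) = Fin k"
proof -
  have pos: "val_rat p (of_nat p ^ n) = Fin (int n)" for n
  proof -
    have "\<not> is_unit (int p)" using p by (simp add: prime_nat_iff)
    then have "multiplicity (int p) (int p ^ n) = n" using p
      by (intro multiplicity_same_power) auto
    then show ?thesis using val_rat_frac[OF p, of "int p ^ n" 1] p by simp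
  qed
  show ?thesis
  proof (cases "k \<ge> 0")
    case True
    then show ?thesis using pos[of "nat k"] by (simp add: power_int_def)
  next
    case False
    have "val_rat p (of_nat p powi k) + val_rat p (of_nat p ^ nat (-k)) = val_rat p 1"
      using False p by (subst val_rat_mult[symmetric, OF p]) (simp add: power_int_def field_simps)
    then have "val_rat p (of_nat p powi k) + Fin (-k) = Fin 0"
      using pos[of "nat (-k)"] False p by simp
    then show ?thesis by (cases "val_rat p (of_nat p powi k)") auto
  qed
qed

text \<open>If p divided the reduced denominator, it could not divide the numerator, and the
  valuation would be negative.\<close>

lemma rball_0_frac:
  assumes p: "prime p" and x: "x \<in> rball p 0"
  obtains a b where "x = of_int a / of_int b" "coprime b (int p)" "b \<noteq> 0"
proof (cases "x = 0")
  case True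
  then show ?thesis using that[of 0 1] by auto
next
  case False
  obtain a b where ab: "quotient_of x = (a, b)" by force
  have z: "x = of_int a / of_int b" "b > 0" "coprime a b"
    using quotient_of_div[OF ab] quotient_of_denom_pos[OF ab] quotient_of_coprime[OF ab] by auto
  have anz: "a \<noteq> 0" using False z by auto
  have "\<not> int p dvd b"
  proof
    assume d: "int p dvd b"
    then have "\<not> int p dvd a" using z(3) p
      by (metis coprime_common_divisor int_ops(2) nat_dvd_1_iff_1 not_prime_1 int_dvd_int_iff)
    then have "multiplicity (int p) a = 0" by (simp add: not_dvd_imp_multiplicity_0)
    moreover have "multiplicity (int p) b > 0"
      using d z(2) p by (simp add: prime_multiplicity_gt_zero_iff)
    ultimately show False using x val_rat_frac[OF p anz, of b] z by (simp add: rball_def)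
  qed
  then have "coprime (int p) b" using p by (simp add: prime_imp_coprime)
  then show ?thesis using that z by (simp add: coprime_commute)
qed

text \<open>Multiplication by a rational of valuation -k reduces to k = 0, where fractions with
  denominator prime to p are visibly closed under addition.\<close>

lemma rball_add:
  assumes p: "prime p" and x: "x \<in> rball p k" and y: "y \<in> rball p k"
  shows "x + y \<in> rball p k"
proof -
  have int: "\<exists>a b. z = of_int a / of_int b \<and> \<not> int p dvd b" if z: "z \<in> rball p 0" for z
  proof -
    obtain a b where "z = of_int a / of_int b" "coprime b (int p)" using rball_0_frac[OF p z] by metis
    then show ?thesis using p
      by (metis coprime_common_divisor int_ops(2) nat_dvd_1_iff_1 not_prime_1 int_dvd_int_iff dvd_refl)
  qed
  define q where "q = (of_nat p powi k :: rat)"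
  have q: "q \<noteq> 0" "val_rat p q = Fin k" "val_rat p (inverse q) = Fin (-k)"
    using p rball_prime_powi[OF p, of k] rball_prime_powi[OF p, of "-k"]
    by (auto simp: q_def power_int_minus)
  have "x * inverse q \<in> rball p 0" "y * inverse q \<in> rball p 0"
    using rball_mult[OF p x, of "inverse q" "-k"] rball_mult[OF p y, of "inverse q" "-k"] q
    by (auto simp: rball_def)
  then obtain a b c d where e: "x * inverse q = of_int a / of_int b" "\<not> int p dvd b"
      "y * inverse q = of_int c / of_int d" "\<not> int p dvd d"
    using int by meson
  have nd: "\<not> int p dvd b * d" using e p by (simp add: prime_dvd_mult_iff)
  then have bd: "b \<noteq> 0" "d \<noteq> 0" by auto
  have "(x + y) * inverse q = of_int (a * d + c * b) / of_int (b * d)"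
    unfolding distrib_right e using bd by (simp add: field_simps)
  also have "\<dots> \<in> rball p 0"
  proof (cases "a * d + c * b = 0")
    case False
    have "multiplicity (int p) (b * d) = 0" using nd by (simp add: not_dvd_imp_multiplicity_0)
    then show ?thesis unfolding rball_def using val_rat_frac[OF p False, of "b * d"] bd by simp
  qed (simp only: of_int_0 div_0 rball_0)
  finally have "(x + y) * inverse q * q \<in> rball p (0 + k)"
    by (rule rball_mult[OF p]) (use q in \<open>simp add: rball_def\<close>)
  moreover have "(x + y) * inverse q * q = x + y" using q(1) by (simp add: mult.assoc)
  ultimately show ?thesis by simp
qed

lemma rball_diff: "prime p \<Longrightarrow> x \<in> rball p k \<Longrightarrow> y \<in> rball p k \<Longrightarrow> x - y \<in> rball p k"
  using rball_add[of p x k "- y"] rball_uminus by simp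

lemma rball_diff_swap: "prime p \<Longrightarrow> x - y \<in> rball p k \<Longrightarrow> y - x \<in> rball p k"
  using rball_uminus[of p "x - y" k] by simp

lemma rball_eq_0: "(\<And>k. x \<in> rball p k) \<Longrightarrow> x = 0"
  using val_rat_eq_Fin[of x p] unfolding rball_def
  by (metis less_eq_extended.simps(1) mem_Collect_eq not_less zless_add1_eq)

lemma rball_exists: "\<exists>k. x \<in> rball p k"
  using val_rat_eq_Fin[of x p] unfolding rball_def by (cases "x = 0") auto

lemma val_rat_eq_Fin_iff: "val_rat p x = Fin v \<longleftrightarrow> x \<in> rball p v \<and> x \<notin> rball p (v + 1)"
  unfolding rball_def by (cases "val_rat p x") auto

text \<open>Density of the naturals in the p-integral rationals: for x = a / b the denominator b has
  an inverse y modulo p^t, and a y reduced modulo p^t is the required approximation.\<close>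

lemma rball_approx_nat:
  assumes p: "prime p" and x: "x \<in> rball p 0"
  obtains n :: nat where "of_nat n - x \<in> rball p (int t)"
proof -
  obtain a b where ab: "x = of_int a / of_int b" "coprime b (int p)" "b \<noteq> 0"
    using rball_0_frac[OF p x] .
  have "coprime b (int p ^ t)" using ab by simp
  then obtain y where y: "[b * y = 1] (mod int p ^ t)" using cong_solve_coprime_int by blast
  define n where "n = nat ((a * y) mod int p ^ t)"
  have n: "int n = (a * y) mod int p ^ t" using p by (simp add: n_def prime_gt_0_nat)
  have "[b * int n = b * (a * y)] (mod int p ^ t)" unfolding n by (simp add: cong_def mod_mult_right_eq)
  also have "[b * (a * y) = a * 1] (mod int p ^ t)"
    using cong_scalar_left[OF y, of a] by (simp add: algebra_simps)
  finally have "int p ^ t dvd b * int n - a" by (simp add: cong_iff_dvd_diff)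
  then have "of_int (b * int n - a) \<in> rball p (int t)" using rball_of_int_iff[OF p] by blast
  moreover have "1 / of_int b \<in> rball p 0"
  proof -
    have "\<not> int p dvd b" using ab(2) p
      by (metis coprime_common_divisor int_ops(2) nat_dvd_1_iff_1 not_prime_1 int_dvd_int_iff dvd_refl)
    then have "multiplicity (int p) b = 0" by (simp add: not_dvd_imp_multiplicity_0)
    then show ?thesis using val_rat_frac[OF p, of 1 b] ab(3) by (simp add: rball_def)
  qed
  ultimately have "of_int (b * int n - a) * (1 / of_int b) \<in> rball p (int t + 0)"
    using rball_mult[OF p] by blast
  moreover have "of_int (b * int n - a) * (1 / of_int b) = of_nat n - x"
    using ab(1,3) by (simp add: field_simps)
  ultimately show ?thesis using that by simp
qed

lemma val_rat_of_nat:
  assumes p: "prime p" and n: "n \<noteq> 0"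
  shows "val_rat p (of_nat n) = Fin (int (multiplicity p n))"
proof -
  have iff: "Fin (int k) \<le> val_rat p (of_nat n) \<longleftrightarrow> k \<le> multiplicity p n" for k
  proof -
    have "\<not> is_unit p" using p by (simp add: prime_nat_iff)
    have "Fin (int k) \<le> val_rat p (of_int (int n)) \<longleftrightarrow> int (p ^ k) dvd int n"
      unfolding val_rat_of_int_ge_iff[OF p] by simp
    also have "\<dots> \<longleftrightarrow> k \<le> multiplicity p n"
      unfolding int_dvd_int_iff using n \<open>\<not> is_unit p\<close> by (simp add: power_dvd_iff_le_multiplicity)
    finally show ?thesis by simp
  qed
  obtain v where v: "val_rat p (of_nat n) = Fin v" using val_rat_eq_Fin n by force
  have "0 \<le> v" using iff[of 0] v by simp
  then show ?thesis using iff[of "nat v"] iff[of "multiplicity p n"] v by auto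
qed

lemma val_rat_power_of_nat:
  assumes p: "prime p" and n: "n \<noteq> 0"
  shows "val_rat p (of_nat (n ^ i)) = Fin (int (i * multiplicity p n))"
    and "val_rat p (1 / of_nat (n ^ i)) = Fin (- int (i * multiplicity p n))"
proof -
  show 1: "val_rat p (of_nat (n ^ i)) = Fin (int (i * multiplicity p n))"
    using val_rat_of_nat[OF p, of "n ^ i"] n p
    by (simp add: prime_elem_multiplicity_power_distrib del: of_nat_power)
  have "val_rat p (1 / of_nat (n ^ i)) + val_rat p (of_nat (n ^ i)) = val_rat p 1"
    using n by (subst val_rat_mult[symmetric, OF p]) simp
  then have "val_rat p (1 / of_nat (n ^ i)) + Fin (int (i * multiplicity p n)) = Fin 0"
    using 1 p by simp
  then show "val_rat p (1 / of_nat (n ^ i)) = Fin (- int (i * multiplicity p n))"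
    by (cases "val_rat p (1 / of_nat (n ^ i))") (use n in auto)
qed

text \<open>An integer is wanted for linear arithmetic. The value 0 at the argument 0 is a
  placeholder; the uses below keep the argument away from 0.\<close>

definition nu :: "nat \<Rightarrow> rat \<Rightarrow> int" where
  "nu p x = (case val_rat p x of Fin v \<Rightarrow> v | _ \<Rightarrow> 0)"

lemma val_rat_nu: "x \<noteq> 0 \<Longrightarrow> val_rat p x = Fin (nu p x)"
  using val_rat_eq_Fin[of x p] by (auto simp: nu_def)

lemma nu_eqI: "val_rat p x = Fin v \<Longrightarrow> nu p x = v"
  by (simp add: nu_def)

lemma rball_nu_iff: "x \<noteq> 0 \<Longrightarrow> x \<in> rball p k \<longleftrightarrow> k \<le> nu p x"
  by (simp add: rball_def val_rat_nu)

lemma nu_mult: "prime p \<Longrightarrow> x \<noteq> 0 \<Longrightarrow> y \<noteq> 0 \<Longrightarrow> nu p (x * y) = nu p x + nu p y"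
  by (rule nu_eqI, subst val_rat_mult) (auto simp: val_rat_nu)

text \<open>The summand of smaller valuation decides. Stating the condition on y by a ball admits y
  = 0, which has no integer valuation.\<close>

lemma nu_add_eq:
  assumes p: "prime p" and x: "x \<noteq> 0" and y: "y \<in> rball p (nu p x + 1)"
  shows "x + y \<noteq> 0" "nu p (x + y) = nu p x"
proof -
  have x1: "x \<in> rball p (nu p x)" "x \<notin> rball p (nu p x + 1)"
    using rball_nu_iff[OF x] by auto
  have "x + y \<in> rball p (nu p x)" by (rule rball_add[OF p x1(1) rball_mono[OF y]]) simp
  moreover have "x + y \<notin> rball p (nu p x + 1)"
    using rball_diff[OF p _ y, of "x + y"] x1(2) by auto
  ultimately have "val_rat p (x + y) = Fin (nu p x)" by (simp add: val_rat_eq_Fin_iff)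
  then show "x + y \<noteq> 0" "nu p (x + y) = nu p x" by (auto simp: nu_eqI)
qed

lemma nu_of_nat_power: "prime p \<Longrightarrow> n \<noteq> 0 \<Longrightarrow> nu p (of_nat (n ^ i)) = int (i * multiplicity p n)"
  by (rule nu_eqI) (rule val_rat_power_of_nat)

lemma rball_of_nat_power:
  "prime p \<Longrightarrow> n \<noteq> 0 \<Longrightarrow> of_nat (n ^ i) \<in> rball p (int (i * multiplicity p n))"
  by (simp add: rball_def val_rat_power_of_nat del: of_nat_power)

section \<open>Rational Cauchy sequences\<close>

abbreviation Cauchy_seqs :: "nat \<Rightarrow> (nat \<Rightarrow> rat) set" where
  "Cauchy_seqs p \<equiv> {X. padic_Cauchy p X}"

text \<open>The ball of the completion, seen on representatives: asking for the condition at almost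
  all indices makes it invariant under adding null sequences, which are the common elements of all
  these balls.\<close>

definition sball :: "nat \<Rightarrow> int \<Rightarrow> (nat \<Rightarrow> rat) set" where
  "sball p k = {X. \<forall>\<^sub>F n in sequentially. X n \<in> rball p k}"

text \<open>A relation and not a function, since a null sequence has no valuation in the
  integers.\<close>

definition seq_val :: "nat \<Rightarrow> (nat \<Rightarrow> rat) \<Rightarrow> int \<Rightarrow> bool" where
  "seq_val p X v \<longleftrightarrow> (\<forall>\<^sub>F n in sequentially. val_rat p (X n) = Fin v)"

lemma padic_null_iff: "X \<in> padic_null p \<longleftrightarrow> (\<forall>k. X \<in> sball p k)"
  by (simp add: padic_null_def sball_def rball_def)

lemma padic_nullD: "X \<in> padic_null p \<Longrightarrow> X \<in> sball p k"
  by (simp add: padic_null_iff)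

lemma sball_0 [simp]: "0 \<in> sball p k"
  by (simp add: sball_def)

lemma sball_const [simp]: "(\<lambda>_. x) \<in> sball p k \<longleftrightarrow> x \<in> rball p k"
  by (simp add: sball_def)

lemma sball_of_nat: "prime p \<Longrightarrow> of_nat n \<in> sball p 0"
  by (simp add: of_nat_fun rball_of_nat)

lemma sball_mono: "X \<in> sball p k \<Longrightarrow> k' \<le> k \<Longrightarrow> X \<in> sball p k'"
  unfolding sball_def using rball_mono by (auto elim: eventually_mono)

lemma sball_add: "prime p \<Longrightarrow> X \<in> sball p k \<Longrightarrow> Y \<in> sball p k \<Longrightarrow> X + Y \<in> sball p k"
  unfolding sball_def by (auto elim: eventually_elim2 simp: rball_add)

lemma sball_uminus: "prime p \<Longrightarrow> X \<in> sball p k \<Longrightarrow> - X \<in> sball p k"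
  unfolding sball_def by (auto elim: eventually_mono simp: rball_uminus)

lemma sball_diff: "prime p \<Longrightarrow> X \<in> sball p k \<Longrightarrow> Y \<in> sball p k \<Longrightarrow> X - Y \<in> sball p k"
  unfolding sball_def by (auto elim: eventually_elim2 simp: rball_diff)

lemma sball_diff_swap: "prime p \<Longrightarrow> X - Y \<in> sball p k \<Longrightarrow> Y - X \<in> sball p k"
  using sball_uminus[of p "X - Y" k] by simp

lemma sball_diff_trans:
  "prime p \<Longrightarrow> X - Y \<in> sball p k \<Longrightarrow> Y - Z \<in> sball p k \<Longrightarrow> X - Z \<in> sball p k"
  using sball_add[of p "X - Y" k "Y - Z"] by simp

lemma sball_diff_iff:
  "prime p \<Longrightarrow> X - Y \<in> sball p k \<Longrightarrow> X \<in> sball p k \<longleftrightarrow> Y \<in> sball p k"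
  using sball_add[of p "X - Y" k Y] sball_diff[of p X k "X - Y"] by auto

lemma sball_mult: "prime p \<Longrightarrow> X \<in> sball p k \<Longrightarrow> Y \<in> sball p l \<Longrightarrow> X * Y \<in> sball p (k + l)"
  unfolding sball_def by (auto elim: eventually_elim2 simp: rball_mult)

lemma sball_mult_int: "prime p \<Longrightarrow> X \<in> sball p k \<Longrightarrow> Y \<in> sball p 0 \<Longrightarrow> X * Y \<in> sball p k"
  using sball_mult[of p X k Y 0] by simp

lemma sball_power: "prime p \<Longrightarrow> X \<in> sball p 0 \<Longrightarrow> X ^ n \<in> sball p 0"
  using sball_of_nat[of p 1] by (induction n) (auto dest: sball_mult_int)

lemma sball_sum: "prime p \<Longrightarrow> (\<And>i. i \<in> A \<Longrightarrow> f i \<in> sball p k) \<Longrightarrow> sum f A \<in> sball p k"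
  by (induction A rule: infinite_finite_induct) (auto simp: sball_add)

lemma padic_null_0 [simp]: "0 \<in> padic_null p"
  by (simp add: padic_null_iff)

lemma padic_null_add: "prime p \<Longrightarrow> X \<in> padic_null p \<Longrightarrow> Y \<in> padic_null p \<Longrightarrow> X + Y \<in> padic_null p"
  by (simp add: padic_null_iff sball_add)

lemma padic_null_uminus: "prime p \<Longrightarrow> X \<in> padic_null p \<Longrightarrow> - X \<in> padic_null p"
  by (simp add: padic_null_iff sball_uminus)

lemma padic_null_diff: "prime p \<Longrightarrow> X \<in> padic_null p \<Longrightarrow> Y \<in> padic_null p \<Longrightarrow> X - Y \<in> padic_null p"
  by (simp add: padic_null_iff sball_diff)

lemma padic_null_diff_trans:
  "prime p \<Longrightarrow> X - Y \<in> padic_null p \<Longrightarrow> Y - Z \<in> padic_null p \<Longrightarrow> X - Z \<in> padic_null p"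
  by (auto simp: padic_null_iff intro: sball_diff_trans)

lemma padic_null_diff_swap: "prime p \<Longrightarrow> X - Y \<in> padic_null p \<Longrightarrow> Y - X \<in> padic_null p"
  by (simp add: padic_null_iff sball_diff_swap)

lemma const_padic_null_iff: "(\<lambda>_. c) \<in> padic_null p \<longleftrightarrow> c = 0"
  using rball_eq_0[of c p] by (auto simp: padic_null_iff)

section \<open>The ring of Cauchy sequences and its prime ideal of null sequences\<close>

lemma padic_Cauchy_iff:
  "padic_Cauchy p X \<longleftrightarrow> (\<forall>k. \<exists>N. \<forall>m\<ge>N. \<forall>n\<ge>N. X m - X n \<in> rball p k)"
  by (simp add: padic_Cauchy_def rball_def)

lemma padic_Cauchy_const [simp]: "padic_Cauchy p (\<lambda>_. x)"
  by (simp add: padic_Cauchy_iff)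

lemma padic_Cauchy_0 [simp]: "padic_Cauchy p 0"
  using padic_Cauchy_const[of p 0] by (simp add: zero_fun_def)

lemma padic_Cauchy_1 [simp]: "padic_Cauchy p 1"
  using padic_Cauchy_const[of p 1] by (simp add: one_fun_def)

lemma padic_Cauchy_of_nat [simp]: "padic_Cauchy p (of_nat n)"
  by (simp add: of_nat_fun)

lemma padic_Cauchy_add:
  assumes p: "prime p" and X: "padic_Cauchy p X" and Y: "padic_Cauchy p Y"
  shows "padic_Cauchy p (X + Y)"
  unfolding padic_Cauchy_iff
proof
  fix k
  obtain N where N: "\<And>m n. m \<ge> N \<Longrightarrow> n \<ge> N \<Longrightarrow> X m - X n \<in> rball p k"
    using X unfolding padic_Cauchy_iff by blast
  obtain M where M: "\<And>m n. m \<ge> M \<Longrightarrow> n \<ge> M \<Longrightarrow> Y m - Y n \<in> rball p k"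
    using Y unfolding padic_Cauchy_iff by blast
  have "(X + Y) m - (X + Y) n \<in> rball p k" if "m \<ge> max M N" "n \<ge> max M N" for m n
    using rball_add[OF p N[of m n] M[of m n]] that by (simp add: algebra_simps)
  then show "\<exists>N. \<forall>m\<ge>N. \<forall>n\<ge>N. (X + Y) m - (X + Y) n \<in> rball p k" by blast
qed

lemma padic_Cauchy_uminus:
  assumes p: "prime p" and X: "padic_Cauchy p X"
  shows "padic_Cauchy p (- X)"
  using X rball_diff_swap[OF p] unfolding padic_Cauchy_iff by (simp add: algebra_simps) blast

lemma padic_Cauchy_diff:
  "prime p \<Longrightarrow> padic_Cauchy p X \<Longrightarrow> padic_Cauchy p Y \<Longrightarrow> padic_Cauchy p (X - Y)"
  using padic_Cauchy_add[of p X "- Y"] padic_Cauchy_uminus[of p Y] by simp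

lemma padic_Cauchy_sball:
  assumes p: "prime p" and X: "padic_Cauchy p X"
  obtains k where "X \<in> sball p k"
proof -
  obtain N where N: "\<And>m n. m \<ge> N \<Longrightarrow> n \<ge> N \<Longrightarrow> X m - X n \<in> rball p 0"
    using X unfolding padic_Cauchy_iff by blast
  obtain k where k: "X N \<in> rball p k" using rball_exists by blast
  have "X n \<in> rball p (min k 0)" if "n \<ge> N" for n
    using rball_add[OF p rball_mono[OF N[of n N]] rball_mono[OF k], of "min k 0"] that by simp
  then have "X \<in> sball p (min k 0)" unfolding sball_def eventually_sequentially by blast
  then show ?thesis using that by blast
qed

lemma padic_Cauchy_mult:
  assumes p: "prime p" and X: "padic_Cauchy p X" and Y: "padic_Cauchy p Y"
  shows "padic_Cauchy p (X * Y)"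
  unfolding padic_Cauchy_iff
proof
  fix k
  obtain a where a: "X \<in> sball p a" using padic_Cauchy_sball[OF p X] .
  obtain b where b: "Y \<in> sball p b" using padic_Cauchy_sball[OF p Y] .
  obtain A where A: "\<And>n. n \<ge> A \<Longrightarrow> X n \<in> rball p a"
    using a unfolding sball_def eventually_sequentially by blast
  obtain B where B: "\<And>n. n \<ge> B \<Longrightarrow> Y n \<in> rball p b"
    using b unfolding sball_def eventually_sequentially by blast
  obtain N where N: "\<And>m n. m \<ge> N \<Longrightarrow> n \<ge> N \<Longrightarrow> X m - X n \<in> rball p (k - b)"
    using X unfolding padic_Cauchy_iff by blast
  obtain M where M: "\<And>m n. m \<ge> M \<Longrightarrow> n \<ge> M \<Longrightarrow> Y m - Y n \<in> rball p (k - a)"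
    using Y unfolding padic_Cauchy_iff by blast
  let ?K = "max (max A B) (max M N)"
  have "(X * Y) m - (X * Y) n \<in> rball p k" if mn: "m \<ge> ?K" "n \<ge> ?K" for m n
  proof -
    have "(X m - X n) * Y m \<in> rball p (k - b + b)" "X n * (Y m - Y n) \<in> rball p (a + (k - a))"
      using mn by (intro rball_mult[OF p] A B N M; simp)+
    then have "(X m - X n) * Y m + X n * (Y m - Y n) \<in> rball p k"
      by (intro rball_add[OF p]) simp_all
    then show ?thesis by (simp add: algebra_simps)
  qed
  then show "\<exists>N. \<forall>m\<ge>N. \<forall>n\<ge>N. (X * Y) m - (X * Y) n \<in> rball p k" by blast
qed

lemma padic_Cauchy_power: "prime p \<Longrightarrow> padic_Cauchy p X \<Longrightarrow> padic_Cauchy p (X ^ n)"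
  by (induction n) (auto simp: padic_Cauchy_mult)

lemma padic_Cauchy_sum:
  "prime p \<Longrightarrow> (\<And>i. i \<in> A \<Longrightarrow> padic_Cauchy p (f i)) \<Longrightarrow> padic_Cauchy p (sum f A)"
  by (induction A rule: infinite_finite_induct) (auto simp: padic_Cauchy_add)

lemma padic_null_Cauchy:
  assumes p: "prime p" and X: "X \<in> padic_null p"
  shows "padic_Cauchy p X"
  unfolding padic_Cauchy_iff
proof
  fix k
  obtain N where "\<And>n. n \<ge> N \<Longrightarrow> X n \<in> rball p k"
    using X unfolding padic_null_iff sball_def eventually_sequentially by blast
  then have "\<forall>m\<ge>N. \<forall>n\<ge>N. X m - X n \<in> rball p k" using rball_diff[OF p] by blast
  then show "\<exists>N. \<forall>m\<ge>N. \<forall>n\<ge>N. X m - X n \<in> rball p k" by blast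
qed

lemma padic_null_mult:
  assumes p: "prime p" and X: "X \<in> padic_null p" and Y: "padic_Cauchy p Y"
  shows "X * Y \<in> padic_null p"
  unfolding padic_null_iff
proof
  fix k
  obtain a where a: "Y \<in> sball p a" using padic_Cauchy_sball[OF p Y] .
  have "X \<in> sball p (k - a)" using X by (simp add: padic_null_iff)
  then show "X * Y \<in> sball p k" using sball_mult[OF p _ a] by fastforce
qed

lemma seq_val_sball:
  assumes "seq_val p X v" shows "X \<in> sball p k \<longleftrightarrow> k \<le> v"
proof -
  have ev: "\<forall>\<^sub>F n in sequentially. X n \<in> rball p k \<longleftrightarrow> k \<le> v"
    using assms unfolding seq_val_def by eventually_elim (simp add: rball_def)
  show ?thesis
  proof
    assume "X \<in> sball p k"
    then have "\<forall>\<^sub>F n in sequentially. X n \<in> rball p k" by (simp add: sball_def)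
    with ev have "\<forall>\<^sub>F n in sequentially::nat filter. k \<le> v" by eventually_elim blast
    then show "k \<le> v" by simp
  next
    assume "k \<le> v"
    then show "X \<in> sball p k" using ev by (simp add: sball_def)
  qed
qed

lemma seq_val_unique: "seq_val p X v \<Longrightarrow> seq_val p X w \<Longrightarrow> v = w"
  using seq_val_sball[of p X v v] seq_val_sball[of p X v w] seq_val_sball[of p X w v]
    seq_val_sball[of p X w w] by auto

lemma seq_val_not_null: "seq_val p X v \<Longrightarrow> X \<notin> padic_null p"
  using seq_val_sball[of p X v "v + 1"] by (auto simp: padic_null_iff)

lemma seq_val_const [simp]: "seq_val p (\<lambda>_. x) v \<longleftrightarrow> val_rat p x = Fin v"
  by (simp add: seq_val_def)

lemma seq_val_mult:
  assumes p: "prime p" and X: "seq_val p X v" and Y: "seq_val p Y w"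
  shows "seq_val p (X * Y) (v + w)"
  using X Y unfolding seq_val_def by eventually_elim (simp add: val_rat_mult[OF p])

lemma seq_val_power: "prime p \<Longrightarrow> seq_val p X v \<Longrightarrow> seq_val p (X ^ n) (int n * v)"
proof (induction n)
  case 0
  then show ?case by (simp add: seq_val_def)
next
  case (Suc n)
  then show ?case using seq_val_mult[of p X v "X ^ n" "int n * v"] unfolding power_Suc by (simp only: of_nat_Suc distrib_right mult_1)
qed

lemma seq_val_add:
  assumes p: "prime p" and X: "seq_val p X v" and Y: "Y \<in> sball p (v + 1)"
  shows "seq_val p (X + Y) v"
  using X Y unfolding seq_val_def sball_def mem_Collect_eq
proof eventually_elim
  case (elim n)
  have X: "X n \<in> rball p v" "X n \<notin> rball p (v + 1)" using elim(1) val_rat_eq_Fin_iff by blast+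
  have "X n + Y n \<in> rball p v" using rball_add[OF p X(1) rball_mono[OF elim(2)]] by simp
  moreover have "X n + Y n \<notin> rball p (v + 1)"
    using rball_diff[OF p _ elim(2), of "X n + Y n"] X(2) by auto
  ultimately show ?case by (simp add: val_rat_eq_Fin_iff)
qed

text \<open>If X leaves the ball of index k infinitely often, then beyond the point where all
  differences lie in that ball a single term outside it imposes its valuation on all later
  terms.\<close>

lemma padic_Cauchy_cases:
  assumes p: "prime p" and X: "padic_Cauchy p X"
  obtains "X \<in> padic_null p" | v where "seq_val p X v"
proof (cases "X \<in> padic_null p")
  case False
  then obtain k where k: "X \<notin> sball p k" by (auto simp: padic_null_iff)
  obtain N where N: "\<And>m n. m \<ge> N \<Longrightarrow> n \<ge> N \<Longrightarrow> X m - X n \<in> rball p k"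
    using X unfolding padic_Cauchy_iff by blast
  obtain n where n: "n \<ge> N" "X n \<notin> rball p k"
    using k unfolding sball_def eventually_sequentially by auto
  then obtain v where v: "val_rat p (X n) = Fin v"
    using val_rat_eq_Fin rball_0 by metis
  have vk: "v < k" using n(2) v by (simp add: rball_def)
  have Xn: "X n \<in> rball p v" "X n \<notin> rball p (v + 1)" using v val_rat_eq_Fin_iff by blast+
  have "val_rat p (X m) = Fin v" if m: "m \<ge> N" for m
  proof -
    have d: "X m - X n \<in> rball p (v + 1)" using rball_mono[OF N[OF m n(1)]] vk by simp
    have "X m \<in> rball p v" using rball_add[OF p rball_mono[OF d] Xn(1)] by simp
    moreover have "X m \<notin> rball p (v + 1)" using rball_diff[OF p _ d, of "X m"] Xn(2) by auto
    ultimately show ?thesis by (simp add: val_rat_eq_Fin_iff)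
  qed
  then have "seq_val p X v" unfolding seq_val_def eventually_sequentially by blast
  then show ?thesis using that by blast
qed

lemma seq_val_iff:
  assumes "prime p" "padic_Cauchy p X"
  shows "seq_val p X v \<longleftrightarrow> X \<in> sball p v \<and> X \<notin> sball p (v + 1)"
  using padic_Cauchy_cases[OF assms]
proof cases
  case 1
  then show ?thesis using seq_val_not_null[of p X v] padic_nullD[of X p "v + 1"] by auto
next
  case (2 w)
  then have "seq_val p X v \<longleftrightarrow> v = w" using seq_val_unique by blast
  then show ?thesis by (auto simp: seq_val_sball[OF 2])
qed

text \<open>Absence of zero divisors: two non-null Cauchy sequences have valuations, and these
  add.\<close>

lemma padic_null_mult_iff:
  assumes p: "prime p" and X: "padic_Cauchy p X" and Y: "padic_Cauchy p Y"
  shows "X * Y \<in> padic_null p \<longleftrightarrow> X \<in> padic_null p \<or> Y \<in> padic_null p"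
proof
  assume XY: "X * Y \<in> padic_null p"
  show "X \<in> padic_null p \<or> Y \<in> padic_null p"
  proof (rule ccontr)
    assume "\<not> ?thesis"
    then obtain v w where "seq_val p X v" "seq_val p Y w"
      using padic_Cauchy_cases[OF p X] padic_Cauchy_cases[OF p Y] by metis
    then show False using seq_val_mult[OF p] seq_val_not_null XY by blast
  qed
next
  show "X \<in> padic_null p \<or> Y \<in> padic_null p \<Longrightarrow> X * Y \<in> padic_null p"
    using padic_null_mult[OF p, of X Y] padic_null_mult[OF p, of Y X] X Y
    by (auto simp: mult.commute)
qed

lemma sball_approx_nat:
  assumes p: "prime p" and X: "padic_Cauchy p X" "X \<in> sball p 0"
  obtains n :: nat where "of_nat n - X \<in> sball p (int t)"
proof -
  obtain N where N: "\<And>m n. m \<ge> N \<Longrightarrow> n \<ge> N \<Longrightarrow> X m - X n \<in> rball p (int t)"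
    using X(1) unfolding padic_Cauchy_iff by blast
  obtain M where M: "\<And>n. n \<ge> M \<Longrightarrow> X n \<in> rball p 0"
    using X(2) unfolding sball_def eventually_sequentially by blast
  let ?K = "max M N"
  obtain n :: nat where n: "of_nat n - X ?K \<in> rball p (int t)"
    using rball_approx_nat[OF p M[of ?K]] by auto
  have "of_nat n - X m \<in> rball p (int t)" if "m \<ge> ?K" for m
    using rball_add[OF p n N[of ?K m]] that by simp
  then have "of_nat n - X \<in> sball p (int t)"
    unfolding sball_def eventually_sequentially by (auto intro!: exI[of _ ?K])
  then show ?thesis using that by blast
qed

text \<open>A limit of Cauchy sequences is represented by a diagonal sequence of rational approximations.\<close>

lemma padic_complete:
  assumes p: "prime p" and S: "\<And>N. padic_Cauchy p (S N)"
    and C: "\<And>k. \<exists>N. \<forall>m\<ge>N. \<forall>n\<ge>N. S m - S n \<in> sball p k"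
  obtains X where "padic_Cauchy p X" "\<And>k. \<forall>\<^sub>F N in sequentially. S N - X \<in> sball p k"
proof -
  \<comment> \<open>The precision N grows with the index, so the errors of the approximations
    themselves tend to 0.\<close>
  have "\<exists>r. S N - (\<lambda>_. r) \<in> sball p (int N)" for N
  proof -
    obtain M where M: "\<And>m n. m \<ge> M \<Longrightarrow> n \<ge> M \<Longrightarrow> S N m - S N n \<in> rball p (int N)"
      using S unfolding padic_Cauchy_iff by blast
    then have "S N - (\<lambda>_. S N M) \<in> sball p (int N)"
      unfolding sball_def eventually_sequentially by auto
    then show ?thesis by blast
  qed
  then obtain r where r: "\<And>N. S N - (\<lambda>_. r N) \<in> sball p (int N)" by metis
  have r': "r m - r n \<in> rball p k"
    if "S m - S n \<in> sball p k" "k \<le> int m" "k \<le> int n" for m n k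
  proof -
    have "S m - S n - (S m - (\<lambda>_. r m)) + (S n - (\<lambda>_. r n)) \<in> sball p k"
      by (rule sball_add[OF p sball_diff[OF p that(1) sball_mono[OF r that(2)]] sball_mono[OF r that(3)]])
    moreover have "S m - S n - (S m - (\<lambda>_. r m)) + (S n - (\<lambda>_. r n)) = (\<lambda>_. r m - r n)"
      by (rule ext) simp
    ultimately show ?thesis by simp
  qed
  have C': "\<exists>N. \<forall>m\<ge>N. \<forall>n\<ge>N. r m - r n \<in> rball p k" for k
  proof -
    obtain N where N: "\<forall>m\<ge>N. \<forall>n\<ge>N. S m - S n \<in> sball p k" using C by blast
    show ?thesis
      using N r' by (intro exI[of _ "max N (nat k)"]) auto
  qed
  then have rC: "padic_Cauchy p r" unfolding padic_Cauchy_iff by blast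
  have "\<forall>\<^sub>F N in sequentially. S N - r \<in> sball p k" for k
  proof -
    obtain N where N: "\<forall>m\<ge>N. \<forall>n\<ge>N. r m - r n \<in> rball p k" using C' by blast
    have "S m - r \<in> sball p k" if m: "m \<ge> max N (nat k)" for m
    proof -
      have "(\<lambda>_. r m) - r \<in> sball p k"
        using N m unfolding sball_def eventually_sequentially by auto
      moreover have "S m - (\<lambda>_. r m) \<in> sball p k" using sball_mono[OF r[of m], of k] m by (simp add: nat_le_iff)
      ultimately show ?thesis using sball_diff_trans[OF p] by blast
    qed
    then show ?thesis unfolding eventually_sequentially by blast
  qed
  then show ?thesis using that rC by blast
qed

section \<open>Arithmetic and valuation on classes of Cauchy sequences\<close>

abbreviation cls :: "nat \<Rightarrow> (nat \<Rightarrow> rat) \<Rightarrow> padic" where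
  "cls p X \<equiv> padic_null p +>\<^bsub>Cauchy_ring p\<^esub> X"

lemma Cauchy_ring_simps [simp]:
  "carrier (Cauchy_ring p) = Cauchy_seqs p"
  "X \<otimes>\<^bsub>Cauchy_ring p\<^esub> Y = X * Y" "X \<oplus>\<^bsub>Cauchy_ring p\<^esub> Y = X + Y"
  "\<one>\<^bsub>Cauchy_ring p\<^esub> = 1" "\<zero>\<^bsub>Cauchy_ring p\<^esub> = 0"
  by (simp_all add: Cauchy_ring_def times_fun_def plus_fun_def one_fun_def zero_fun_def)

lemma cring_Cauchy_ring:
  assumes p: "prime p" shows "cring (Cauchy_ring p)"
proof (rule cringI)
  show "abelian_group (Cauchy_ring p)"
  proof (rule abelian_groupI, goal_cases)
    case (6 X)
    then show ?case using p by (auto intro!: bexI[of _ "- X"] padic_Cauchy_uminus)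
  qed (use p in \<open>auto simp: padic_Cauchy_add algebra_simps\<close>)
  show "comm_monoid (Cauchy_ring p)"
    by (rule comm_monoidI) (use p in \<open>auto simp: padic_Cauchy_mult algebra_simps\<close>)
qed (auto simp: algebra_simps)

lemma minus_Cauchy_ring:
  assumes p: "prime p" and X: "padic_Cauchy p X" and Y: "padic_Cauchy p Y"
  shows "X \<ominus>\<^bsub>Cauchy_ring p\<^esub> Y = X - Y"
proof -
  interpret cring "Cauchy_ring p" by (rule cring_Cauchy_ring[OF p])
  have "\<ominus>\<^bsub>Cauchy_ring p\<^esub> Y = - Y"
    using minus_equality[of "- Y" Y] Y padic_Cauchy_uminus[OF p Y] by simp
  then show ?thesis unfolding a_minus_def by simp
qed

lemma ideal_padic_null:
  assumes p: "prime p" shows "ideal (padic_null p) (Cauchy_ring p)"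
proof -
  interpret cring "Cauchy_ring p" by (rule cring_Cauchy_ring[OF p])
  show ?thesis
  proof (rule idealI)
    show "subgroup (padic_null p) (add_monoid (Cauchy_ring p))"
    proof (rule add.subgroupI)
      fix X assume X: "X \<in> padic_null p"
      have "\<ominus>\<^bsub>Cauchy_ring p\<^esub> X = - X"
        using minus_equality[of "- X" X] padic_null_Cauchy[OF p X]
          padic_Cauchy_uminus[OF p padic_null_Cauchy[OF p X]] by simp
      then show "\<ominus>\<^bsub>Cauchy_ring p\<^esub> X \<in> padic_null p" using padic_null_uminus[OF p X] by simp
    next
      show "padic_null p \<noteq> {}" using padic_null_0 by blast
    qed (use p in \<open>auto simp: padic_null_add padic_null_Cauchy\<close>)
    fix X Y assume "X \<in> padic_null p" "Y \<in> carrier (Cauchy_ring p)"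
    then show "Y \<otimes>\<^bsub>Cauchy_ring p\<^esub> X \<in> padic_null p" "X \<otimes>\<^bsub>Cauchy_ring p\<^esub> Y \<in> padic_null p"
      using padic_null_mult[OF p, of X Y] by (simp_all add: mult.commute)
  qed (rule ring_axioms)
qed

lemma ring_hom_cls:
  "prime p \<Longrightarrow> ring_hom_cring (Cauchy_ring p) (Qp p) (cls p)"
  unfolding Qp_def by (intro ideal.rcos_ring_hom_cring ideal_padic_null cring_Cauchy_ring)

lemma cring_Qp: "prime p \<Longrightarrow> cring (Qp p)"
  using ring_hom_cls by (auto simp: ring_hom_cring_def)

lemma carrier_Qp: "carrier (Qp p) = cls p ` Cauchy_seqs p"
  unfolding Qp_def FactRing_def by (auto simp: A_RCOSETS_def')

lemma mem_cls_iff: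
  "Y \<in> cls p X \<longleftrightarrow> Y - X \<in> padic_null p"
proof
  assume "Y - X \<in> padic_null p"
  then show "Y \<in> cls p X" unfolding a_r_coset_def' by (auto intro!: bexI[of _ "Y - X"])
qed (auto simp: a_r_coset_def')

lemma cls_self: "X \<in> cls p X"
  by (simp add: mem_cls_iff)

lemma cls_eq_iff:
  assumes p: "prime p" shows "cls p X = cls p Y \<longleftrightarrow> X - Y \<in> padic_null p"
proof
  assume "cls p X = cls p Y"
  then show "X - Y \<in> padic_null p" using cls_self[of X p] mem_cls_iff by blast
next
  assume "X - Y \<in> padic_null p"
  then show "cls p X = cls p Y"
    using padic_null_diff_trans[OF p] padic_null_diff_swap[OF p] mem_cls_iff by blast
qed

lemma Qp_cls_simps:
  assumes p: "prime p" and X: "padic_Cauchy p X" and Y: "padic_Cauchy p Y"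
  shows "cls p X \<oplus>\<^bsub>Qp p\<^esub> cls p Y = cls p (X + Y)"
    "cls p X \<otimes>\<^bsub>Qp p\<^esub> cls p Y = cls p (X * Y)"
    "cls p X \<ominus>\<^bsub>Qp p\<^esub> cls p Y = cls p (X - Y)"
    "cls p X [^]\<^bsub>Qp p\<^esub> (n::nat) = cls p (X ^ n)"
proof -
  interpret h: ring_hom_cring "Cauchy_ring p" "Qp p" "cls p" by (rule ring_hom_cls[OF p])
  show "cls p X \<oplus>\<^bsub>Qp p\<^esub> cls p Y = cls p (X + Y)" "cls p X \<otimes>\<^bsub>Qp p\<^esub> cls p Y = cls p (X * Y)"
    using h.hom_add[of X Y] h.hom_mult[of X Y] X Y by auto
  have "cls p (X \<ominus>\<^bsub>Cauchy_ring p\<^esub> Y) = cls p X \<ominus>\<^bsub>Qp p\<^esub> cls p Y"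
    using X Y h.hom_add[of X "\<ominus>\<^bsub>Cauchy_ring p\<^esub> Y"] h.hom_a_inv[of Y] h.R.a_inv_closed[of Y]
    by (simp add: a_minus_def)
  then show "cls p X \<ominus>\<^bsub>Qp p\<^esub> cls p Y = cls p (X - Y)"
    using minus_Cauchy_ring[OF p X Y] by simp
  have "X [^]\<^bsub>Cauchy_ring p\<^esub> n = X ^ n"
    by (induction n) (auto simp: mult.commute)
  moreover have "cls p (X [^]\<^bsub>Cauchy_ring p\<^esub> n) = cls p X [^]\<^bsub>Qp p\<^esub> n"
  proof (induction n)
    case (Suc n)
    have "X [^]\<^bsub>Cauchy_ring p\<^esub> n \<in> carrier (Cauchy_ring p)"
      using X by (intro h.R.nat_pow_closed) simp
    then have "cls p (X [^]\<^bsub>Cauchy_ring p\<^esub> n \<otimes>\<^bsub>Cauchy_ring p\<^esub> X) =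
        cls p (X [^]\<^bsub>Cauchy_ring p\<^esub> n) \<otimes>\<^bsub>Qp p\<^esub> cls p X"
      using X by (intro h.hom_mult) auto
    then show ?case using Suc by (simp only: monoid.nat_pow_Suc[OF h.R.is_monoid] monoid.nat_pow_Suc[OF h.S.is_monoid])
  qed (use h.hom_one in \<open>simp add: one_fun_def\<close>)
  ultimately show "cls p X [^]\<^bsub>Qp p\<^esub> n = cls p (X ^ n)" by simp
qed

lemma cls_eq_zero_iff: "prime p \<Longrightarrow> cls p X = \<zero>\<^bsub>Qp p\<^esub> \<longleftrightarrow> X \<in> padic_null p"
proof -
  assume p: "prime p"
  have "\<zero>\<^bsub>Qp p\<^esub> = cls p 0"
    using ring_hom_cring.hom_zero[OF ring_hom_cls[OF p]] by simp
  then show ?thesis using cls_eq_iff[OF p, of X 0] by simp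
qed

lemma finsum_Qp_cls:
  assumes p: "prime p" and "\<And>j. padic_Cauchy p (F j)"
  shows "(\<Oplus>\<^bsub>Qp p\<^esub>j\<in>{..<N::nat}. cls p (F j)) = cls p (\<Sum>j<N. F j)"
proof -
  interpret cring "Qp p" by (rule cring_Qp[OF p])
  have F: "cls p (F j) \<in> carrier (Qp p)" for j using assms by (auto simp: carrier_Qp)
  show ?thesis
  proof (induction N)
    case 0
    then show ?case using ring_hom_cring.hom_zero[OF ring_hom_cls[OF p]] by (simp add: zero_fun_def)
  next
    case (Suc N)
    have "(\<Oplus>\<^bsub>Qp p\<^esub>j\<in>{..<Suc N}. cls p (F j)) = cls p (F N) \<oplus>\<^bsub>Qp p\<^esub> cls p (\<Sum>j<N. F j)"
      unfolding lessThan_Suc using F Suc by (subst finsum_insert) auto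
    also have "\<dots> = cls p (F N + (\<Sum>j<N. F j))"
      using assms by (intro Qp_cls_simps) (auto intro: padic_Cauchy_sum)
    finally show ?case by (simp only: sum.lessThan_Suc add.commute)
  qed
qed

text \<open>The uniqueness half of the definite description in \<open>val_Qp\<close>:
  representatives differ by a null sequence, which cannot disturb a finite eventual valuation, and
  the eventual value \<infinity> forces the zero class.\<close>

lemma val_Qp_cls_aux:
  assumes p: "prime p" and X: "X0 \<in> cls p X" "\<forall>\<^sub>F n in sequentially. val_rat p (X0 n) = v"
  shows "(\<exists>w. v = Fin w \<and> seq_val p X w) \<or> v = \<infinity> \<and> X \<in> padic_null p"
proof (cases v)
  case (Fin w)
  then have "seq_val p X0 w" using X(2) by (simp add: seq_val_def)
  moreover have "X - X0 \<in> sball p (w + 1)"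
    using X(1) padic_null_diff_swap[OF p] padic_nullD mem_cls_iff by blast
  ultimately have "seq_val p (X0 + (X - X0)) w" using seq_val_add[OF p] by blast
  then show ?thesis using Fin by simp
next
  case Pinf
  then have "X0 \<in> sball p k" for k
    unfolding sball_def mem_Collect_eq using X(2) by (auto elim!: eventually_mono)
  then have "X0 \<in> padic_null p" by (simp add: padic_null_iff)
  then have "X0 - (X0 - X) \<in> padic_null p"
    using padic_null_diff[OF p] X(1) mem_cls_iff by blast
  then show ?thesis using Pinf by simp
next
  case Minf
  then have "\<forall>\<^sub>F n in sequentially::nat filter. False" using X(2) by simp
  then show ?thesis by simp
qed

lemma val_Qp_cls_Fin:
  assumes p: "prime p" and X: "seq_val p X v" shows "val_Qp p (cls p X) = Fin v"
  unfolding val_Qp_def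
proof (rule the_equality)
  show "\<exists>X\<in>cls p X. \<forall>\<^sub>F n in sequentially. val_rat p (X n) = Fin v"
    using X cls_self unfolding seq_val_def by blast
next
  fix u assume "\<exists>X\<in>cls p X. \<forall>\<^sub>F n in sequentially. val_rat p (X n) = u"
  then show "u = Fin v" using val_Qp_cls_aux[OF p] X seq_val_unique seq_val_not_null by blast
qed

lemma val_Qp_cls_inf:
  assumes p: "prime p" and X: "X \<in> padic_null p" shows "val_Qp p (cls p X) = \<infinity>"
  unfolding val_Qp_def
proof (rule the_equality)
  have "0 \<in> cls p X" using padic_null_uminus[OF p X] by (simp add: mem_cls_iff)
  then show "\<exists>X\<in>cls p X. \<forall>\<^sub>F n in sequentially. val_rat p (X n) = \<infinity>"
    by (rule rev_bexI) simp
next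
  fix u assume "\<exists>X\<in>cls p X. \<forall>\<^sub>F n in sequentially. val_rat p (X n) = u"
  then show "u = \<infinity>" using val_Qp_cls_aux[OF p] X seq_val_not_null by blast
qed

text \<open>Lower bounds treat the zero class like any other, which equations for the valuation do
  not; many later arguments are therefore phrased with them.\<close>

lemma val_Qp_cls_ge_iff:
  assumes p: "prime p" and X: "padic_Cauchy p X"
  shows "Fin k \<le> val_Qp p (cls p X) \<longleftrightarrow> X \<in> sball p k"
  using padic_Cauchy_cases[OF p X]
proof cases
  case 1
  then show ?thesis using val_Qp_cls_inf[OF p] padic_nullD by simp
next
  case (2 v)
  then show ?thesis using val_Qp_cls_Fin[OF p] seq_val_sball by simp
qed

definition int_seqs :: "nat \<Rightarrow> (nat \<Rightarrow> rat) set" where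
  "int_seqs p = Cauchy_seqs p \<inter> sball p 0"

lemma Zp_eq: "prime p \<Longrightarrow> Zp p = cls p ` int_seqs p"
  unfolding Zp_def carrier_Qp int_seqs_def zero_extended_def
  by (auto simp: val_Qp_cls_ge_iff)

lemma of_rat_Qp_eq: "of_rat_Qp p q = cls p (\<lambda>_. q)"
  by (simp add: of_rat_Qp_def)

lemma of_rat_Qp_eq_iff: "prime p \<Longrightarrow> of_rat_Qp p q = of_rat_Qp p r \<longleftrightarrow> q = r"
proof -
  assume p: "prime p"
  have "(\<lambda>_. q) - (\<lambda>_. r) = (\<lambda>_::nat. q - r)" by (rule ext) simp
  then show ?thesis unfolding of_rat_Qp_eq cls_eq_iff[OF p] padic_null_iff
    using rball_eq_0[of "q - r" p] by auto
qed

lemma of_rat_Qp_in_Zp_iff: "prime p \<Longrightarrow> of_rat_Qp p q \<in> Zp p \<longleftrightarrow> q \<in> rball p 0"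
  unfolding Zp_def of_rat_Qp_eq by (auto simp: zero_extended_def val_Qp_cls_ge_iff carrier_Qp)

section \<open>Convergent power series\<close>

definition seq_lim :: "nat \<Rightarrow> (nat \<Rightarrow> nat \<Rightarrow> rat) \<Rightarrow> (nat \<Rightarrow> rat) \<Rightarrow> bool" where
  "seq_lim p S L \<longleftrightarrow> (\<forall>k. \<forall>\<^sub>F N in sequentially. S N - L \<in> sball p k)"

lemma seq_lim_add:
  assumes p: "prime p" and "seq_lim p S L" "seq_lim p T M"
  shows "seq_lim p (\<lambda>N. S N + T N) (L + M)"
  unfolding seq_lim_def
proof
  fix k
  have "\<forall>\<^sub>F N in sequentially. S N - L \<in> sball p k" "\<forall>\<^sub>F N in sequentially. T N - M \<in> sball p k"
    using assms by (auto simp: seq_lim_def)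
  then show "\<forall>\<^sub>F N in sequentially. S N + T N - (L + M) \<in> sball p k"
    by eventually_elim (metis sball_add[OF p] add_diff_add)
qed

lemma seq_lim_cmult:
  assumes p: "prime p" and "seq_lim p S L" and Y: "padic_Cauchy p Y"
  shows "seq_lim p (\<lambda>N. Y * S N) (Y * L)"
  unfolding seq_lim_def
proof
  fix k
  obtain a where a: "Y \<in> sball p a" using padic_Cauchy_sball[OF p Y] .
  have "\<forall>\<^sub>F N in sequentially. S N - L \<in> sball p (k - a)"
    using assms by (auto simp: seq_lim_def)
  then show "\<forall>\<^sub>F N in sequentially. Y * S N - Y * L \<in> sball p k"
  proof eventually_elim
    case (elim N)
    then show ?case using sball_mult[OF p a elim] by (simp add: right_diff_distrib)
  qed
qed

lemma seq_lim_cong: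
  assumes p: "prime p" and "seq_lim p S L" and "\<And>N. T N - S N \<in> padic_null p"
  shows "seq_lim p T L"
  unfolding seq_lim_def
proof
  fix k
  have "\<forall>\<^sub>F N in sequentially. S N - L \<in> sball p k" using assms by (auto simp: seq_lim_def)
  then show "\<forall>\<^sub>F N in sequentially. T N - L \<in> sball p k"
    by eventually_elim (use assms(3) padic_nullD sball_diff_trans[OF p] in blast)
qed

lemma seq_lim_const: "seq_lim p (\<lambda>_. L) L"
  by (simp add: seq_lim_def)

lemma seq_lim_Suc: "seq_lim p S L \<Longrightarrow> seq_lim p (\<lambda>N. S (Suc N)) L"
  unfolding seq_lim_def by (simp add: eventually_sequentially_Suc[where P = "\<lambda>N. S N - L \<in> _"])

lemma seq_lim_sball:
  assumes p: "prime p" and "seq_lim p S L" and "\<forall>\<^sub>F N in sequentially. S N \<in> sball p k"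
  shows "L \<in> sball p k"
proof -
  have "\<forall>\<^sub>F N in sequentially. S N - L \<in> sball p k" using assms by (auto simp: seq_lim_def)
  with assms(3) have "\<forall>\<^sub>F N in sequentially::nat filter. L \<in> sball p k"
    by eventually_elim (use sball_diff_iff[OF p] in blast)
  then show ?thesis by simp
qed

lemma seq_lim_unique:
  assumes p: "prime p" and S: "seq_lim p S L" and "seq_lim p S M"
  shows "L - M \<in> padic_null p"
  unfolding padic_null_iff
proof
  fix k
  have "\<forall>\<^sub>F N in sequentially. S N - L \<in> sball p k" "\<forall>\<^sub>F N in sequentially. S N - M \<in> sball p k"
    using assms by (auto simp: seq_lim_def)
  then have "\<forall>\<^sub>F N in sequentially::nat filter. L - M \<in> sball p k"
    by eventually_elim (use sball_diff_swap[OF p] sball_diff_trans[OF p] in blast)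
  then show "L - M \<in> sball p k" by simp
qed

lemma int_seqs_D: "X \<in> int_seqs p \<Longrightarrow> padic_Cauchy p X" "X \<in> int_seqs p \<Longrightarrow> X \<in> sball p 0"
  by (auto simp: int_seqs_def)

lemma of_nat_int_seqs: "prime p \<Longrightarrow> of_nat n \<in> int_seqs p"
  by (simp add: int_seqs_def sball_of_nat)

lemma const_int_seqs: "(\<lambda>_. q) \<in> int_seqs p \<longleftrightarrow> q \<in> rball p 0"
  by (simp add: int_seqs_def)

text \<open>A power series converges on the whole closed unit disc iff its coefficients tend to 0.\<close>

definition coeffs_conv :: "nat \<Rightarrow> (nat \<Rightarrow> nat \<Rightarrow> rat) \<Rightarrow> bool" where
  "coeffs_conv p c \<longleftrightarrow> (\<forall>j. padic_Cauchy p (c j)) \<and> seq_lim p c 0"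

lemma coeffs_conv_tail:
  assumes "coeffs_conv p c" shows "\<exists>N. \<forall>j\<ge>N. c j \<in> sball p k"
  using assms unfolding coeffs_conv_def seq_lim_def eventually_sequentially by (metis diff_zero)

definition pow_sum :: "(nat \<Rightarrow> nat \<Rightarrow> rat) \<Rightarrow> (nat \<Rightarrow> rat) \<Rightarrow> nat \<Rightarrow> nat \<Rightarrow> rat" where
  "pow_sum c X N = (\<Sum>j<N. c j * X ^ j)"

text \<open>The sum of the series is determined only up to a null sequence, so identities about
  \<open>ev\<close> are congruences modulo \<open>padic_null p\<close>.\<close>

definition ev :: "nat \<Rightarrow> (nat \<Rightarrow> nat \<Rightarrow> rat) \<Rightarrow> (nat \<Rightarrow> rat) \<Rightarrow> nat \<Rightarrow> rat" where
  "ev p c X = (SOME L. padic_Cauchy p L \<and> seq_lim p (pow_sum c X) L)"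

lemma pow_sum_Suc: "pow_sum c X (Suc N) = pow_sum c X N + c N * X ^ N"
  unfolding pow_sum_def by (simp only: sum.lessThan_Suc)

lemma pow_sum_Cauchy:
  "prime p \<Longrightarrow> (\<And>j. padic_Cauchy p (c j)) \<Longrightarrow> padic_Cauchy p X \<Longrightarrow> padic_Cauchy p (pow_sum c X N)"
  unfolding pow_sum_def by (intro padic_Cauchy_sum padic_Cauchy_mult padic_Cauchy_power)

lemma pow_sum_diff_sball:
  assumes p: "prime p" and X: "X \<in> int_seqs p" and c: "\<And>j. j \<ge> n \<Longrightarrow> c j \<in> sball p k" and "n \<le> m"
  shows "pow_sum c X m - pow_sum c X n \<in> sball p k"
proof -
  have "pow_sum c X m - pow_sum c X n = (\<Sum>j\<in>{n..<m}. c j * X ^ j)"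
    unfolding pow_sum_def using \<open>n \<le> m\<close>
    by (simp only: lessThan_atLeast0 sum_diff_nat_ivl)
  also have "\<dots> \<in> sball p k"
    using c by (intro sball_sum[OF p] sball_mult_int[OF p] sball_power[OF p] int_seqs_D(2)[OF X]) auto
  finally show ?thesis .
qed

lemma ev_props:
  assumes p: "prime p" and c: "coeffs_conv p c" and X: "X \<in> int_seqs p"
  shows ev_Cauchy: "padic_Cauchy p (ev p c X)" and ev_lim: "seq_lim p (pow_sum c X) (ev p c X)"
proof -
  have "\<exists>N. \<forall>m\<ge>N. \<forall>n\<ge>N. pow_sum c X m - pow_sum c X n \<in> sball p k" for k
  proof -
    obtain N where N: "\<And>j. j \<ge> N \<Longrightarrow> c j \<in> sball p k"
      using coeffs_conv_tail[OF c] by blast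
    have "pow_sum c X m - pow_sum c X n \<in> sball p k" if "m \<ge> N" "n \<ge> N" for m n
    proof (cases "n \<le> m")
      case True
      then show ?thesis using N that by (intro pow_sum_diff_sball[OF p X]) auto
    next
      case False
      then have "pow_sum c X n - pow_sum c X m \<in> sball p k"
        using N that by (intro pow_sum_diff_sball[OF p X]) auto
      then show ?thesis by (rule sball_diff_swap[OF p])
    qed
    then show ?thesis by blast
  qed
  moreover have "padic_Cauchy p (pow_sum c X N)" for N
    using c by (intro pow_sum_Cauchy[OF p] int_seqs_D(1)[OF X]) (simp add: coeffs_conv_def)
  ultimately obtain L where "padic_Cauchy p L" "\<And>k. \<forall>\<^sub>F N in sequentially. pow_sum c X N - L \<in> sball p k"
    using padic_complete[OF p, of "pow_sum c X"] by blast
  then have "padic_Cauchy p L \<and> seq_lim p (pow_sum c X) L" by (simp add: seq_lim_def)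
  then have "padic_Cauchy p (ev p c X) \<and> seq_lim p (pow_sum c X) (ev p c X)"
    unfolding ev_def by (rule someI[where P = "\<lambda>L. padic_Cauchy p L \<and> seq_lim p (pow_sum c X) L"])
  then show "padic_Cauchy p (ev p c X)" "seq_lim p (pow_sum c X) (ev p c X)" by auto
qed

lemma ev_sball:
  assumes p: "prime p" and c: "coeffs_conv p c" and X: "X \<in> int_seqs p" and "\<And>j. c j \<in> sball p k"
  shows "ev p c X \<in> sball p k"
proof (rule seq_lim_sball[OF p ev_lim[OF p c X]])
  have "pow_sum c X N \<in> sball p k" for N
    using pow_sum_diff_sball[OF p X, of 0 c k N] assms(4) by (simp add: pow_sum_def)
  then show "\<forall>\<^sub>F N in sequentially. pow_sum c X N \<in> sball p k" by simp
qed

lemma coeffs_conv_shift: "coeffs_conv p c \<Longrightarrow> coeffs_conv p (\<lambda>i. c (i + j))"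
  unfolding coeffs_conv_def seq_lim_def
  by (simp add: eventually_sequentially_seg[where P = "\<lambda>j. c j \<in> _"])

text \<open>One Horner step c(X) = c_0 + X d(X) with d the shifted series, obtained as a limit of
  the identity for partial sums. It yields the recursion for the quotient coefficients.\<close>

lemma ev_shift:
  assumes p: "prime p" and c: "coeffs_conv p c" and X: "X \<in> int_seqs p"
  shows "ev p c X - (c 0 + X * ev p (\<lambda>i. c (i + 1)) X) \<in> padic_null p"
proof (rule seq_lim_unique[OF p])
  show "seq_lim p (\<lambda>N. pow_sum c X (Suc N)) (ev p c X)"
    by (rule seq_lim_Suc[OF ev_lim[OF p c X]])
  have "pow_sum c X (Suc N) = c 0 + X * pow_sum (\<lambda>i. c (i + 1)) X N" for N
  proof (induction N)
    case 0
    then show ?case by (simp add: pow_sum_def)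
  next
    case (Suc N)
    have "pow_sum c X (Suc (Suc N)) = c 0 + X * pow_sum (\<lambda>i. c (i + 1)) X N + c (Suc N) * X ^ Suc N"
      using Suc pow_sum_Suc by metis
    also have "\<dots> = c 0 + X * (pow_sum (\<lambda>i. c (i + 1)) X N + c (N + 1) * X ^ N)"
      unfolding power_Suc by (simp only: distrib_left ac_simps Suc_eq_plus1)
    finally show ?case by (simp only: pow_sum_Suc)
  qed
  then show "seq_lim p (\<lambda>N. pow_sum c X (Suc N)) (c 0 + X * ev p (\<lambda>i. c (i + 1)) X)"
    by (simp only:) (intro seq_lim_add[OF p] seq_lim_const seq_lim_cmult[OF p] ev_lim[OF p] X
      coeffs_conv_shift c int_seqs_D(1)[OF X])
qed

text \<open>The coefficients of the quotient of \<open>c(X) - c(X0)\<close> by \<open>X - X0\<close>, as in Horner's scheme.\<close>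

definition quot_coeffs where
  "quot_coeffs p c X0 j = ev p (\<lambda>i. c (i + Suc j)) X0"

lemma quot_coeffs_rec:
  assumes p: "prime p" and c: "coeffs_conv p c" and X: "X0 \<in> int_seqs p"
  shows "ev p (\<lambda>i. c (i + j)) X0 - (c j + X0 * quot_coeffs p c X0 j) \<in> padic_null p"
  using ev_shift[OF p coeffs_conv_shift[OF c] X, of j] by (simp add: quot_coeffs_def)

lemma quot_coeffs_sball:
  assumes p: "prime p" and c: "coeffs_conv p c" and X: "X0 \<in> int_seqs p"
    and "\<And>i. i > j \<Longrightarrow> c i \<in> sball p k"
  shows "quot_coeffs p c X0 j \<in> sball p k"
  unfolding quot_coeffs_def
  by (rule ev_sball[OF p coeffs_conv_shift[OF c] X]) (use assms in auto)

lemma quot_coeffs_conv: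
  assumes p: "prime p" and c: "coeffs_conv p c" and X: "X0 \<in> int_seqs p"
  shows "coeffs_conv p (quot_coeffs p c X0)"
  unfolding coeffs_conv_def
proof
  show "\<forall>j. padic_Cauchy p (quot_coeffs p c X0 j)"
    unfolding quot_coeffs_def using ev_Cauchy[OF p coeffs_conv_shift[OF c] X] by blast
  show "seq_lim p (quot_coeffs p c X0) 0"
    unfolding seq_lim_def
  proof
    fix k
    obtain N where N: "\<And>j. j \<ge> N \<Longrightarrow> c j \<in> sball p k"
      using coeffs_conv_tail[OF c] by blast
    then have "quot_coeffs p c X0 j \<in> sball p k" if "j \<ge> N" for j
      using that by (intro quot_coeffs_sball[OF p c X]) auto
    then show "\<forall>\<^sub>F j in sequentially. quot_coeffs p c X0 j - 0 \<in> sball p k"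
      unfolding eventually_sequentially by auto
  qed
qed

lemma ev_division:
  assumes p: "prime p" and c: "coeffs_conv p c" and X0: "X0 \<in> int_seqs p" and X: "X \<in> int_seqs p"
  shows "(X - X0) * ev p (quot_coeffs p c X0) X - (ev p c X - ev p c X0) \<in> padic_null p"
proof (rule seq_lim_unique[OF p])
  define G where "G j = ev p (\<lambda>i. c (i + j)) X0" for j
  have rec: "G j - (c j + X0 * G (Suc j)) \<in> padic_null p" for j
    using quot_coeffs_rec[OF p c X0, of j] by (simp add: G_def quot_coeffs_def)
  have g: "quot_coeffs p c X0 j = G (Suc j)" for j by (simp add: G_def quot_coeffs_def)
  have XC: "padic_Cauchy p X" "padic_Cauchy p X0" using X X0 int_seqs_D by auto
  let ?L = "\<lambda>N. (X - X0) * pow_sum (quot_coeffs p c X0) X N"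
  \<comment> \<open>Up to a null sequence \<open>?L N\<close> equals \<open>?R N\<close>:
    multiplying out telescopes by the recursion for G and leaves the boundary terms G_N X^N and -
    G_0, of which the first tends to 0.\<close>
  let ?R = "\<lambda>N. pow_sum c X N + (G N * X ^ N + - G 0)"
  show "seq_lim p ?L ((X - X0) * ev p (quot_coeffs p c X0) X)"
    by (intro seq_lim_cmult[OF p] ev_lim[OF p] quot_coeffs_conv[OF p] c X X0 padic_Cauchy_diff[OF p] XC)
  have "seq_lim p (\<lambda>N. G N * X ^ N) 0"
    unfolding seq_lim_def
  proof
    fix k
    obtain N where N: "\<And>j. j \<ge> N \<Longrightarrow> c j \<in> sball p k"
      using coeffs_conv_tail[OF c] by blast
    have "G j * X ^ j - 0 \<in> sball p k" if "j \<ge> N" for j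
    proof -
      have "G j \<in> sball p k" unfolding G_def
        by (rule ev_sball[OF p coeffs_conv_shift[OF c] X0]) (use N that in auto)
      then show ?thesis
        using sball_mult_int[OF p _ sball_power[OF p int_seqs_D(2)[OF X]]] by simp
    qed
    then show "\<forall>\<^sub>F j in sequentially. G j * X ^ j - 0 \<in> sball p k"
      unfolding eventually_sequentially by blast
  qed
  then have "seq_lim p ?R (ev p c X + (0 + - G 0))"
    by (intro seq_lim_add[OF p] ev_lim[OF p c X] seq_lim_const)
  moreover have "ev p c X + (0 + - G 0) = ev p c X - ev p c X0" by (simp add: G_def)
  moreover have "?L N - ?R N \<in> padic_null p" for N
  proof (induction N)
    case 0
    have "?L 0 - ?R 0 = 0" by (simp add: pow_sum_def fun_eq_iff)
    then show ?case by (simp only: padic_null_0)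
  next
    case (Suc N)
    have "?L (Suc N) - ?R (Suc N) = (?L N - ?R N) + (G N - (c N + X0 * G (Suc N))) * X ^ N"
      unfolding pow_sum_Suc g power_Suc by (simp only: algebra_simps)
    also have "\<dots> \<in> padic_null p"
      by (intro padic_null_add[OF p] Suc padic_null_mult[OF p] rec padic_Cauchy_power[OF p] XC)
    finally show ?case .
  qed
  ultimately show "seq_lim p ?L (ev p c X - ev p c X0)"
    using seq_lim_cong[OF p, of ?R "ev p c X - ev p c X0" ?L] by simp
qed

lemma coeffs_conv_bounded:
  assumes p: "prime p" and c: "coeffs_conv p c"
  shows "\<exists>K::nat. \<forall>j. c j \<in> sball p (- int K)"
proof -
  obtain N where N: "\<And>j. j \<ge> N \<Longrightarrow> c j \<in> sball p 0"
    using coeffs_conv_tail[OF c] by blast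
  have "\<exists>k. c j \<in> sball p k" for j
    using c padic_Cauchy_sball[OF p] unfolding coeffs_conv_def by metis
  then obtain k where k: "\<And>j. c j \<in> sball p (k j)" by metis
  define K where "K = (\<Sum>j<N. nat \<bar>k j\<bar>)"
  have "c j \<in> sball p (- int K)" for j
  proof (cases "j < N")
    case True
    then have "nat \<bar>k j\<bar> \<le> K" unfolding K_def by (intro member_le_sum) auto
    then show ?thesis using sball_mono[OF k[of j]] by simp
  next
    case False
    then show ?thesis using sball_mono[OF N[of j]] by simp
  qed
  then show ?thesis by blast
qed

text \<open>An admissible loss of precision: evaluation sends points that agree to t digits to
  values that agree to t - \<open>coeff_loss p c\<close> digits.\<close>

definition coeff_loss :: "nat \<Rightarrow> (nat \<Rightarrow> nat \<Rightarrow> rat) \<Rightarrow> nat" where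
  "coeff_loss p c = (SOME K. \<forall>j. c j \<in> sball p (- int K))"

lemma coeff_sball: "prime p \<Longrightarrow> coeffs_conv p c \<Longrightarrow> c j \<in> sball p (- int (coeff_loss p c))"
  unfolding coeff_loss_def using someI_ex[OF coeffs_conv_bounded] by blast

lemma ev_bounded:
  "prime p \<Longrightarrow> coeffs_conv p c \<Longrightarrow> X \<in> int_seqs p \<Longrightarrow> ev p c X \<in> sball p (- int (coeff_loss p c))"
  by (intro ev_sball coeff_sball)

text \<open>By division c(X) - c(Y) is X - Y times a value of the quotient series, whose
  coefficients obey the same lower bound on valuations as those of c.\<close>

lemma ev_lipschitz:
  assumes p: "prime p" and c: "coeffs_conv p c" and X: "X \<in> int_seqs p" and Y: "Y \<in> int_seqs p"
    and XY: "X - Y \<in> sball p t"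
  shows "ev p c X - ev p c Y \<in> sball p (t - int (coeff_loss p c))"
proof -
  have "ev p (quot_coeffs p c Y) X \<in> sball p (- int (coeff_loss p c))"
    by (intro ev_sball[OF p quot_coeffs_conv[OF p c Y] X] quot_coeffs_sball[OF p c Y] coeff_sball[OF p c])
  then have "(X - Y) * ev p (quot_coeffs p c Y) X \<in> sball p (t + - int (coeff_loss p c))"
    by (rule sball_mult[OF p XY])
  then show ?thesis
    using sball_diff_iff[OF p padic_nullD[OF ev_division[OF p c Y X]]] by simp
qed

lemma ev_cong:
  assumes p: "prime p" and c: "coeffs_conv p c" and X: "X \<in> int_seqs p" and Y: "Y \<in> int_seqs p"
    and XY: "X - Y \<in> padic_null p"
  shows "ev p c X - ev p c Y \<in> padic_null p"
  unfolding padic_null_iff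
proof
  fix k
  show "ev p c X - ev p c Y \<in> sball p k"
    using ev_lipschitz[OF p c X Y padic_nullD[OF XY], of "k + int (coeff_loss p c)"] by simp
qed

section \<open>Roots of power series\<close>

text \<open>
  \<open>N\<close> is the last index at which the minimal valuation \<open>v\<close> of the coefficients is attained. Dividing
  by a linear factor lowers \<open>N\<close> by 1, so \<open>N\<close> bounds the number of roots.
\<close>

definition strassmann :: "nat \<Rightarrow> (nat \<Rightarrow> nat \<Rightarrow> rat) \<Rightarrow> int \<Rightarrow> nat \<Rightarrow> bool" where
  "strassmann p c v N \<longleftrightarrow> seq_val p (c N) v \<and> (\<forall>j. c j \<in> sball p v) \<and> (\<forall>j>N. c j \<in> sball p (v + 1))"

text \<open>The valuations of the coefficients are bounded below and one of them is finite, so a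
  minimum v exists. Since the coefficients tend to 0, it is attained at finitely many indices
  only.\<close>

lemma strassmann_exists:
  assumes p: "prime p" and c: "coeffs_conv p c" and "c j0 \<notin> padic_null p"
  obtains v N where "strassmann p c v N"
proof -
  have C: "padic_Cauchy p (c j)" for j using c by (simp add: coeffs_conv_def)
  obtain v0 where v0: "seq_val p (c j0) v0" using padic_Cauchy_cases[OF p C] assms(3) by metis
  obtain K :: nat where K: "\<And>j. c j \<in> sball p (- int K)" using coeffs_conv_bounded[OF p c] by blast
  \<comment> \<open>Shifting by K lets the largest common lower bound be sought among the naturals;
    it is capped by the valuation of the non-null coefficient \<open>c j0\<close>.\<close>
  define P where "P d \<longleftrightarrow> (\<forall>j. c j \<in> sball p (int d - int K))" for d
  have P0: "P 0" using K by (simp add: P_def)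
  have bound: "d \<le> nat (v0 + int K)" if "P d" for d
  proof -
    have "c j0 \<in> sball p (int d - int K)" using that by (simp add: P_def)
    then show ?thesis using seq_val_sball[OF v0] by simp
  qed
  define d where "d = (GREATEST d. P d)"
  have Pd: "P d" unfolding d_def by (rule GreatestI_nat[of P 0, OF P0]) (rule bound)
  have "\<not> P (Suc d)"
  proof
    assume "P (Suc d)"
    then have "Suc d \<le> d" unfolding d_def by (rule Greatest_le_nat) (rule bound)
    then show False by simp
  qed
  define v where "v = int d - int K"
  have v: "c j \<in> sball p v" for j using Pd by (simp add: P_def v_def)
  define A where "A = {j. c j \<notin> sball p (v + 1)}"
  have "A \<noteq> {}" using \<open>\<not> P (Suc d)\<close> by (auto simp: A_def P_def v_def algebra_simps)
  moreover have "finite A"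
  proof -
    obtain J where "\<And>j. j \<ge> J \<Longrightarrow> c j \<in> sball p (v + 1)"
      using coeffs_conv_tail[OF c] by blast
    then have "A \<subseteq> {..<J}" unfolding A_def by (auto simp: not_le[symmetric])
    then show ?thesis using finite_subset by blast
  qed
  ultimately have max: "Max A \<in> A" "\<And>j. j > Max A \<Longrightarrow> j \<notin> A"
    using Max_in[of A] Max_ge[of A] leD by blast+
  have "seq_val p (c (Max A)) v"
    using max(1) v seq_val_iff[OF p C] by (simp add: A_def)
  moreover have "c j \<in> sball p (v + 1)" if "j > Max A" for j
    using max(2)[OF that] unfolding A_def by blast
  ultimately have "strassmann p c v (Max A)" unfolding strassmann_def using v by blast
  then show ?thesis by (rule that)
qed

text \<open>The constant coefficient has strictly smallest valuation and dominates the rest of the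
  series at every integral point.\<close>

lemma strassmann_0:
  assumes p: "prime p" and c: "coeffs_conv p c" and X: "X \<in> int_seqs p" and s: "strassmann p c v 0"
  shows "ev p c X \<notin> padic_null p"
proof -
  let ?E = "ev p (\<lambda>i. c (i + 1)) X"
  have "?E \<in> sball p (v + 1)"
    using s by (intro ev_sball[OF p coeffs_conv_shift[OF c] X]) (simp add: strassmann_def)
  then have "X * ?E \<in> sball p (v + 1)"
    by (subst mult.commute) (rule sball_mult_int[OF p _ int_seqs_D(2)[OF X]])
  moreover have "ev p c X - (c 0 + X * ?E) \<in> sball p (v + 1)"
    by (rule padic_nullD[OF ev_shift[OF p c X]])
  ultimately have "X * ?E + (ev p c X - (c 0 + X * ?E)) \<in> sball p (v + 1)" by (rule sball_add[OF p])
  then have "seq_val p (c 0 + (X * ?E + (ev p c X - (c 0 + X * ?E)))) v"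
    using s by (intro seq_val_add[OF p]) (simp_all only: strassmann_def)
  moreover have "c 0 + (X * ?E + (ev p c X - (c 0 + X * ?E))) = ev p c X" by (rule ext) simp
  ultimately show ?thesis using seq_val_not_null by simp
qed

text \<open>In g_N = c_(N+1) + X g_(N+1) the second summand is small, because g_j involves only
  coefficients of c beyond j. So g_N inherits the valuation of c_(N+1).\<close>

lemma strassmann_quot:
  assumes p: "prime p" and c: "coeffs_conv p c" and X: "X \<in> int_seqs p"
    and s: "strassmann p c v (Suc N)"
  shows "strassmann p (quot_coeffs p c X) v N"
proof -
  let ?g = "quot_coeffs p c X"
  have tail: "?g j \<in> sball p (v + 1)" if "j > N" for j
    using s that by (intro quot_coeffs_sball[OF p c X]) (simp add: strassmann_def)
  have "?g N - (c (Suc N) + X * ?g (Suc N)) \<in> sball p (v + 1)"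
    using padic_nullD[OF quot_coeffs_rec[OF p c X, of "Suc N"]] by (simp add: quot_coeffs_def)
  moreover have "X * ?g (Suc N) \<in> sball p (v + 1)"
    by (subst mult.commute) (intro sball_mult_int[OF p] tail int_seqs_D(2)[OF X] lessI)
  ultimately have "X * ?g (Suc N) + (?g N - (c (Suc N) + X * ?g (Suc N))) \<in> sball p (v + 1)"
    using sball_add[OF p] by blast
  then have "seq_val p (c (Suc N) + (X * ?g (Suc N) + (?g N - (c (Suc N) + X * ?g (Suc N))))) v"
    using s by (intro seq_val_add[OF p]) (simp_all only: strassmann_def)
  moreover have "c (Suc N) + (X * ?g (Suc N) + (?g N - (c (Suc N) + X * ?g (Suc N)))) = ?g N"
    by (rule ext) simp
  ultimately have "seq_val p (?g N) v" by simp
  moreover have "?g j \<in> sball p v" for j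
    using s by (intro quot_coeffs_sball[OF p c X]) (simp add: strassmann_def)
  ultimately show ?thesis using tail by (simp add: strassmann_def)
qed

lemma ev_root_factor:
  assumes p: "prime p" and c: "coeffs_conv p c" and X0: "X0 \<in> int_seqs p" and X: "X \<in> int_seqs p"
    and r: "ev p c X0 \<in> padic_null p"
  shows "ev p c X - (X - X0) * ev p (quot_coeffs p c X0) X \<in> padic_null p"
proof -
  have "- (((X - X0) * ev p (quot_coeffs p c X0) X - (ev p c X - ev p c X0)) - ev p c X0) \<in> padic_null p"
    by (intro padic_null_uminus[OF p] padic_null_diff[OF p] ev_division[OF p c X0 X] r)
  moreover have "- (((X - X0) * ev p (quot_coeffs p c X0) X - (ev p c X - ev p c X0)) - ev p c X0)
      = ev p c X - (X - X0) * ev p (quot_coeffs p c X0) X"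
    by (rule ext) simp
  ultimately show ?thesis by simp
qed

text \<open>A root other than X0 is a root of the quotient by X - X0, as there are no zero divisors;
  induction applies to the quotient.\<close>

lemma finite_ev_roots:
  assumes p: "prime p"
  shows "coeffs_conv p c \<Longrightarrow> strassmann p c v N \<Longrightarrow>
    finite {cls p X | X. X \<in> int_seqs p \<and> ev p c X \<in> padic_null p}"
proof (induction N arbitrary: c)
  case 0
  then have "{cls p X | X. X \<in> int_seqs p \<and> ev p c X \<in> padic_null p} = {}"
    using strassmann_0[OF p] by blast
  then show ?case by (simp only: finite.emptyI)
next
  case (Suc N)
  let ?R = "\<lambda>c. {cls p X | X. X \<in> int_seqs p \<and> ev p c X \<in> padic_null p}"
  show ?case
  proof (cases "?R c = {}")
    case False
    then obtain X0 where X0: "X0 \<in> int_seqs p" "ev p c X0 \<in> padic_null p" by blast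
    let ?g = "quot_coeffs p c X0"
    have g: "coeffs_conv p ?g" by (rule quot_coeffs_conv[OF p Suc.prems(1) X0(1)])
    have "?R c \<subseteq> insert (cls p X0) (?R ?g)"
    proof
      fix x assume "x \<in> ?R c"
      then obtain X where X: "x = cls p X" "X \<in> int_seqs p" "ev p c X \<in> padic_null p" by blast
      have "ev p c X - (ev p c X - (X - X0) * ev p ?g X) \<in> padic_null p"
        by (intro padic_null_diff[OF p] X(3) ev_root_factor[OF p Suc.prems(1) X0(1) X(2) X0(2)])
      then have "(X - X0) * ev p ?g X \<in> padic_null p" by simp
      then have "X - X0 \<in> padic_null p \<or> ev p ?g X \<in> padic_null p"
        using padic_null_mult_iff[OF p padic_Cauchy_diff[OF p] ev_Cauchy[OF p g X(2)]]
          int_seqs_D(1)[OF X(2)] int_seqs_D(1)[OF X0(1)] by blast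
      then show "x \<in> insert (cls p X0) (?R ?g)"
        using X cls_eq_iff[OF p] by blast
    qed
    moreover have "finite (?R ?g)"
      by (rule Suc.IH[OF g strassmann_quot[OF p Suc.prems(1) X0(1) Suc.prems(2)]])
    ultimately show ?thesis using finite_subset by blast
  qed (simp only: finite.emptyI)
qed

text \<open>Division by X - X0 is repeated as long as X0 is a root. The Strassmann index drops each
  time, and at index 0 no root is left.\<close>

lemma ev_factor:
  assumes p: "prime p" and X0: "X0 \<in> int_seqs p"
  shows "coeffs_conv p c \<Longrightarrow> strassmann p c v N \<Longrightarrow>
    \<exists>m g. coeffs_conv p g \<and> ev p g X0 \<notin> padic_null p \<and>
      (\<forall>X\<in>int_seqs p. ev p c X - (X - X0) ^ m * ev p g X \<in> padic_null p)"
proof (induction N arbitrary: c)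
  case 0
  have "\<forall>X\<in>int_seqs p. ev p c X - (X - X0) ^ 0 * ev p c X \<in> padic_null p"
    by (intro ballI) (simp only: power_0 mult_1 diff_self padic_null_0)
  then show ?case using strassmann_0[OF p 0(1) X0 0(2)] 0 by blast
next
  case (Suc N)
  show ?case
  proof (cases "ev p c X0 \<in> padic_null p")
    case False
    have "\<forall>X\<in>int_seqs p. ev p c X - (X - X0) ^ 0 * ev p c X \<in> padic_null p"
      by (intro ballI) (simp only: power_0 mult_1 diff_self padic_null_0)
    then show ?thesis using False Suc.prems by blast
  next
    case True
    let ?q = "quot_coeffs p c X0"
    have q: "coeffs_conv p ?q" by (rule quot_coeffs_conv[OF p Suc.prems(1) X0])
    obtain m g where g: "coeffs_conv p g" "ev p g X0 \<notin> padic_null p"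
        "\<forall>X\<in>int_seqs p. ev p ?q X - (X - X0) ^ m * ev p g X \<in> padic_null p"
      using Suc.IH[OF q strassmann_quot[OF p Suc.prems(1) X0 Suc.prems(2)]] by blast
    have "ev p c X - (X - X0) ^ Suc m * ev p g X \<in> padic_null p" if X: "X \<in> int_seqs p" for X
    proof -
      have "(ev p ?q X - (X - X0) ^ m * ev p g X) * (X - X0) \<in> padic_null p"
        using g(3) X by (intro padic_null_mult[OF p] padic_Cauchy_diff[OF p] int_seqs_D(1) X0) auto
      then have "(ev p c X - (X - X0) * ev p ?q X) + (ev p ?q X - (X - X0) ^ m * ev p g X) * (X - X0)
          \<in> padic_null p"
        by (intro padic_null_add[OF p] ev_root_factor[OF p Suc.prems(1) X0 X True])
      moreover have "(ev p c X - (X - X0) * ev p ?q X) + (ev p ?q X - (X - X0) ^ m * ev p g X) * (X - X0)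
          = ev p c X - (X - X0) ^ Suc m * ev p g X"
        unfolding power_Suc by (rule ext) (simp add: algebra_simps)
      ultimately show ?thesis by simp
    qed
    then show ?thesis using g by blast
  qed
qed

text \<open>Compactness: a nested choice of residue classes yields a Cauchy sequence of naturals.\<close>

lemma ev_compact:
  assumes p: "prime p" and c: "coeffs_conv p c" and unb: "\<And>k. \<exists>n. ev p c (of_nat n) \<in> sball p k"
  shows "\<exists>X\<in>int_seqs p. ev p c X \<in> padic_null p"
proof -
  define good where "good t r \<longleftrightarrow> (\<forall>k. \<exists>n. [n = r] (mod p ^ t) \<and> ev p c (of_nat n) \<in> sball p k)" for t r
  have g0: "good 0 0" using unb by (simp add: good_def)
  have step: "\<exists>r'. good (Suc t) r' \<and> [r' = r] (mod p ^ t)" if gd: "good t r" for t r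
  proof (rule ccontr)
    assume "\<not> ?thesis"
    then have "\<forall>r'. \<exists>k. [r' = r] (mod p ^ t) \<longrightarrow>
        (\<forall>n. [n = r'] (mod p ^ Suc t) \<longrightarrow> ev p c (of_nat n) \<notin> sball p k)"
      unfolding good_def by blast
    then obtain k where k: "\<And>r' n. [r' = r] (mod p ^ t) \<Longrightarrow> [n = r'] (mod p ^ Suc t) \<Longrightarrow>
        ev p c (of_nat n) \<notin> sball p (k r')" by metis
    \<comment> \<open>If every residue refining r had its own bound \<open>k r'\<close>, the maximum
      over the finitely many residues modulo p^(t+1) would bound the valuation on the whole class of
      r.\<close>
    define M where "M = (MAX r'\<in>{..<p ^ Suc t}. k r')"
    obtain n where n: "[n = r] (mod p ^ t)" "ev p c (of_nat n) \<in> sball p M"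
      using gd unfolding good_def by blast
    let ?r = "n mod p ^ Suc t"
    have "?r < p ^ Suc t" using p by (simp add: prime_gt_0_nat del: power_Suc)
    then have "k ?r \<le> M" unfolding M_def by (intro Max_ge) (auto simp del: power_Suc)
    then have "ev p c (of_nat n) \<in> sball p (k ?r)" using n(2) sball_mono by blast
    moreover have "[n = ?r] (mod p ^ Suc t)" by (simp add: cong_def del: power_Suc)
    moreover have "[?r = r] (mod p ^ t)"
    proof -
      have "[?r = n] (mod p ^ Suc t)" by (simp add: cong_def del: power_Suc)
      then have "[?r = n] (mod p ^ t)" by (rule cong_dvd_modulus_nat) (simp add: le_imp_power_dvd)
      then show ?thesis using n(1) cong_trans by blast
    qed
    ultimately show False using k by blast
  qed
  obtain r where r: "\<And>t. good t (r t)" "\<And>t. [r (Suc t) = r t] (mod p ^ t)"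
  proof -
    have "\<exists>r. \<forall>t. good t (r t) \<and> [r (Suc t) = r t] (mod p ^ t)"
      by (rule dependent_nat_choice) (use g0 step in blast)+
    then show ?thesis using that by blast
  qed
  have cong: "[r m = r t] (mod p ^ t)" if "t \<le> m" for m t
    using that
  proof (induction m rule: dec_induct)
    case (step m)
    have "[r (Suc m) = r m] (mod p ^ t)"
      by (rule cong_dvd_modulus_nat[OF r(2)]) (use step in \<open>simp add: le_imp_power_dvd\<close>)
    then show ?case using step cong_trans by blast
  qed simp
  have congb: "(of_nat x :: rat) - of_nat y \<in> rball p (int t)" if "[x = y] (mod p ^ t)" for x y t
  proof -
    have "int p ^ t dvd int x - int y"
      using that by (metis cong_iff_dvd_diff cong_int_iff of_nat_power)
    then have "of_int (int x - int y) \<in> rball p (int t)" using rball_of_int_iff[OF p] by blast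
    then show ?thesis by simp
  qed
  define X where "X = (\<lambda>t. of_nat (r t) :: rat)"
  have Xb: "X m - X n \<in> rball p (int t)" if "m \<ge> t" "n \<ge> t" for m n t
    unfolding X_def by (rule congb[OF cong_trans[OF cong[OF that(1)] cong_sym[OF cong[OF that(2)]]]])
  have "padic_Cauchy p X" unfolding padic_Cauchy_iff
  proof
    fix k
    have "X m - X n \<in> rball p k" if "m \<ge> nat k" "n \<ge> nat k" for m n
      using rball_mono[OF Xb[of "nat k" m n]] that by simp
    then show "\<exists>N. \<forall>m\<ge>N. \<forall>n\<ge>N. X m - X n \<in> rball p k" by blast
  qed
  moreover have "X \<in> sball p 0" by (simp add: X_def sball_def rball_of_nat[OF p])
  ultimately have X: "X \<in> int_seqs p" by (simp add: int_seqs_def)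
  define K where "K = coeff_loss p c"
  have "ev p c X \<in> sball p k" for k
  proof -
    \<comment> \<open>Enough digits to keep precision k after the Lipschitz loss K.\<close>
    define t where "t = nat (k + int K)"
    obtain n where n: "[n = r t] (mod p ^ t)" "ev p c (of_nat n) \<in> sball p k"
      using r(1)[of t] unfolding good_def by blast
    have "X m - of_nat n \<in> rball p (int t)" if "m \<ge> t" for m
      unfolding X_def of_nat_fun by (rule congb[OF cong_trans[OF cong[OF that] cong_sym[OF n(1)]]])
    then have "X - of_nat n \<in> sball p (int t)"
      unfolding sball_def eventually_sequentially by auto
    then have "ev p c X - ev p c (of_nat n) \<in> sball p (int t - int K)"
      unfolding K_def using ev_lipschitz[OF p c X of_nat_int_seqs[OF p]] by blast
    then have "ev p c X - ev p c (of_nat n) \<in> sball p k"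
      by (rule sball_mono) (simp add: t_def)
    then show ?thesis using n(2) sball_diff_iff[OF p] by blast
  qed
  then show ?thesis using X by (auto simp: padic_null_iff)
qed

section \<open>From analytic functions to convergent coefficient sequences and back\<close>

definition represents :: "nat \<Rightarrow> (nat \<Rightarrow> nat \<Rightarrow> rat) \<Rightarrow> (padic \<Rightarrow> padic) \<Rightarrow> bool" where
  "represents p c f \<longleftrightarrow> coeffs_conv p c \<and> (\<forall>X\<in>int_seqs p. f (cls p X) = cls p (ev p c X))"

lemma tendsto_cls_iff:
  assumes p: "prime p" and "\<And>j. padic_Cauchy p (c j)" "X \<in> int_seqs p" "padic_Cauchy p L"
  shows "padic_tendsto p (\<lambda>N. \<Oplus>\<^bsub>Qp p\<^esub>j\<in>{..<N}. cls p (c j) \<otimes>\<^bsub>Qp p\<^esub> cls p X [^]\<^bsub>Qp p\<^esub> j) (cls p L)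
    \<longleftrightarrow> seq_lim p (pow_sum c X) L"
proof -
  have X: "padic_Cauchy p X" by (rule int_seqs_D(1)[OF assms(3)])
  have "cls p (c j) \<otimes>\<^bsub>Qp p\<^esub> cls p X [^]\<^bsub>Qp p\<^esub> j = cls p (c j * X ^ j)" for j
    by (simp only: Qp_cls_simps(4)[OF p X X] Qp_cls_simps(2)[OF p assms(2) padic_Cauchy_power[OF p X]])
  then have "(\<Oplus>\<^bsub>Qp p\<^esub>j\<in>{..<N}. cls p (c j) \<otimes>\<^bsub>Qp p\<^esub> cls p X [^]\<^bsub>Qp p\<^esub> j) = cls p (pow_sum c X N)" for N
    unfolding pow_sum_def
    by (simp only: finsum_Qp_cls[OF p, of "\<lambda>j. c j * X ^ j", OF padic_Cauchy_mult[OF p assms(2) padic_Cauchy_power[OF p X]]])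
  moreover have "cls p (pow_sum c X N) \<ominus>\<^bsub>Qp p\<^esub> cls p L = cls p (pow_sum c X N - L)" for N
    by (rule Qp_cls_simps(3)[OF p pow_sum_Cauchy[OF p assms(2) X] assms(4)])
  moreover have "padic_Cauchy p (pow_sum c X N - L)" for N
    by (intro padic_Cauchy_diff[OF p] pow_sum_Cauchy[OF p] assms X)
  ultimately show ?thesis
    unfolding padic_tendsto_def seq_lim_def by (simp only: val_Qp_cls_ge_iff[OF p])
qed

lemma analytic_represents:
  assumes p: "prime p" and f: "analytic_Zp p f"
  obtains c where "represents p c f"
proof -
  obtain c' where c': "\<forall>j. c' j \<in> carrier (Qp p)"
      "\<forall>x\<in>Zp p. padic_tendsto p
          (\<lambda>N. \<Oplus>\<^bsub>Qp p\<^esub>j\<in>{..<N}. c' j \<otimes>\<^bsub>Qp p\<^esub> x [^]\<^bsub>Qp p\<^esub> j) (f x)"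
    using f unfolding analytic_Zp_def by blast
  have "\<forall>j. \<exists>X. padic_Cauchy p X \<and> c' j = cls p X" using c'(1) unfolding carrier_Qp by blast
  then obtain c where c: "\<And>j. padic_Cauchy p (c j)" "\<And>j. c' j = cls p (c j)" by metis
  have ex: "\<exists>L. padic_Cauchy p L \<and> seq_lim p (pow_sum c X) L \<and> f (cls p X) = cls p L"
    if X: "X \<in> int_seqs p" for X
  proof -
    have xZ: "cls p X \<in> Zp p" using X Zp_eq[OF p] by blast
    then have "f (cls p X) \<in> carrier (Qp p)" using f unfolding analytic_Zp_def by blast
    then obtain L where L: "padic_Cauchy p L" "f (cls p X) = cls p L" unfolding carrier_Qp by blast
    then have "seq_lim p (pow_sum c X) L"
      using c'(2)[rule_format, OF xZ] tendsto_cls_iff[OF p c(1) X L(1)] by (simp only: c(2) L(2))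
    then show ?thesis using L by blast
  qed
  \<comment> \<open>At the point 1 the terms of the series are the coefficients themselves, and
    consecutive partial sums of a convergent series have differences tending to 0.\<close>
  have "seq_lim p c 0"
  proof -
    have one: "1 \<in> int_seqs p" using of_nat_int_seqs[OF p, of 1] by (simp only: of_nat_1)
    obtain L where L: "padic_Cauchy p L" "seq_lim p (pow_sum c 1) L" using ex[OF one] by blast
    have "seq_lim p (\<lambda>N. pow_sum c 1 (Suc N) + (-1) * pow_sum c 1 N) (L + (-1) * L)"
      by (intro seq_lim_add[OF p] seq_lim_Suc seq_lim_cmult[OF p] L padic_Cauchy_uminus[OF p] padic_Cauchy_1)
    moreover have "pow_sum c 1 (Suc N) + (-1) * pow_sum c 1 N = c N" for N
      unfolding pow_sum_Suc by (simp only: power_one) (simp add: fun_eq_iff)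
    ultimately show ?thesis by simp
  qed
  then have cc: "coeffs_conv p c" using c(1) by (simp add: coeffs_conv_def)
  have "f (cls p X) = cls p (ev p c X)" if X: "X \<in> int_seqs p" for X
    using ex[OF X] cls_eq_iff[OF p] seq_lim_unique[OF p] ev_lim[OF p cc X] by metis
  then have "represents p c f" using cc by (simp add: represents_def)
  then show ?thesis by (rule that)
qed

lemma represents_analytic:
  assumes p: "prime p" and r: "represents p c f"
  shows "analytic_Zp p f"
  unfolding analytic_Zp_def
proof
  have cc: "coeffs_conv p c" and f: "\<And>X. X \<in> int_seqs p \<Longrightarrow> f (cls p X) = cls p (ev p c X)"
    using r by (auto simp: represents_def)
  have c: "padic_Cauchy p (c j)" for j using cc by (simp add: coeffs_conv_def)
  show "f \<in> Zp p \<rightarrow> carrier (Qp p)"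
    using f ev_Cauchy[OF p cc] by (auto simp: Zp_eq[OF p] carrier_Qp)
  show "\<exists>c. (\<forall>j. c j \<in> carrier (Qp p)) \<and>
       (\<forall>x\<in>Zp p. padic_tendsto p
          (\<lambda>N. \<Oplus>\<^bsub>Qp p\<^esub>j\<in>{..<N}. c j \<otimes>\<^bsub>Qp p\<^esub> x [^]\<^bsub>Qp p\<^esub> j) (f x))"
  proof (intro exI[of _ "\<lambda>j. cls p (c j)"] conjI allI ballI)
    fix j show "cls p (c j) \<in> carrier (Qp p)" using c by (auto simp: carrier_Qp)
  next
    fix x assume "x \<in> Zp p"
    then obtain X where X: "X \<in> int_seqs p" "x = cls p X" using Zp_eq[OF p] by blast
    show "padic_tendsto p
          (\<lambda>N. \<Oplus>\<^bsub>Qp p\<^esub>j\<in>{..<N}. cls p (c j) \<otimes>\<^bsub>Qp p\<^esub> x [^]\<^bsub>Qp p\<^esub> j) (f x)"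
      unfolding X(2) f[OF X(1)] tendsto_cls_iff[OF p c X(1) ev_Cauchy[OF p cc X(1)]]
      by (rule ev_lim[OF p cc X(1)])
  qed
qed

text \<open>\<open>ev\<close> acts on sequences, a function on \<open>Zp p\<close> on classes;
  choosing a representative is harmless because equivalent arguments have equivalent values by
  \<open>ev_cong\<close>.\<close>

lemma represents_exists:
  assumes p: "prime p" and c: "coeffs_conv p c"
  shows "represents p c (\<lambda>x. cls p (ev p c (SOME X. X \<in> int_seqs p \<and> x = cls p X)))"
  unfolding represents_def
proof (intro conjI ballI c)
  fix X assume X: "X \<in> int_seqs p"
  define Y where "Y = (SOME Y. Y \<in> int_seqs p \<and> cls p X = cls p Y)"
  have "Y \<in> int_seqs p \<and> cls p X = cls p Y"
    unfolding Y_def by (rule someI[where P = "\<lambda>Y. Y \<in> int_seqs p \<and> cls p X = cls p Y" and x = X]) (simp add: X)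
  then have "ev p c Y - ev p c X \<in> padic_null p"
    using ev_cong[OF p c _ X] cls_eq_iff[OF p] by metis
  then have "cls p (ev p c Y) = cls p (ev p c X)" by (simp only: cls_eq_iff[OF p])
  then show "cls p (ev p c (SOME Y. Y \<in> int_seqs p \<and> cls p X = cls p Y)) = cls p (ev p c X)"
    by (simp only: Y_def)
qed

section \<open>Valuations of analytic functions\<close>

definition nat_val :: "nat \<Rightarrow> (padic \<Rightarrow> padic) \<Rightarrow> nat \<Rightarrow> int extended" where
  "nat_val p f n = val_Qp p (f (of_rat_Qp p (of_nat n)))"

lemma of_rat_Qp_of_nat: "of_rat_Qp p (of_nat n) = cls p (of_nat n)"
  by (simp add: of_rat_Qp_eq of_nat_fun)

lemma nat_val_eq: "prime p \<Longrightarrow> represents p c f \<Longrightarrow> nat_val p f n = val_Qp p (cls p (ev p c (of_nat n)))"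
  unfolding nat_val_def represents_def of_rat_Qp_of_nat using of_nat_int_seqs by metis

lemma representsD:
  assumes p: "prime p" and r: "represents p c f"
  shows "coeffs_conv p c" "X \<in> int_seqs p \<Longrightarrow> f (cls p X) = cls p (ev p c X)"
    "X \<in> int_seqs p \<Longrightarrow> Fin k \<le> val_Qp p (f (cls p X)) \<longleftrightarrow> ev p c X \<in> sball p k"
    "X \<in> int_seqs p \<Longrightarrow> cls p X \<in> roots_Zp p f \<longleftrightarrow> ev p c X \<in> padic_null p"
proof -
  show c: "coeffs_conv p c" and f: "X \<in> int_seqs p \<Longrightarrow> f (cls p X) = cls p (ev p c X)"
    using r by (auto simp: represents_def)
  show "X \<in> int_seqs p \<Longrightarrow> Fin k \<le> val_Qp p (f (cls p X)) \<longleftrightarrow> ev p c X \<in> sball p k"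
    using val_Qp_cls_ge_iff[OF p ev_Cauchy[OF p c]] f by simp
  show "X \<in> int_seqs p \<Longrightarrow> cls p X \<in> roots_Zp p f \<longleftrightarrow> ev p c X \<in> padic_null p"
    using cls_eq_zero_iff[OF p] Zp_eq[OF p] f unfolding roots_Zp_def by auto
qed

lemma analytic_val_bounded_below:
  assumes p: "prime p" and f: "analytic_Zp p f"
  shows "\<exists>K::nat. \<forall>x\<in>Zp p. Fin (- int K) \<le> val_Qp p (f x)"
proof -
  obtain c where r: "represents p c f" using analytic_represents[OF p f] .
  show ?thesis unfolding Zp_eq[OF p]
    using ev_bounded[OF p representsD(1)[OF p r]] representsD(3)[OF p r] by blast
qed

text \<open>By the Lipschitz estimate the set where the valuation is at least k is a union of
  residue classes modulo p^t, with t depending on k. Thresholds are used because near a root the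
  valuation itself is not uniformly locally constant.\<close>

lemma analytic_val_uniform:
  assumes p: "prime p" and f: "analytic_Zp p f"
  shows "\<exists>t::nat. \<forall>X\<in>int_seqs p. \<forall>Y\<in>int_seqs p. X - Y \<in> sball p (int t) \<longrightarrow>
    (Fin k \<le> val_Qp p (f (cls p X)) \<longleftrightarrow> Fin k \<le> val_Qp p (f (cls p Y)))"
proof -
  obtain c where r: "represents p c f" using analytic_represents[OF p f] .
  define K where "K = coeff_loss p c"
  have "Fin k \<le> val_Qp p (f (cls p X)) \<longleftrightarrow> Fin k \<le> val_Qp p (f (cls p Y))"
    if X: "X \<in> int_seqs p" and Y: "Y \<in> int_seqs p" and XY: "X - Y \<in> sball p (int (nat (k + int K)))" for X Y
  proof -
    have "ev p c X - ev p c Y \<in> sball p (int (nat (k + int K)) - int K)"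
      unfolding K_def using ev_lipschitz[OF p representsD(1)[OF p r] X Y] XY K_def by simp
    then have "ev p c X - ev p c Y \<in> sball p k" by (rule sball_mono) simp
    then show ?thesis using representsD(3)[OF p r] X Y sball_diff_iff[OF p] by simp
  qed
  then show ?thesis by blast
qed

lemma analytic_nonzero_coeff:
  assumes p: "prime p" and r: "represents p c f" and nz: "\<exists>x\<in>Zp p. f x \<noteq> \<zero>\<^bsub>Qp p\<^esub>"
  obtains v N where "strassmann p c v N"
proof -
  have c: "coeffs_conv p c" by (rule representsD(1)[OF p r])
  have "\<exists>j. c j \<notin> padic_null p"
  proof (rule ccontr)
    assume "\<not> ?thesis"
    then have "ev p c X \<in> padic_null p" if "X \<in> int_seqs p" for X
      unfolding padic_null_iff using ev_sball[OF p c that] by blast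
    then show False
      using nz representsD(2)[OF p r] cls_eq_zero_iff[OF p] unfolding Zp_eq[OF p] by auto
  qed
  then show ?thesis using strassmann_exists[OF p c] that by blast
qed

lemma finite_roots_Zp:
  assumes p: "prime p" and f: "analytic_Zp p f" and nz: "\<exists>x\<in>Zp p. f x \<noteq> \<zero>\<^bsub>Qp p\<^esub>"
  shows "finite (roots_Zp p f)"
proof -
  obtain c where r: "represents p c f" using analytic_represents[OF p f] .
  obtain v N where s: "strassmann p c v N" using analytic_nonzero_coeff[OF p r nz] .
  have "roots_Zp p f \<subseteq> {cls p X | X. X \<in> int_seqs p \<and> ev p c X \<in> padic_null p}"
  proof
    fix x assume x: "x \<in> roots_Zp p f"
    then obtain X where X: "X \<in> int_seqs p" "x = cls p X" unfolding roots_Zp_def Zp_eq[OF p] by blast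
    then show "x \<in> {cls p X | X. X \<in> int_seqs p \<and> ev p c X \<in> padic_null p}"
      using x representsD(4)[OF p r X(1)] by blast
  qed
  then show ?thesis using finite_ev_roots[OF p representsD(1)[OF p r] s] finite_subset by blast
qed

lemma of_nat_diff_sball:
  assumes p: "prime p" and "[n = n'] (mod p ^ t)"
  shows "of_nat n - of_nat n' \<in> sball p (int t)"
proof -
  have "int p ^ t dvd int n - int n'"
    using assms(2) by (metis cong_iff_dvd_diff cong_int_iff of_nat_power)
  then have "of_int (int n - int n') \<in> rball p (int t)" using rball_of_int_iff[OF p] by blast
  then have "(\<lambda>_. of_nat n - of_nat n' :: rat) \<in> sball p (int t)" by simp
  moreover have "of_nat n - of_nat n' = (\<lambda>_::nat. of_nat n - of_nat n' :: rat)" by (rule ext) simp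
  ultimately show ?thesis by (simp only:)
qed

text \<open>Without roots, the valuation is bounded by compactness, hence locally constant.\<close>

lemma no_roots_nat_val:
  assumes p: "prime p" and f: "analytic_Zp p f" and nr: "roots_Zp p f = {}"
  shows "\<exists>h (M::nat) t. (\<forall>n. nat_val p f n = Fin (h n)) \<and> (\<forall>n. \<bar>h n\<bar> \<le> int M) \<and>
    (\<forall>n n'. [n = n'] (mod p ^ t) \<longrightarrow> h n = h n')"
proof -
  obtain c where r: "represents p c f" using analytic_represents[OF p f] .
  have c: "coeffs_conv p c" by (rule representsD(1)[OF p r])
  have nn: "ev p c X \<notin> padic_null p" if "X \<in> int_seqs p" for X
    using nr representsD(4)[OF p r that] by blast
  then obtain k where k: "\<And>n. ev p c (of_nat n) \<notin> sball p k"
    using ev_compact[OF p c] by blast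
  define K where "K = coeff_loss p c"
  have N: "of_nat n \<in> int_seqs p" for n by (rule of_nat_int_seqs[OF p])
  have "\<forall>n. \<exists>v. seq_val p (ev p c (of_nat n)) v"
    using padic_Cauchy_cases[OF p ev_Cauchy[OF p c N]] nn[OF N] by metis
  then obtain h where h: "\<And>n. seq_val p (ev p c (of_nat n)) (h n)" by metis
  have hk: "h n < k" for n using seq_val_sball[OF h] k by (meson not_less)
  have hK: "- int K \<le> h n" for n using seq_val_sball[OF h] ev_bounded[OF p c N] K_def by blast
  have "\<bar>h n\<bar> \<le> int (nat \<bar>k\<bar> + K)" for n using hk[of n] hK[of n] by linarith
  moreover have "nat_val p f n = Fin (h n)" for n
    using nat_val_eq[OF p r] val_Qp_cls_Fin[OF p h] by simp
  \<comment> \<open>All h n lie below k, so agreement to k + K digits leaves, after the loss K, a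
    difference too small to alter the valuation.\<close>
  moreover have "h n = h n'" if nn': "[n = n'] (mod p ^ nat (k + int K))" for n n'
  proof -
    have "of_nat n' - of_nat n \<in> sball p (int (nat (k + int K)))"
      by (rule of_nat_diff_sball[OF p cong_sym[OF nn']])
    then have "ev p c (of_nat n') - ev p c (of_nat n) \<in> sball p (int (nat (k + int K)) - int K)"
      unfolding K_def by (intro ev_lipschitz[OF p c N N])
    then have "ev p c (of_nat n') - ev p c (of_nat n) \<in> sball p (h n + 1)"
      by (rule sball_mono) (use hk[of n] in linarith)
    then have "seq_val p (ev p c (of_nat n) + (ev p c (of_nat n') - ev p c (of_nat n))) (h n)"
      by (rule seq_val_add[OF p h])
    then have "seq_val p (ev p c (of_nat n')) (h n)" by simp
    then show ?thesis using seq_val_unique h by blast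
  qed
  ultimately show ?thesis by blast
qed

text \<open>
  After dividing out the largest power of \<open>x - x0\<close>, the cofactor does not vanish at \<open>x0\<close>, so
  continuity at \<open>x0\<close> excludes higher multiplicities.
\<close>

lemma root_mult_factor:
  assumes p: "prime p" and f: "analytic_Zp p f" and nz: "\<exists>x\<in>Zp p. f x \<noteq> \<zero>\<^bsub>Qp p\<^esub>"
    and r: "represents p c f" and X0: "X0 \<in> int_seqs p"
  shows "\<exists>g. coeffs_conv p g \<and> ev p g X0 \<notin> padic_null p \<and>
    (\<forall>X\<in>int_seqs p. ev p c X - (X - X0) ^ root_mult p f (cls p X0) * ev p g X \<in> padic_null p)"
proof -
  have c: "coeffs_conv p c" by (rule representsD(1)[OF p r])
  obtain v N where s: "strassmann p c v N" using analytic_nonzero_coeff[OF p r nz] .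
  obtain m g where g: "coeffs_conv p g" "ev p g X0 \<notin> padic_null p"
      "\<forall>X\<in>int_seqs p. ev p c X - (X - X0) ^ m * ev p g X \<in> padic_null p"
    using ev_factor[OF p X0 c s] by blast
  define P where "P m \<longleftrightarrow> (\<exists>g. analytic_Zp p g \<and>
        (\<forall>x\<in>Zp p. f x = (x \<ominus>\<^bsub>Qp p\<^esub> cls p X0) [^]\<^bsub>Qp p\<^esub> m \<otimes>\<^bsub>Qp p\<^esub> g x))" for m :: nat
  have X0C: "padic_Cauchy p X0" by (rule int_seqs_D(1)[OF X0])
  have expand: "(cls p X \<ominus>\<^bsub>Qp p\<^esub> cls p X0) [^]\<^bsub>Qp p\<^esub> m \<otimes>\<^bsub>Qp p\<^esub> cls p Z = cls p ((X - X0) ^ m * Z)"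
    if "X \<in> int_seqs p" "padic_Cauchy p Z" for X Z and m :: nat
  proof -
    have d: "padic_Cauchy p (X - X0)" by (rule padic_Cauchy_diff[OF p int_seqs_D(1)[OF that(1)] X0C])
    show ?thesis
      by (simp only: Qp_cls_simps(3)[OF p int_seqs_D(1)[OF that(1)] X0C] Qp_cls_simps(4)[OF p d d]
          Qp_cls_simps(2)[OF p padic_Cauchy_power[OF p d] that(2)])
  qed
  have "P m" unfolding P_def
  proof (intro exI conjI ballI)
    let ?g = "\<lambda>x. cls p (ev p g (SOME X. X \<in> int_seqs p \<and> x = cls p X))"
    have rg: "represents p g ?g" by (rule represents_exists[OF p g(1)])
    show "analytic_Zp p ?g" by (rule represents_analytic[OF p rg])
    fix x assume "x \<in> Zp p"
    then obtain X where X: "X \<in> int_seqs p" "x = cls p X" unfolding Zp_eq[OF p] by blast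
    have "f x = cls p ((X - X0) ^ m * ev p g X)"
      using representsD(2)[OF p r X(1)] g(3) X cls_eq_iff[OF p] by simp
    also have "\<dots> = (x \<ominus>\<^bsub>Qp p\<^esub> cls p X0) [^]\<^bsub>Qp p\<^esub> m \<otimes>\<^bsub>Qp p\<^esub> cls p (ev p g X)"
      unfolding X(2) by (rule expand[symmetric, OF X(1) ev_Cauchy[OF p g(1) X(1)]])
    also have "cls p (ev p g X) = ?g x"
      using representsD(2)[OF p rg X(1)] X(2) by simp
    finally show "f x = (x \<ominus>\<^bsub>Qp p\<^esub> cls p X0) [^]\<^bsub>Qp p\<^esub> m \<otimes>\<^bsub>Qp p\<^esub> ?g x" .
  qed
  moreover have "m' \<le> m" if Pm: "P m'" for m'
  proof (rule ccontr)
    assume "\<not> m' \<le> m"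
    then obtain d where d: "m' = m + Suc d" by (metis add_Suc_right less_imp_Suc_add not_le)
    obtain g' where g': "analytic_Zp p g'"
        "\<forall>x\<in>Zp p. f x = (x \<ominus>\<^bsub>Qp p\<^esub> cls p X0) [^]\<^bsub>Qp p\<^esub> m' \<otimes>\<^bsub>Qp p\<^esub> g' x"
      using Pm unfolding P_def by blast
    obtain c' where r': "represents p c' g'" using analytic_represents[OF p g'(1)] .
    have c': "coeffs_conv p c'" by (rule representsD(1)[OF p r'])
    define K' where "K' = coeff_loss p c'"
    define K where "K = coeff_loss p g"
    have "ev p g X0 \<in> sball p k" for k
    proof -
      \<comment> \<open>The point X = X0 + p^t is close to X0 but different from it, so (X - X0)^m
        can be cancelled; t pays for the losses K and K' of the two series.\<close>
      define t where "t = nat (k + int K + int K')"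
      define X where "X = X0 + (\<lambda>_. of_nat p ^ t)"
      have D: "X - X0 = (\<lambda>_. of_nat p ^ t)" by (rule ext) (simp add: X_def)
      have v: "seq_val p (X - X0) (int t)"
        using rball_prime_powi[OF p, of "int t"] by (simp add: D)
      have Xt: "X - X0 \<in> sball p (int t)" using seq_val_sball[OF v] by simp
      have XC: "padic_Cauchy p X" unfolding X_def by (intro padic_Cauchy_add[OF p X0C] padic_Cauchy_const)
      have "X \<in> sball p 0"
        using sball_diff_iff[OF p sball_mono[OF Xt, of 0]] int_seqs_D(2)[OF X0] by simp
      then have X: "X \<in> int_seqs p" using XC by (simp add: int_seqs_def)
      have DC: "padic_Cauchy p (X - X0)" by (rule padic_Cauchy_diff[OF p XC X0C])
      have "f (cls p X) = cls p ((X - X0) ^ m' * ev p c' X)"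
        using g'(2) X Zp_eq[OF p] expand[OF X ev_Cauchy[OF p c' X]] representsD(2)[OF p r' X] by simp
      then have "ev p c X - (X - X0) ^ m' * ev p c' X \<in> padic_null p"
        using representsD(2)[OF p r X] cls_eq_iff[OF p] by metis
      moreover have "(X - X0) ^ m * ev p g X - ev p c X \<in> padic_null p"
        using g(3) X padic_null_diff_swap[OF p] by blast
      ultimately have "(X - X0) ^ m * ev p g X - (X - X0) ^ m' * ev p c' X \<in> padic_null p"
        using padic_null_diff_trans[OF p] by blast
      then have "(X - X0) ^ m * (ev p g X - (X - X0) ^ Suc d * ev p c' X) \<in> padic_null p"
        unfolding d power_add by (simp only: right_diff_distrib mult.assoc)
      moreover have "(X - X0) ^ m \<notin> padic_null p"
        using seq_val_power[OF p v] seq_val_not_null by blast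
      moreover have "padic_Cauchy p (ev p g X - (X - X0) ^ Suc d * ev p c' X)"
        by (intro padic_Cauchy_diff[OF p] padic_Cauchy_mult[OF p] padic_Cauchy_power[OF p] DC
            ev_Cauchy[OF p] g(1) c' X)
      ultimately have n: "ev p g X - (X - X0) ^ Suc d * ev p c' X \<in> padic_null p"
        using padic_null_mult_iff[OF p padic_Cauchy_power[OF p DC]] by blast
      have "(X - X0) * ((X - X0) ^ d * ev p c' X) \<in> sball p (int t + (0 + - int K'))"
        unfolding K'_def by (intro sball_mult[OF p] Xt sball_power[OF p] sball_mono[OF Xt] ev_bounded[OF p c' X]) simp
      then have "(X - X0) ^ Suc d * ev p c' X \<in> sball p (int t - int K')"
        by (simp only: power_Suc mult.assoc) (simp only: add_0_left diff_conv_add_uminus)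
      then have "ev p g X \<in> sball p (int t - int K')"
        using sball_diff_iff[OF p padic_nullD[OF n]] by blast
      then have 1: "ev p g X \<in> sball p k" by (rule sball_mono) (simp add: t_def)
      have "ev p g X - ev p g X0 \<in> sball p (int t - int K)"
        unfolding K_def by (rule ev_lipschitz[OF p g(1) X X0 Xt])
      then have "ev p g X - ev p g X0 \<in> sball p k" by (rule sball_mono) (simp add: t_def)
      then show ?thesis using sball_diff_iff[OF p] 1 by blast
    qed
    then show False using g(2) by (simp add: padic_null_iff)
  qed
  ultimately have "root_mult p f (cls p X0) = m"
    unfolding root_mult_def P_def[symmetric] by (rule Greatest_equality)
  then show ?thesis using g by blast
qed

text \<open>Write f = (x - q)^m g with g(q) nonzero. A zero of g would be a zero of f, hence q, so g
  has no roots at all; its valuation h is then bounded and locally constant by compactness.\<close>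

lemma single_root_nat_val:
  assumes p: "prime p" and f: "analytic_Zp p f" and nz: "\<exists>x\<in>Zp p. f x \<noteq> \<zero>\<^bsub>Qp p\<^esub>"
    and roots: "roots_Zp p f = {of_rat_Qp p q}"
    and m: "m = root_mult p f (of_rat_Qp p q)"
  shows "m \<ge> 1"
    and "\<exists>h (M::nat) t.
      (\<forall>n v. val_rat p (of_nat n - q) = Fin v \<longrightarrow> nat_val p f n = Fin (int m * v + h n)) \<and>
      (\<forall>n. \<bar>h n\<bar> \<le> int M) \<and> (\<forall>n n'. [n = n'] (mod p ^ t) \<longrightarrow> h n = h n')"
proof -
  obtain c where r: "represents p c f" using analytic_represents[OF p f] .
  have c: "coeffs_conv p c" by (rule representsD(1)[OF p r])
  let ?X = "\<lambda>_::nat. q"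
  have "of_rat_Qp p q \<in> Zp p" using roots by (auto simp: roots_Zp_def)
  then have X0: "?X \<in> int_seqs p" by (simp add: of_rat_Qp_in_Zp_iff[OF p] const_int_seqs)
  obtain g where g: "coeffs_conv p g" "ev p g ?X \<notin> padic_null p"
      "\<And>X. X \<in> int_seqs p \<Longrightarrow> ev p c X - (X - ?X) ^ m * ev p g X \<in> padic_null p"
    using root_mult_factor[OF p f nz r X0] unfolding m of_rat_Qp_eq by blast
  have root0: "ev p c ?X \<in> padic_null p"
    using roots representsD(4)[OF p r X0] by (simp add: of_rat_Qp_eq)
  have "m \<noteq> 0"
  proof
    assume m0: "m = 0"
    have "ev p c ?X - ev p g ?X \<in> padic_null p" using g(3)[OF X0] by (simp only: m0 power_0 mult_1)
    then have "ev p c ?X - (ev p c ?X - ev p g ?X) \<in> padic_null p"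
      by (rule padic_null_diff[OF p root0])
    then show False using g(2) by simp
  qed
  then show "m \<ge> 1" by simp
  let ?g = "\<lambda>x. cls p (ev p g (SOME X. X \<in> int_seqs p \<and> x = cls p X))"
  have rg: "represents p g ?g" by (rule represents_exists[OF p g(1)])
  have ag: "analytic_Zp p ?g" by (rule represents_analytic[OF p rg])
  have "roots_Zp p ?g = {}"
  proof (rule ccontr)
    assume "\<not> ?thesis"
    then obtain x where x: "x \<in> roots_Zp p ?g" by blast
    then obtain X where X: "X \<in> int_seqs p" "x = cls p X" unfolding roots_Zp_def Zp_eq[OF p] by blast
    then have gX: "ev p g X \<in> padic_null p" using x representsD(4)[OF p rg X(1)] by blast
    have "ev p g X * (X - ?X) ^ m \<in> padic_null p"
      by (intro padic_null_mult[OF p gX] padic_Cauchy_power[OF p] padic_Cauchy_diff[OF p] int_seqs_D(1)[OF X(1)] padic_Cauchy_const)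
    then have "(ev p c X - (X - ?X) ^ m * ev p g X) + (X - ?X) ^ m * ev p g X \<in> padic_null p"
      by (intro padic_null_add[OF p] g(3)[OF X(1)]) (simp only: mult.commute)
    then have "ev p c X \<in> padic_null p" by (simp only: diff_add_cancel)
    then have "x \<in> roots_Zp p f" using representsD(4)[OF p r X(1)] X(2) by blast
    then have "cls p X = cls p ?X" using roots X(2) by (simp add: of_rat_Qp_eq)
    then have "ev p g X - ev p g ?X \<in> padic_null p"
      using ev_cong[OF p g(1) X(1) X0] cls_eq_iff[OF p] by blast
    then have "ev p g X - (ev p g X - ev p g ?X) \<in> padic_null p"
      by (rule padic_null_diff[OF p gX])
    then show False using g(2) by simp
  qed
  then obtain h M t where h: "\<And>n. nat_val p ?g n = Fin (h n)" "\<And>n. \<bar>h n\<bar> \<le> int M"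
      "\<And>n n'. [n = n'] (mod p ^ t) \<Longrightarrow> h n = h n'"
    using no_roots_nat_val[OF p ag] by metis
  have "nat_val p f n = Fin (int m * v + h n)" if v: "val_rat p (of_nat n - q) = Fin v" for n v
  proof -
    have N: "of_nat n \<in> int_seqs p" by (rule of_nat_int_seqs[OF p])
    have "ev p g (of_nat n) \<notin> padic_null p"
      using h(1)[of n] nat_val_eq[OF p rg, of n] val_Qp_cls_inf[OF p] by fastforce
    then obtain w where w: "seq_val p (ev p g (of_nat n)) w"
      using padic_Cauchy_cases[OF p ev_Cauchy[OF p g(1) N]] by metis
    then have "Fin w = Fin (h n)"
      using h(1)[of n] nat_val_eq[OF p rg, of n] val_Qp_cls_Fin[OF p w] by simp
    then have w: "seq_val p (ev p g (of_nat n)) (h n)" using w by simp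
    have "of_nat n - ?X = (\<lambda>_. of_nat n - q)" by (rule ext) simp
    then have "seq_val p (of_nat n - ?X) v" using v by simp
    then have A: "seq_val p ((of_nat n - ?X) ^ m * ev p g (of_nat n)) (int m * v + h n)"
      by (intro seq_val_mult[OF p] seq_val_power[OF p] w)
    have "seq_val p ((of_nat n - ?X) ^ m * ev p g (of_nat n) +
        (ev p c (of_nat n) - (of_nat n - ?X) ^ m * ev p g (of_nat n))) (int m * v + h n)"
      by (rule seq_val_add[OF p A padic_nullD[OF g(3)[OF N]]])
    moreover have "(of_nat n - ?X) ^ m * ev p g (of_nat n) +
        (ev p c (of_nat n) - (of_nat n - ?X) ^ m * ev p g (of_nat n)) = ev p c (of_nat n)"
      by (rule ext) simp
    ultimately have "seq_val p (ev p c (of_nat n)) (int m * v + h n)" by (simp only:)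
    then show ?thesis using nat_val_eq[OF p r, of n] val_Qp_cls_Fin[OF p] by simp
  qed
  then show "\<exists>h (M::nat) t.
      (\<forall>n v. val_rat p (of_nat n - q) = Fin v \<longrightarrow> nat_val p f n = Fin (int m * v + h n)) \<and>
      (\<forall>n. \<bar>h n\<bar> \<le> int M) \<and> (\<forall>n n'. [n = n'] (mod p ^ t) \<longrightarrow> h n = h n')"
    using h(2,3) by blast
qed

section \<open>Finitely generated modules of integer sequences\<close>

lemma int_ideal_principal:
  fixes I :: "int set"
  assumes "0 \<in> I" and diff: "\<And>x y. x \<in> I \<Longrightarrow> y \<in> I \<Longrightarrow> x - y \<in> I"
    and mult: "\<And>x c. x \<in> I \<Longrightarrow> c * x \<in> I"
  shows "\<exists>d\<in>I. \<forall>x\<in>I. d dvd x"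
proof (cases "I = {0}")
  case True
  then show ?thesis by auto
next
  case False
  then obtain x where x: "x \<in> I" "x \<noteq> 0" using assms(1) by blast
  define P where "P n \<longleftrightarrow> n > 0 \<and> int n \<in> I" for n
  have "\<bar>x\<bar> \<in> I" using x mult[of x "-1"] by (auto simp: abs_if)
  then have "P (nat \<bar>x\<bar>)" using x by (simp add: P_def)
  then have L: "P (LEAST n. P n)" by (rule LeastI)
  define d where "d = (LEAST n. P n)"
  have d: "d > 0" "int d \<in> I" using L by (auto simp: P_def d_def)
  have "int d dvd y" if y: "y \<in> I" for y
  proof -
    have "y mod int d = y - (y div int d) * int d" by (simp add: minus_div_mult_eq_mod)
    then have "y mod int d \<in> I" using diff[OF y mult[OF d(2)]] by simp
    moreover have "0 \<le> y mod int d" "y mod int d < int d" using d(1) by auto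
    ultimately have "\<not> P (nat (y mod int d)) \<Longrightarrow> y mod int d = 0" by (auto simp: P_def)
    moreover have "\<not> P (nat (y mod int d))"
      using not_less_Least[of "nat (y mod int d)" P] \<open>y mod int d < int d\<close> \<open>0 \<le> y mod int d\<close>
      by (simp add: d_def[symmetric] nat_less_iff)
    ultimately show ?thesis by auto
  qed
  then show ?thesis using d(2) by blast
qed

text \<open>\<open>\<int>\<close> is Noetherian: the coefficients at \<open>e\<close> form a principal ideal.\<close>

lemma subspace_finitely_generated:
  assumes "finite B"
  shows "int_seq.subspace M \<Longrightarrow> M \<subseteq> int_seq.span B \<Longrightarrow> \<exists>B'. finite B' \<and> int_seq.span B' = M"
  using assms
proof (induction B arbitrary: M rule: finite_induct)
  case empty
  then have "M = {0}" using int_seq.subspace_0 int_seq.span_empty by blast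
  then show ?case using int_seq.span_empty by blast
next
  case (insert e B)
  let ?S = "int_seq.span B"
  define I where "I = {c. \<exists>x\<in>?S. (\<lambda>n. c * e n) + x \<in> M}"
  have I_I: "c \<in> I" if "x \<in> ?S" "(\<lambda>n. c * e n) + x \<in> M" for c x
    unfolding I_def using that by (intro CollectI bexI)
  have scale: "(\<lambda>n. c * x n) \<in> M" if "x \<in> M" for c x
    using int_seq.subspace_scale[OF insert.prems(1) that] by simp
  have scaleS: "(\<lambda>n. c * x n) \<in> ?S" if "x \<in> ?S" for c x
    using int_seq.span_scale[OF that] by simp
  have "\<exists>d\<in>I. \<forall>c\<in>I. d dvd c"
  proof (rule int_ideal_principal[of I])
    have "(\<lambda>n. 0 * e n) + 0 = (0 :: nat \<Rightarrow> int)" by (rule ext) simp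
    then show "0 \<in> I"
      using int_seq.subspace_0[OF insert.prems(1)] by (intro I_I[OF int_seq.span_zero]) (simp only:)
  next
    fix a b assume "a \<in> I" "b \<in> I"
    then obtain x y where x: "x \<in> ?S" "(\<lambda>n. a * e n) + x \<in> M" and y: "y \<in> ?S" "(\<lambda>n. b * e n) + y \<in> M"
      unfolding I_def by blast
    have "((\<lambda>n. a * e n) + x) - ((\<lambda>n. b * e n) + y) \<in> M"
      by (rule int_seq.subspace_diff[OF insert.prems(1) x(2) y(2)])
    moreover have "((\<lambda>n. a * e n) + x) - ((\<lambda>n. b * e n) + y) = (\<lambda>n. (a - b) * e n) + (x - y)"
      by (rule ext) (simp add: algebra_simps)
    ultimately show "a - b \<in> I" by (intro I_I[OF int_seq.span_diff[OF x(1) y(1)]]) (simp only:)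
  next
    fix a c assume "a \<in> I"
    then obtain x where x: "x \<in> ?S" "(\<lambda>n. a * e n) + x \<in> M" unfolding I_def by (elim CollectE bexE)
    have "(\<lambda>n. c * ((\<lambda>n. a * e n) + x) n) \<in> M" by (rule scale[OF x(2)])
    moreover have "(\<lambda>n. c * ((\<lambda>n. a * e n) + x) n) = (\<lambda>n. (c * a) * e n) + (\<lambda>n. c * x n)"
      by (rule ext) (simp only: plus_fun_apply distrib_left mult.assoc)
    ultimately show "c * a \<in> I" by (intro I_I[OF scaleS[OF x(1), of c]]) (simp only:)
  qed
  then obtain d where d: "d \<in> I" "\<And>c. c \<in> I \<Longrightarrow> d dvd c" by (elim bexE) (rule that, blast+)
  have "\<exists>x\<in>?S. (\<lambda>n. d * e n) + x \<in> M" using d(1) by (simp only: I_def mem_Collect_eq)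
  then obtain x0 where x0: "x0 \<in> ?S" "(\<lambda>n. d * e n) + x0 \<in> M" by (rule bexE)
  define y where "y = (\<lambda>n. d * e n) + x0"
  have "\<exists>B'. finite B' \<and> int_seq.span B' = M \<inter> ?S"
    by (rule insert.IH[OF int_seq.subspace_inter[OF insert.prems(1) int_seq.subspace_span] Int_lower2])
  then obtain B' where B': "finite B'" "int_seq.span B' = M \<inter> ?S" by blast
  have "int_seq.span (insert y B') = M"
  proof
    have "insert y B' \<subseteq> M" using B'(2) x0(2) int_seq.span_superset[of B'] unfolding y_def by blast
    then show "int_seq.span (insert y B') \<subseteq> M" by (rule int_seq.span_minimal[OF _ insert.prems(1)])
  next
    show "M \<subseteq> int_seq.span (insert y B')"
    proof
      fix z assume z: "z \<in> M"
      then have "z \<in> int_seq.span (insert e B)" using insert.prems(2) by blast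
      then obtain c where c: "z - (\<lambda>n. c * e n) \<in> ?S"
        unfolding int_seq.span_insert mem_Collect_eq by (elim exE)
      have "(\<lambda>n. c * e n) + (z - (\<lambda>n. c * e n)) = z" by (rule ext) simp
      then have "c \<in> I" using z by (intro I_I[OF c]) (simp only:)
      then obtain q where q: "c = d * q" using d(2) by (auto elim: dvdE)
      have "z - (\<lambda>n. q * y n) = (z - (\<lambda>n. c * e n)) - (\<lambda>n. q * x0 n)"
        unfolding y_def q by (rule ext) (simp only: minus_apply plus_fun_apply distrib_left diff_diff_eq ac_simps)
      then have "z - (\<lambda>n. q * y n) \<in> ?S" using int_seq.span_diff[OF c scaleS[OF x0(1)]] by (simp only:)
      moreover have "z - (\<lambda>n. q * y n) \<in> M"
        using int_seq.subspace_diff[OF insert.prems(1) z scale[OF x0(2)]] unfolding y_def .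
      ultimately have "z - (\<lambda>n. q * y n) \<in> int_seq.span B'" unfolding B'(2) by (intro IntI)
      then show "z \<in> int_seq.span (insert y B')" 
        unfolding int_seq.span_insert by (intro CollectI exI)
    qed
  qed
  then show ?case using B'(1) by blast
qed

text \<open>A submodule of a finitely generated module of integer sequences is finitely generated,
  so the kernel may be placed in any convenient larger module.\<close>

lemma k_regularI:
  assumes "finite B" "kernel k a \<subseteq> int_seq.span B"
  shows "k_regular k a"
  unfolding k_regular_def
  using subspace_finitely_generated[OF assms(1), of "int_seq.span (kernel k a)"]
    int_seq.span_minimal[OF assms(2)] int_seq.subspace_span by blast

definition kernel_seq :: "nat \<Rightarrow> (nat \<Rightarrow> int) \<Rightarrow> nat \<times> nat \<Rightarrow> nat \<Rightarrow> int" where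
  "kernel_seq k a = (\<lambda>(i, j) n. a (k ^ i * n + j))"

lemma kernel_eq: "k \<ge> 1 \<Longrightarrow> kernel k a = kernel_seq k a ` {(i, j). j < k ^ i}"
proof -
  assume k: "k \<ge> 1"
  have "j \<le> k ^ i - 1 \<longleftrightarrow> j < k ^ i" for i j
    using k one_le_power[of k i] by linarith
  then show ?thesis unfolding kernel_def kernel_seq_def by (auto simp: image_iff)
qed

lemma span_finite_subset:
  assumes "x \<in> int_seq.span S"
  shows "\<exists>T. finite T \<and> T \<subseteq> S \<and> x \<in> int_seq.span T"
proof -
  obtain T r where T: "finite T" "T \<subseteq> S" and x: "x = (\<Sum>b\<in>T. (\<lambda>n. r b * b n))"
    using assms unfolding int_seq.span_explicit by blast
  have "x \<in> int_seq.span T" unfolding x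
    by (intro int_seq.span_sum int_seq.span_scale int_seq.span_base)
  then show ?thesis using T by blast
qed

text \<open>Each abstract generator is a combination of finitely many kernel sequences. Generators
  can thus be chosen inside the kernel, where their singularities are known.\<close>

lemma k_regularD:
  assumes "k_regular k a" and k: "k \<ge> 1"
  obtains K where "finite K" "K \<subseteq> {(i, j). j < k ^ i}"
    "\<And>i j. j < k ^ i \<Longrightarrow> kernel_seq k a (i, j) \<in> int_seq.span (kernel_seq k a ` K)"
proof -
  obtain B where B: "finite B" "int_seq.span B = int_seq.span (kernel k a)"
    using assms(1) unfolding k_regular_def by blast
  have "\<exists>T. finite T \<and> T \<subseteq> kernel k a \<and> b \<in> int_seq.span T" if "b \<in> B" for b
    by (rule span_finite_subset) (use int_seq.span_base[OF that] B(2) in simp)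
  then obtain T where T: "\<And>b. b \<in> B \<Longrightarrow> finite (T b)" "\<And>b. b \<in> B \<Longrightarrow> T b \<subseteq> kernel k a"
      "\<And>b. b \<in> B \<Longrightarrow> b \<in> int_seq.span (T b)" by metis
  define U where "U = (\<Union>b\<in>B. T b)"
  have U: "finite U" "U \<subseteq> kernel_seq k a ` {(i, j). j < k ^ i}"
    using B(1) T(1,2) kernel_eq[OF k] by (auto simp: U_def)
  obtain K where K: "K \<subseteq> {(i, j). j < k ^ i}" "finite K" "U = kernel_seq k a ` K"
    using finite_subset_image[OF U] by blast
  have "B \<subseteq> int_seq.span U"
  proof
    fix b assume b: "b \<in> B"
    then have "T b \<subseteq> U" by (auto simp: U_def)
    then show "b \<in> int_seq.span U" using T(3)[OF b] int_seq.span_mono by blast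
  qed
  then have "int_seq.span B \<subseteq> int_seq.span U" by (rule int_seq.span_minimal) (rule int_seq.subspace_span)
  moreover have "kernel_seq k a (i, j) \<in> int_seq.span B" if "j < k ^ i" for i j
    unfolding B(2) kernel_eq[OF k] by (rule int_seq.span_base) (use that in blast)
  ultimately show ?thesis using that[OF K(2,1)] K(3) by blast
qed

lemma prod_coprime_dvd:
  fixes g :: "'a \<Rightarrow> nat"
  assumes "finite A" "\<And>x y. x \<in> A \<Longrightarrow> y \<in> A \<Longrightarrow> x \<noteq> y \<Longrightarrow> coprime (g x) (g y)" "\<And>x. x \<in> A \<Longrightarrow> g x dvd m"
  shows "prod g A dvd m"
  using assms
proof (induction A rule: finite_induct)
  case (insert x A)
  have "coprime (g x) (prod g A)" using insert by (intro prod_coprime_right) auto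
  then show ?case using insert by (simp add: divides_mult)
qed simp

text \<open>The bound makes this set finite, so that it can serve as a set of generators.\<close>

definition periodic_seqs :: "int \<Rightarrow> nat \<Rightarrow> (nat \<Rightarrow> int) set" where
  "periodic_seqs C P = {g. (\<forall>n. \<bar>g n\<bar> \<le> C) \<and> (\<forall>n. g (n + P) = g n)}"

lemma finite_periodic_seqs:
  assumes P: "P > 0" shows "finite (periodic_seqs C P)"
proof -
  have mod: "g n = g (n mod P)" if "g \<in> periodic_seqs C P" for g n
  proof -
    have "g (m + c * P) = g m" for m c
    proof (induction c)
      case (Suc c)
      have "g (m + Suc c * P) = g ((m + c * P) + P)" by (simp add: algebra_simps)
      also have "\<dots> = g (m + c * P)" using that by (simp add: periodic_seqs_def)
      finally show ?case using Suc by simp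
    qed simp
    from this[of "n mod P" "n div P"] show ?thesis by simp
  qed
  have "inj_on (\<lambda>g. restrict g {..<P}) (periodic_seqs C P)"
  proof (rule inj_onI, rule ext)
    fix g g' n assume g: "g \<in> periodic_seqs C P" "g' \<in> periodic_seqs C P"
      and eq: "restrict g {..<P} = restrict g' {..<P}"
    have "g (n mod P) = g' (n mod P)" using fun_cong[OF eq, of "n mod P"] P by simp
    then show "g n = g' n" using mod[OF g(1), of n] mod[OF g(2), of n] by simp
  qed
  moreover have "(\<lambda>g. restrict g {..<P}) ` periodic_seqs C P \<subseteq> {..<P} \<rightarrow>\<^sub>E {- C..C}"
  proof (rule image_subsetI)
    fix g assume "g \<in> periodic_seqs C P"
    then show "restrict g {..<P} \<in> {..<P} \<rightarrow>\<^sub>E {- C..C}"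
      unfolding restrict_PiE_iff periodic_seqs_def by (auto simp: abs_le_iff minus_le_iff)
  qed
  moreover have "finite ({..<P} \<rightarrow>\<^sub>E {- C..C})" by (intro finite_PiE) auto
  ultimately show ?thesis using finite_imageD finite_subset by metis
qed

text \<open>A lower bound on a minimum of floors is a conjunction of linear inequalities, so
  comparing lower bounds avoids evaluating either operation.\<close>

lemma int_eq_if_same_lower_bounds: "(\<And>B. B \<le> x \<longleftrightarrow> B \<le> y) \<Longrightarrow> x = (y :: int)"
  by (meson order_antisym order_refl)

section \<open>Valuation sequences\<close>

locale val_seq =
  fixes s :: nat and p l :: "nat \<Rightarrow> nat" and f :: "nat \<Rightarrow> padic \<Rightarrow> padic" and a :: "nat \<Rightarrow> int"
  assumes s: "s \<ge> 2"
    and prime: "\<And>i. i \<in> {1..s} \<Longrightarrow> prime (p i)"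
    and distinct: "inj_on p {1..s}"
    and l: "\<And>i. i \<in> {1..s} \<Longrightarrow> l i \<ge> 1"
    and analytic: "\<And>i. i \<in> {1..s} \<Longrightarrow> analytic_Zp (p i) (f i)"
    and nonzero: "\<And>i. i \<in> {1..s} \<Longrightarrow> \<exists>x\<in>Zp (p i). f i x \<noteq> \<zero>\<^bsub>Qp (p i)\<^esub>"
    and a: "\<And>n. val_b s p l (eval_b s f (diag s p (of_nat n))) \<noteq> \<infinity> \<Longrightarrow>
              Fin (a n) = val_b s p l (eval_b s f (diag s p (of_nat n)))"
begin

abbreviation "R \<equiv> {1..s}"

definition u :: "nat \<Rightarrow> nat \<Rightarrow> int extended" where
  "u r n = nat_val (p r) (f r) n"

lemma one_in_R: "1 \<in> R" and R_ne: "R \<noteq> {}"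
  using s by auto

lemma of_nat_in_Zp: "r \<in> R \<Longrightarrow> of_rat_Qp (p r) (of_nat n) \<in> Zp (p r)"
  using of_rat_Qp_in_Zp_iff[OF prime] rball_of_nat[OF prime] by simp

lemma u_lower: obtains K :: nat where "\<And>r n. r \<in> R \<Longrightarrow> Fin (- int K) \<le> u r n"
proof -
  have "\<forall>r\<in>R. \<exists>K::nat. \<forall>x\<in>Zp (p r). Fin (- int K) \<le> val_Qp (p r) (f r x)"
    using analytic_val_bounded_below[OF prime analytic] by blast
  then obtain K where K: "\<And>r x. r \<in> R \<Longrightarrow> x \<in> Zp (p r) \<Longrightarrow> Fin (- int (K r)) \<le> val_Qp (p r) (f r x)"
    by metis
  have "Fin (- int (sum K R)) \<le> u r n" if r: "r \<in> R" for r n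
  proof -
    have "K r \<le> sum K R" using r by (intro member_le_sum) auto
    then have "Fin (- int (sum K R)) \<le> Fin (- int (K r))"
      by (simp only: less_eq_extended.simps neg_le_iff_le of_nat_le_iff)
    also have "\<dots> \<le> u r n" unfolding u_def nat_val_def by (rule K[OF r of_nat_in_Zp[OF r]])
    finally show ?thesis .
  qed
  then show ?thesis by (rule that)
qed

lemma u_ne_Minf: "r \<in> R \<Longrightarrow> u r n \<noteq> -\<infinity>"
  using u_lower by (metis le_Minf extended.distinct(3))

lemma floor_div_ge_iff: "L \<ge> 1 \<Longrightarrow> v \<noteq> -\<infinity> \<Longrightarrow> Fin M \<le> floor_div v L \<longleftrightarrow> Fin (M * int L) \<le> v"
proof (cases v)
  case (Fin z)
  assume "L \<ge> 1"
  then have L: "int L > 0" by simp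
  have "M * int L \<le> z" if "M \<le> z div int L"
  proof -
    have "M * int L \<le> z div int L * int L" using that L by (intro mult_right_mono) auto
    also have "\<dots> = z - z mod int L" by (simp add: minus_mod_eq_div_mult)
    also have "\<dots> \<le> z" using L by simp
    finally show ?thesis .
  qed
  moreover have "M \<le> z div int L" if "M * int L \<le> z"
    using zdiv_mono1[OF that L] L by simp
  ultimately have "M \<le> z div int L \<longleftrightarrow> M * int L \<le> z" by blast
  then show ?thesis by (simp add: Fin floor_div_def)
qed (simp_all add: floor_div_def)

lemma val_b_eq: "val_b s p l (eval_b s f (diag s p (of_nat n))) = Min ((\<lambda>r. floor_div (u r n) (l r)) ` R)"
  unfolding val_b_def eval_b_def diag_def u_def nat_val_def
  by (intro arg_cong[where f = Min] image_cong) auto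

text \<open>Finiteness of one component makes the minimum finite, which excludes the indices where
  \<open>a\<close> is arbitrary.\<close>

lemma a_ge_iff:
  assumes "r0 \<in> R" "u r0 n \<noteq> \<infinity>"
  shows "M \<le> a n \<longleftrightarrow> (\<forall>r\<in>R. Fin (M * int (l r)) \<le> u r n)"
proof -
  let ?m = "Min ((\<lambda>r. floor_div (u r n) (l r)) ` R)"
  have "floor_div (u r0 n) (l r0) \<noteq> \<infinity>"
    using assms(2) by (cases "u r0 n") (auto simp: floor_div_def)
  moreover have "?m \<le> floor_div (u r0 n) (l r0)" using assms(1) by (intro Min_le) auto
  ultimately have "?m \<noteq> \<infinity>" by auto
  then have "Fin (a n) = ?m" using a[of n] unfolding val_b_eq by blast
  then have "M \<le> a n \<longleftrightarrow> Fin M \<le> ?m" by (metis less_eq_extended.simps(1))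
  also have "\<dots> \<longleftrightarrow> (\<forall>r\<in>R. Fin M \<le> floor_div (u r n) (l r))"
    using R_ne by (subst Min_ge_iff) auto
  also have "\<dots> \<longleftrightarrow> (\<forall>r\<in>R. Fin (M * int (l r)) \<le> u r n)"
    using floor_div_ge_iff[OF l u_ne_Minf] by blast
  finally show ?thesis .
qed

lemma a_lower: obtains K :: nat where "\<And>r n. r \<in> R \<Longrightarrow> u r n \<noteq> \<infinity> \<Longrightarrow> - int K \<le> a n"
proof -
  obtain K :: nat where K: "\<And>r n. r \<in> R \<Longrightarrow> Fin (- int K) \<le> u r n" by (rule u_lower) blast
  have "- int K \<le> a n" if r: "r \<in> R" "u r n \<noteq> \<infinity>" for r n
    unfolding a_ge_iff[OF r]
  proof
    fix r assume r: "r \<in> R"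
    have "int K * 1 \<le> int K * int (l r)" using l[OF r] by (intro mult_left_mono) auto
    then have "Fin (- int K * int (l r)) \<le> Fin (- int K)" by simp
    also have "\<dots> \<le> u r n" by (rule K[OF r])
    finally show "Fin (- int K * int (l r)) \<le> u r n" .
  qed
  then show ?thesis by (rule that)
qed

abbreviation value_at :: "nat \<Rightarrow> (nat \<Rightarrow> rat) \<Rightarrow> int extended" where
  "value_at r X \<equiv> val_Qp (p r) (f r (cls (p r) X))"

text \<open>The precision is left as an eventual condition so that the demands of finitely many
  primes can be met at once.\<close>

lemma u_threshold:
  assumes r: "r \<in> R" and X: "X \<in> int_seqs (p r)"
  shows "\<forall>\<^sub>F t in sequentially. \<forall>n. of_nat n - X \<in> sball (p r) (int t) \<longrightarrow>
    (Fin k \<le> u r n \<longleftrightarrow> Fin k \<le> value_at r X)"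
proof -
  obtain t0 :: nat where t0: "\<forall>X\<in>int_seqs (p r). \<forall>Y\<in>int_seqs (p r). X - Y \<in> sball (p r) (int t0) \<longrightarrow>
    (Fin k \<le> value_at r X \<longleftrightarrow> Fin k \<le> value_at r Y)"
    using analytic_val_uniform[OF prime[OF r] analytic[OF r]] by (rule exE)
  have "Fin k \<le> u r n \<longleftrightarrow> Fin k \<le> value_at r X"
    if "t \<ge> t0" "of_nat n - X \<in> sball (p r) (int t)" for t n
  proof -
    have "of_nat n - X \<in> sball (p r) (int t0)" by (rule sball_mono[OF that(2)]) (use that(1) in simp)
    then show ?thesis unfolding u_def nat_val_def of_rat_Qp_of_nat
      using t0 of_nat_int_seqs[OF prime[OF r]] X by blast
  qed
  then show ?thesis unfolding eventually_sequentially by blast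
qed

lemma u_threshold_cong:
  assumes r: "r \<in> R"
  shows "\<forall>\<^sub>F t in sequentially. \<forall>n n'. [n = n'] (mod p r ^ t) \<longrightarrow> (Fin k \<le> u r n \<longleftrightarrow> Fin k \<le> u r n')"
proof -
  obtain t0 :: nat where t0: "\<forall>X\<in>int_seqs (p r). \<forall>Y\<in>int_seqs (p r). X - Y \<in> sball (p r) (int t0) \<longrightarrow>
    (Fin k \<le> value_at r X \<longleftrightarrow> Fin k \<le> value_at r Y)"
    using analytic_val_uniform[OF prime[OF r] analytic[OF r]] by (rule exE)
  have "Fin k \<le> u r n \<longleftrightarrow> Fin k \<le> u r n'"
    if "t \<ge> t0" "[n = n'] (mod p r ^ t)" for t n n'
  proof -
    have "of_nat n - of_nat n' \<in> sball (p r) (int t0)"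
      by (rule sball_mono[OF of_nat_diff_sball[OF prime[OF r] that(2)]]) (use that(1) in simp)
    then show ?thesis unfolding u_def nat_val_def of_rat_Qp_of_nat
      using t0 of_nat_int_seqs[OF prime[OF r]] by blast
  qed
  then show ?thesis unfolding eventually_sequentially by blast
qed

text \<open>A single component without roots caps \<open>a\<close> from above. Only finitely many
  thresholds k remain, each decided by n modulo a power of every p_r, and b^N is divisible by p_r^N
  because \<open>l r\<close> is positive.\<close>

lemma periodic_if_no_root:
  assumes "r0 \<in> R" and nr: "roots_Zp (p r0) (f r0) = {}"
  shows "\<exists>N. has_period ((\<Prod>i=1..s. p i ^ l i) ^ N) a"
proof -
  obtain h and M :: nat where h: "\<And>n. u r0 n = Fin (h n)" "\<And>n. \<bar>h n\<bar> \<le> int M"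
    unfolding u_def using no_roots_nat_val[OF prime[OF assms(1)] analytic[OF assms(1)] nr] by metis
  have fin: "u r0 n \<noteq> \<infinity>" for n by (simp add: h)
  obtain K :: nat where K: "\<And>r n. r \<in> R \<Longrightarrow> u r n \<noteq> \<infinity> \<Longrightarrow> - int K \<le> a n" by (rule a_lower) blast
  have upper: "a n \<le> int M" for n
  proof (rule ccontr)
    assume "\<not> ?thesis"
    then have "int M + 1 \<le> a n" by simp
    then have "Fin ((int M + 1) * int (l r0)) \<le> u r0 n"
      using a_ge_iff[OF assms(1) fin] assms(1) by blast
    then have "(int M + 1) * int (l r0) \<le> h n" by (simp add: h)
    moreover have "(int M + 1) * 1 \<le> (int M + 1) * int (l r0)"
      using l[OF assms(1)] by (intro mult_left_mono) auto
    ultimately have "(int M + 1) * 1 \<le> h n" by (rule order_trans[rotated])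
    then show False using abs_le_D1[OF h(2)[of n]] by simp
  qed
  have "\<forall>\<^sub>F t in sequentially. \<forall>k\<in>{- int K..int M}. \<forall>r\<in>R. \<forall>n n'. [n = n'] (mod p r ^ t) \<longrightarrow>
      (Fin (k * int (l r)) \<le> u r n \<longleftrightarrow> Fin (k * int (l r)) \<le> u r n')"
    using u_threshold_cong by (intro eventually_ball_finite ballI) auto
  then obtain N where N: "\<And>k r n n'. k \<in> {- int K..int M} \<Longrightarrow> r \<in> R \<Longrightarrow> [n = n'] (mod p r ^ N) \<Longrightarrow>
      Fin (k * int (l r)) \<le> u r n \<longleftrightarrow> Fin (k * int (l r)) \<le> u r n'"
    unfolding eventually_sequentially by blast
  let ?b = "\<Prod>i=1..s. p i ^ l i"
  have "a (n + ?b ^ N) = a n" for n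
  proof -
    have c: "[n + ?b ^ N = n] (mod p r ^ N)" if r: "r \<in> R" for r
    proof -
      have "p r dvd p r ^ l r" using l[OF r] by (simp add: dvd_power)
      also have "p r ^ l r dvd ?b" using r by (intro dvd_prodI) auto
      finally have "p r ^ N dvd ?b ^ N" by (rule dvd_power_same)
      then obtain q where "?b ^ N = p r ^ N * q" by (rule dvdE)
      then show ?thesis by (simp only: cong_def mod_mult_self2)
    qed
    have "k \<le> a (n + ?b ^ N) \<longleftrightarrow> k \<le> a n" if "k \<in> {- int K..int M}" for k
      unfolding a_ge_iff[OF assms(1) fin] by (intro ball_cong refl N[OF that] c)
    from this[of "a n"] this[of "a (n + ?b ^ N)"] show ?thesis
      using K[OF assms(1) fin, of n] K[OF assms(1) fin, of "n + ?b ^ N"] upper[of n] upper[of "n + ?b ^ N"]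
      by auto
  qed
  moreover have "?b ^ N > 0" using prime by (intro zero_less_power prod_pos) (auto simp: prime_gt_0_nat)
  ultimately show ?thesis unfolding has_period_def by blast
qed

section \<open>Approximation at all primes simultaneously, and singular points\<close>

definition near :: "nat \<Rightarrow> nat \<Rightarrow> (nat \<Rightarrow> nat \<Rightarrow> rat) \<Rightarrow> bool" where
  "near t n x \<longleftrightarrow> (\<forall>r\<in>R. of_nat n - x r \<in> sball (p r) (int t))"

lemma near_mono: "near t n x \<Longrightarrow> t' \<le> t \<Longrightarrow> near t' n x"
  unfolding near_def using sball_mono by (meson of_nat_mono)

lemma coprime_p:
  assumes "i \<in> R" "j \<in> R" "i \<noteq> j" shows "coprime (p i ^ x) (p j ^ y)"
proof -
  have "p i \<noteq> p j" using inj_on_eq_iff[OF distinct assms(1,2)] assms(3) by blast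
  then have "coprime (p i) (p j)" by (rule primes_coprime[OF prime[OF assms(1)] prime[OF assms(2)]])
  then show ?thesis by simp
qed

text \<open>Density of the naturals combined with the Chinese remainder theorem. The bound by the
  modulus yields admissible kernel indices; the shifts by c supply arbitrarily large approximations
  and many distinct preimages.\<close>

lemma simultaneous_approx:
  assumes x: "\<And>r. r \<in> R \<Longrightarrow> x r \<in> int_seqs (p r)"
  shows "\<exists>n. n < (\<Prod>r\<in>R. p r ^ t r) \<and> (\<forall>c. \<forall>r\<in>R. of_nat (n + c * (\<Prod>r\<in>R. p r ^ t r)) - x r \<in> sball (p r) (int (t r)))"
proof -
  have "\<forall>r\<in>R. \<exists>m::nat. of_nat m - x r \<in> sball (p r) (int (t r))"
    using sball_approx_nat[OF prime int_seqs_D(1)[OF x] int_seqs_D(2)[OF x]] by metis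
  then obtain m where m: "\<And>r. r \<in> R \<Longrightarrow> of_nat (m r) - x r \<in> sball (p r) (int (t r))" by metis
  let ?P = "\<Prod>r\<in>R. p r ^ t r"
  obtain y where y: "\<And>r. r \<in> R \<Longrightarrow> [y = m r] (mod p r ^ t r)"
    using chinese_remainder_nat[of R "\<lambda>r. p r ^ t r" m] coprime_p by blast
  have "?P > 0" using prime by (intro prod_pos) (auto simp: prime_gt_0_nat)
  moreover have "of_nat (y mod ?P + c * ?P) - x r \<in> sball (p r) (int (t r))" if r: "r \<in> R" for r c
  proof -
    have "p r ^ t r dvd ?P" using r by (intro dvd_prodI) auto
    moreover have "[y mod ?P + c * ?P = y] (mod ?P)" by (simp add: cong_def)
    ultimately have "[y mod ?P + c * ?P = y] (mod p r ^ t r)" using cong_dvd_modulus_nat by blast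
    then have "[y mod ?P + c * ?P = m r] (mod p r ^ t r)" using y[OF r] cong_trans by blast
    then show ?thesis using of_nat_diff_sball[OF prime[OF r]] m[OF r] sball_diff_trans[OF prime[OF r]] by blast
  qed
  ultimately show ?thesis by (intro exI[of _ "y mod ?P"]) auto
qed

lemma simultaneous_approx_rat:
  assumes y: "\<And>r. r \<in> R \<Longrightarrow> y r \<in> rball (p r) 0"
  obtains n :: nat where "\<And>r. r \<in> R \<Longrightarrow> of_nat n - y r \<in> rball (p r) (int (t r))"
proof -
  have "\<exists>n. n < (\<Prod>r\<in>R. p r ^ t r) \<and> (\<forall>c. \<forall>r\<in>R. of_nat (n + c * (\<Prod>r\<in>R. p r ^ t r)) - (\<lambda>_. y r) \<in> sball (p r) (int (t r)))"
    using y by (intro simultaneous_approx) (simp add: const_int_seqs)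
  then obtain n where n: "\<And>r. r \<in> R \<Longrightarrow> of_nat n - (\<lambda>_. y r) \<in> sball (p r) (int (t r))"
    by (metis add.right_neutral mult_zero_left)
  have "of_nat n - y r \<in> rball (p r) (int (t r))" if "r \<in> R" for r
  proof -
    have "of_nat n - (\<lambda>_. y r) = (\<lambda>_::nat. of_nat n - y r)" by (rule ext) simp
    then show ?thesis using n[OF that] by simp
  qed
  then show ?thesis by (rule that)
qed

definition singular :: "(nat \<Rightarrow> nat \<Rightarrow> rat) \<Rightarrow> bool" where
  "singular x \<longleftrightarrow> (\<forall>r\<in>R. cls (p r) (x r) \<in> roots_Zp (p r) (f r))"

definition affine :: "nat \<Rightarrow> nat \<Rightarrow> nat \<Rightarrow> (nat \<Rightarrow> nat \<Rightarrow> rat) \<Rightarrow> nat \<Rightarrow> nat \<Rightarrow> rat" where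
  "affine k i j x = (\<lambda>r n. of_nat (k ^ i) * x r n + of_nat j)"

lemma affine_eq: "affine k i j x r = of_nat (k ^ i) * x r + of_nat j"
  by (rule ext) (simp add: affine_def del: of_nat_power)

lemma affine_int_seqs:
  assumes r: "r \<in> R" and x: "x r \<in> int_seqs (p r)" shows "affine k i j x r \<in> int_seqs (p r)"
proof -
  have p: "Factorial_Ring.prime (p r)" by (rule prime[OF r])
  show ?thesis
    unfolding int_seqs_def affine_eq
    using int_seqs_D[OF x] sball_of_nat[OF p] sball_mult[OF p sball_of_nat[OF p], of "x r" 0 "k ^ i"]
    by (auto intro!: padic_Cauchy_add[OF p] padic_Cauchy_mult[OF p] sball_add[OF p] simp del: of_nat_power)
qed

lemma affine_diff: "of_nat (k ^ i * n + j) - affine k i j x r = of_nat (k ^ i) * (of_nat n - x r)"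
  by (rule ext) (simp add: affine_eq algebra_simps flip: of_nat_power)

lemma near_affine:
  assumes "near t n x" and r: "r \<in> R"
  shows "of_nat (k ^ i * n + j) - affine k i j x r \<in> sball (p r) (int t)"
proof -
  have "of_nat (k ^ i) * (of_nat n - x r) \<in> sball (p r) (0 + int t)"
    using assms by (intro sball_mult[OF prime[OF r]] sball_of_nat[OF prime[OF r]]) (auto simp: near_def)
  then show ?thesis unfolding affine_diff by simp
qed

lemma finite_roots: "r \<in> R \<Longrightarrow> finite (roots_Zp (p r) (f r))"
  using finite_roots_Zp[OF prime analytic nonzero] .

text \<open>An infinite valuation at n makes n a root of \<open>f r\<close>, of which there are
  finitely many; this confines the indices where \<open>a\<close> may be arbitrary.\<close>

lemma finite_u_infinite:
  assumes r: "r \<in> R" shows "finite {n. u r n = \<infinity>}"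
proof -
  have p: "Factorial_Ring.prime (p r)" by (rule prime[OF r])
  let ?q = "\<lambda>n. of_rat_Qp (p r) (of_nat n)"
  obtain c where c: "represents (p r) c (f r)" using analytic_represents[OF p analytic[OF r]] .
  have "?q n \<in> roots_Zp (p r) (f r)" if "u r n = \<infinity>" for n
  proof -
    have "Fin k \<le> val_Qp (p r) (f r (cls (p r) (of_nat n)))" for k
      using that by (simp add: u_def nat_val_def of_rat_Qp_of_nat)
    then show ?thesis
      using representsD(3,4)[OF p c of_nat_int_seqs[OF p]] of_rat_Qp_of_nat padic_null_iff by simp
  qed
  then have "?q ` {n. u r n = \<infinity>} \<subseteq> roots_Zp (p r) (f r)" by blast
  moreover have "inj_on ?q {n. u r n = \<infinity>}"
    using of_rat_Qp_eq_iff[OF p] by (auto simp: inj_on_def)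
  ultimately show ?thesis using finite_roots[OF r] finite_imageD finite_subset by blast
qed

section \<open>Singular points of the kernel\<close>

lemma val_at_root:
  assumes r: "r \<in> R" and "X \<in> int_seqs (p r)" "cls (p r) X \<in> roots_Zp (p r) (f r)"
  shows "Fin k \<le> value_at r X"
proof -
  have p: "Factorial_Ring.prime (p r)" by (rule prime[OF r])
  obtain c where c: "represents (p r) c (f r)" using analytic_represents[OF p analytic[OF r]] .
  show ?thesis using representsD(3,4)[OF p c assms(2)] assms(3) padic_nullD by blast
qed

lemma val_off_root:
  assumes r: "r \<in> R" and X: "X \<in> int_seqs (p r)" and "cls (p r) X \<notin> roots_Zp (p r) (f r)"
  obtains v where "\<not> Fin v \<le> value_at r X"
proof -
  have p: "Factorial_Ring.prime (p r)" by (rule prime[OF r])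
  obtain c where c: "represents (p r) c (f r)" using analytic_represents[OF p analytic[OF r]] .
  have "ev (p r) c X \<notin> padic_null (p r)" using representsD(4)[OF p c X] assms(3) by blast
  then obtain v where "ev (p r) c X \<notin> sball (p r) v" by (auto simp: padic_null_iff)
  then show ?thesis using that representsD(3)[OF p c X] by blast
qed

text \<open>One coordinate r at which k^i x + j is not a root keeps the r-th valuation below a fixed
  v near x. That caps the minimum, and it also makes this component finite, so no arbitrary value of
  \<open>a\<close> occurs.\<close>

lemma bounded_near_nonsingular:
  assumes x: "\<And>r. r \<in> R \<Longrightarrow> x r \<in> int_seqs (p r)" and ns: "\<not> singular (affine k i j x)"
  shows "\<exists>t (M::nat). \<forall>n. near t n x \<longrightarrow> \<bar>a (k ^ i * n + j)\<bar> \<le> int M"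
proof -
  let ?y = "affine k i j x"
  obtain r where r: "r \<in> R" "cls (p r) (?y r) \<notin> roots_Zp (p r) (f r)"
    using ns unfolding singular_def by blast
  have y: "?y r \<in> int_seqs (p r)" by (rule affine_int_seqs[where x = x, OF r(1) x[OF r(1)]])
  obtain v where v: "\<not> Fin v \<le> value_at r (?y r)"
    using val_off_root[OF r(1) y r(2)] .
  obtain t where t: "\<And>n. of_nat n - ?y r \<in> sball (p r) (int t) \<Longrightarrow>
      Fin v \<le> u r n \<longleftrightarrow> Fin v \<le> value_at r (?y r)"
    using u_threshold[OF r(1) y, of v] unfolding eventually_sequentially by blast
  obtain K :: nat where K: "\<And>r n. r \<in> R \<Longrightarrow> u r n \<noteq> \<infinity> \<Longrightarrow> - int K \<le> a n" by (rule a_lower) blast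
  have "\<bar>a (k ^ i * n + j)\<bar> \<le> int (K + nat \<bar>v\<bar>)" if n: "near t n x" for n
  proof -
    let ?n = "k ^ i * n + j"
    have nv: "\<not> Fin v \<le> u r ?n" using t[OF near_affine[OF n r(1)]] v by blast
    then have fin: "u r ?n \<noteq> \<infinity>" by auto
    have "a ?n \<le> \<bar>v\<bar>"
    proof (rule ccontr)
      assume "\<not> ?thesis"
      then have "\<bar>v\<bar> \<le> a ?n" by simp
      then have "Fin (\<bar>v\<bar> * int (l r)) \<le> u r ?n" using a_ge_iff[OF r(1) fin] r(1) by blast
      moreover have "v \<le> \<bar>v\<bar> * int (l r)"
      proof -
        have "\<bar>v\<bar> * 1 \<le> \<bar>v\<bar> * int (l r)" using l[OF r(1)] by (intro mult_left_mono) auto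
        then show ?thesis by linarith
      qed
      ultimately have "Fin v \<le> u r ?n" by (meson less_eq_extended.simps(1) order_trans)
      then show False using nv by blast
    qed
    moreover have "- int K \<le> a ?n" by (rule K[OF r(1) fin])
    ultimately show ?thesis by linarith
  qed
  then show ?thesis by blast
qed

lemma unbounded_near_singular:
  assumes k: "k \<ge> 1" and x: "\<And>r. r \<in> R \<Longrightarrow> x r \<in> int_seqs (p r)" and sg: "singular (affine k i j x)"
  shows "\<exists>n. near t n x \<and> M \<le> a (k ^ i * n + j)"
proof -
  let ?y = "affine k i j x"
  have y: "?y r \<in> int_seqs (p r)" if "r \<in> R" for r by (rule affine_int_seqs[where x = x, OF that x[OF that]])
  have "\<forall>\<^sub>F t in sequentially. \<forall>r\<in>R. \<forall>n. of_nat n - ?y r \<in> sball (p r) (int t) \<longrightarrow>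
    (Fin (M * int (l r)) \<le> u r n \<longleftrightarrow> Fin (M * int (l r)) \<le> value_at r (?y r))"
    using u_threshold[OF _ y] by (intro eventually_ball_finite ballI) auto
  then obtain T where T: "\<And>r n. r \<in> R \<Longrightarrow> of_nat n - ?y r \<in> sball (p r) (int T) \<Longrightarrow>
    (Fin (M * int (l r)) \<le> u r n \<longleftrightarrow> Fin (M * int (l r)) \<le> value_at r (?y r))"
    unfolding eventually_sequentially by blast
  define T' where "T' = max t T"
  define P where "P = (\<Prod>r\<in>R. p r ^ T')"
  obtain n0 where n0: "\<forall>c. \<forall>r\<in>R. of_nat (n0 + c * P) - x r \<in> sball (p r) (int T')"
    using simultaneous_approx[of x "\<lambda>_. T'"] x unfolding P_def by blast
  \<comment> \<open>Indices where \<open>a\<close> could be arbitrary lie in Z. Shifting n past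
    \<open>Max Z\<close> by a multiple of P keeps it near x and moves k^i n + j out of Z; the 0
    makes Z nonempty.\<close>
  define Z where "Z = insert 0 {n. u 1 n = \<infinity>}"
  have Z: "finite Z" using finite_u_infinite[OF one_in_R] by (simp add: Z_def)
  define n where "n = n0 + Suc (Max Z) * P"
  have near: "near T' n x" using n0 unfolding near_def n_def by blast
  have "P > 0" unfolding P_def using prime by (intro prod_pos) (auto simp: prime_gt_0_nat)
  then have "Suc (Max Z) * 1 \<le> Suc (Max Z) * P" by (intro mult_le_mono2) simp
  then have "Max Z < Suc (Max Z) * P" by (simp only: mult_1_right Suc_le_eq)
  then have "Max Z < n" by (simp add: n_def)
  also have "n \<le> k ^ i * n + j" using mult_le_mono1[of 1 "k ^ i" n] k one_le_power[of k i] by linarith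
  finally have "k ^ i * n + j \<notin> Z" using Max_ge[OF Z] by (meson not_le)
  then have fin: "u 1 (k ^ i * n + j) \<noteq> \<infinity>" by (simp add: Z_def)
  have "Fin (M * int (l r)) \<le> u r (k ^ i * n + j)" if r: "r \<in> R" for r
  proof -
    have "near T n x" using near_mono[OF near] by (simp add: T'_def)
    then show ?thesis
      using T[OF r near_affine[OF _ r]] val_at_root[OF r y[OF r]] sg r unfolding singular_def by blast
  qed
  then have "M \<le> a (k ^ i * n + j)" using a_ge_iff[OF one_in_R fin] by blast
  moreover have "near t n x" using near_mono[OF near] by (simp add: T'_def)
  ultimately show ?thesis by blast
qed

text \<open>
  The sequences bounded near \<open>x\<close> form a module, so a finite generating set of the kernel contains
  a sequence unbounded near \<open>x\<close> whenever the kernel does.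
\<close>

lemma singular_transfer:
  assumes k: "k \<ge> 1" and K: "finite K"
    and span: "kernel_seq k a (i, j) \<in> int_seq.span (kernel_seq k a ` K)"
    and x: "\<And>r. r \<in> R \<Longrightarrow> x r \<in> int_seqs (p r)" and sg: "singular (affine k i j x)"
  shows "\<exists>(i', j')\<in>K. singular (affine k i' j' x)"
proof (rule ccontr)
  assume neg: "\<not> ?thesis"
  define S where "S = {g :: nat \<Rightarrow> int. \<exists>t (M::nat). \<forall>n. near t n x \<longrightarrow> \<bar>g n\<bar> \<le> int M}"
  have "int_seq.subspace S"
  proof (rule int_seq.subspaceI)
    show "0 \<in> S" unfolding S_def by auto
  next
    fix g h assume "g \<in> S" "h \<in> S"
    then obtain t t' M M' where g: "\<And>n. near t n x \<Longrightarrow> \<bar>g n\<bar> \<le> int M" and h: "\<And>n. near t' n x \<Longrightarrow> \<bar>h n\<bar> \<le> int M'"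
      unfolding S_def by blast
    have "\<bar>(g + h) n\<bar> \<le> int (M + M')" if "near (max t t') n x" for n
      using g[of n] h[of n] near_mono[OF that, of t] near_mono[OF that, of t'] by simp
    then show "g + h \<in> S" unfolding S_def by blast
  next
    fix c g assume "g \<in> S"
    then obtain t M where g: "\<And>n. near t n x \<Longrightarrow> \<bar>g n\<bar> \<le> int M" unfolding S_def by blast
    have "\<bar>c * g n\<bar> \<le> int (nat \<bar>c\<bar> * M)" if "near t n x" for n
      using mult_left_mono[OF g[OF that], of "\<bar>c\<bar>"] by (simp add: abs_mult)
    then show "(\<lambda>n. c * g n) \<in> S" unfolding S_def by blast
  qed
  moreover have "kernel_seq k a ` K \<subseteq> S"
  proof
    fix g assume "g \<in> kernel_seq k a ` K"
    then obtain i' j' where ij: "(i', j') \<in> K" "g = kernel_seq k a (i', j')" by auto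
    then have "\<not> singular (affine k i' j' x)" using neg by blast
    then show "g \<in> S" using bounded_near_nonsingular[OF x] unfolding S_def ij(2) kernel_seq_def by simp
  qed
  ultimately have "int_seq.span (kernel_seq k a ` K) \<subseteq> S" by (rule int_seq.span_minimal[rotated])
  then have "kernel_seq k a (i, j) \<in> S" using span by blast
  then obtain t and M :: nat where tM: "\<And>n. near t n x \<Longrightarrow> \<bar>a (k ^ i * n + j)\<bar> \<le> int M"
    unfolding S_def kernel_seq_def by auto
  obtain n where "near t n x" "int M + 1 \<le> a (k ^ i * n + j)"
    using unbounded_near_singular[OF k x sg] by blast
  then show False using tM[of n] by linarith
qed

section \<open>Counting points above a singularity\<close>

definition tuple :: "(nat \<Rightarrow> nat \<Rightarrow> rat) \<Rightarrow> nat \<Rightarrow> padic" where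
  "tuple x = (\<lambda>r\<in>R. cls (p r) (x r))"

lemma tuple_in_roots: "singular x \<longleftrightarrow> tuple x \<in> roots_b s p f"
  unfolding singular_def tuple_def roots_b_def by (auto simp: PiE_iff)

lemma finite_roots_b: "finite (roots_b s p f)"
  unfolding roots_b_def using finite_roots by (intro finite_PiE) auto

lemma tuple_eq_iff: "tuple x = tuple y \<longleftrightarrow> (\<forall>r\<in>R. x r - y r \<in> padic_null (p r))"
proof -
  have "tuple x = tuple y \<longleftrightarrow> (\<forall>r\<in>R. cls (p r) (x r) = cls (p r) (y r))"
    unfolding tuple_def by (auto simp: restrict_def fun_eq_iff)
  also have "\<dots> \<longleftrightarrow> (\<forall>r\<in>R. x r - y r \<in> padic_null (p r))"
    by (intro ball_cong refl cls_eq_iff prime)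
  finally show ?thesis .
qed

text \<open>The factor k^i is not null and there are no zero divisors, so x \<mapsto> k^i x + j is
  injective on classes.\<close>

lemma affine_cancel:
  assumes k: "k \<ge> 1" and x: "\<And>r. r \<in> R \<Longrightarrow> x r \<in> int_seqs (p r)" and y: "\<And>r. r \<in> R \<Longrightarrow> y r \<in> int_seqs (p r)"
    and eq: "tuple (affine k i j x) = tuple (affine k i j y)" and r: "r \<in> R"
  shows "x r - y r \<in> padic_null (p r)"
proof -
  have p: "Factorial_Ring.prime (p r)" by (rule prime[OF r])
  have "affine k i j x r - affine k i j y r \<in> padic_null (p r)" using eq r tuple_eq_iff by blast
  moreover have "affine k i j x r - affine k i j y r = of_nat (k ^ i) * (x r - y r)"
    unfolding affine_eq by (rule ext) (simp add: right_diff_distrib)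
  ultimately have "of_nat (k ^ i) * (x r - y r) \<in> padic_null (p r)" by simp
  moreover have "of_nat (k ^ i) \<notin> padic_null (p r)"
  proof -
    have "seq_val (p r) (of_nat (k ^ i)) (int (i * multiplicity (p r) k))"
      using val_rat_power_of_nat(1)[OF p, of k i] k unfolding of_nat_fun by simp
    then show ?thesis by (rule seq_val_not_null)
  qed
  ultimately show ?thesis
    using padic_null_mult_iff[OF p padic_Cauchy_of_nat padic_Cauchy_diff[OF p]]
      int_seqs_D(1)[OF x[OF r]] int_seqs_D(1)[OF y[OF r]] by blast
qed

definition preimage :: "nat \<Rightarrow> nat \<Rightarrow> nat \<Rightarrow> (nat \<Rightarrow> nat \<Rightarrow> rat) \<Rightarrow> nat \<Rightarrow> nat \<Rightarrow> rat" where
  "preimage k i j x = (\<lambda>r n. (x r n - of_nat j) * (1 / of_nat (k ^ i)))"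

lemma affine_preimage: "k \<ge> 1 \<Longrightarrow> affine k i j (preimage k i j x) = x"
  by (intro ext) (simp add: affine_def preimage_def)

lemma preimage_diff:
  "preimage k i j x r - preimage k i j' x r = (\<lambda>_. (of_nat j' - of_nat j) * (1 / of_nat (k ^ i)))"
proof -
  have "(y - b) * c - (y - b') * c = (b' - b) * c" for y b b' c :: rat by (simp add: algebra_simps)
  then show ?thesis by (intro ext) (simp only: preimage_def minus_apply)
qed

text \<open>Dividing by k^i lowers the valuation at p_r by i times the multiplicity of p_r in k,
  which the precision of the approximation j to x exactly makes up for.\<close>

lemma preimage_int_seqs:
  assumes k: "k \<ge> 1" and r: "r \<in> R" and x: "x r \<in> int_seqs (p r)"
    and j: "of_nat j - x r \<in> sball (p r) (int (i * multiplicity (p r) k))"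
  shows "preimage k i j x r \<in> int_seqs (p r)"
proof -
  have p: "Factorial_Ring.prime (p r)" by (rule prime[OF r])
  have eq: "preimage k i j x r = (x r - of_nat j) * (\<lambda>_. 1 / of_nat (k ^ i))"
    by (rule ext) (simp add: preimage_def)
  have "(\<lambda>_. 1 / of_nat (k ^ i)) \<in> sball (p r) (- int (i * multiplicity (p r) k))"
    unfolding sball_const rball_def using val_rat_power_of_nat(2)[OF p, of k i] k by simp
  then have "preimage k i j x r \<in> sball (p r) (int (i * multiplicity (p r) k) + - int (i * multiplicity (p r) k))"
    unfolding eq by (intro sball_mult[OF p] sball_diff_swap[OF p j])
  moreover have "padic_Cauchy (p r) (preimage k i j x r)"
    unfolding eq by (intro padic_Cauchy_mult[OF p] padic_Cauchy_diff[OF p] int_seqs_D(1)[OF x]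
        padic_Cauchy_of_nat padic_Cauchy_const)
  ultimately show ?thesis by (simp add: int_seqs_def)
qed

text \<open>
  If a prime \<open>q \<mid> k\<close> is none of the \<open>p r\<close>, a singular point has at least \<open>q ^ i\<close> distinct preimages
  under the maps \<open>x \<mapsto> k ^ i x + j\<close>, more than the finitely many available singularities.
\<close>

lemma k_regular_prime_factors:
  assumes reg: "k_regular k a" and k: "k \<ge> 1" and x: "\<And>r. r \<in> R \<Longrightarrow> x r \<in> int_seqs (p r)"
    and sg: "singular x" and q: "prime q" "q dvd k"
  shows "q \<in> p ` R"
proof (rule ccontr)
  assume nq: "q \<notin> p ` R"
  obtain K where K: "finite K" "K \<subseteq> {(i, j). j < k ^ i}"
    "\<And>i j. j < k ^ i \<Longrightarrow> kernel_seq k a (i, j) \<in> int_seq.span (kernel_seq k a ` K)"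
    using k_regularD[OF reg k] by blast
  \<comment> \<open>The size of the pigeonhole target doubles as the exponent of k, since q^N >
    N.\<close>
  define N where "N = card (K \<times> roots_b s p f)"
  let ?e = "\<lambda>r. multiplicity (p r) k"
  let ?P = "\<Prod>r\<in>R. p r ^ (N * ?e r)"
  obtain j0 where j0: "j0 < ?P"
      "\<And>c r. r \<in> R \<Longrightarrow> of_nat (j0 + c * ?P) - x r \<in> sball (p r) (int (N * ?e r))"
    using simultaneous_approx[of x "\<lambda>r. N * ?e r"] x by blast
  let ?j = "\<lambda>c. j0 + c * ?P"
  let ?x = "\<lambda>c. preimage k N (?j c) x"
  \<comment> \<open>The primes p_r only prescribe j modulo \<open>?P\<close>; the coprime factor q^N
    of k^N leaves room for q^N shifts below k^N.\<close>
  have P: "?P * q ^ N dvd k ^ N"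
  proof (rule divides_mult)
    show "?P dvd k ^ N"
    proof (rule prod_coprime_dvd)
      fix r assume "r \<in> R"
      have "p r ^ ?e r dvd k" by (rule multiplicity_dvd)
      then show "p r ^ (N * ?e r) dvd k ^ N" by (metis dvd_power_same mult.commute power_mult)
    qed (use coprime_p in auto)
    show "q ^ N dvd k ^ N" using q by (simp add: dvd_power_same)
    show "coprime ?P (q ^ N)"
    proof (rule prod_coprime_left)
      fix r assume r: "r \<in> R"
      then have "p r \<noteq> q" using nq by blast
      then have "coprime (p r) q" by (rule primes_coprime[OF prime[OF r] q(1)])
      then show "coprime (p r ^ (N * ?e r)) (q ^ N)" by simp
    qed
  qed
  have jlt: "?j c < k ^ N" if "c < q ^ N" for c
  proof -
    have "?j c < ?P + c * ?P" using j0(1) by simp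
    also have "\<dots> = Suc c * ?P" by simp
    also have "\<dots> \<le> q ^ N * ?P" using that by (intro mult_le_mono1) simp
    also have "\<dots> \<le> k ^ N" using dvd_imp_le[OF P] k by (simp add: mult.commute)
    finally show ?thesis .
  qed
  have xc: "?x c r \<in> int_seqs (p r)" if "r \<in> R" for c r
    by (rule preimage_int_seqs[where x = x, OF k that x[OF that] j0(2)[OF that]])
  have "\<exists>z\<in>K. singular (affine k (fst z) (snd z) (?x c))" if "c < q ^ N" for c
  proof -
    have sgc: "singular (affine k N (?j c) (?x c))" using sg by (simp only: affine_preimage[OF k])
    have "\<exists>(i', j')\<in>K. singular (affine k i' j' (?x c))"
      by (rule singular_transfer[OF k K(1) K(3)[OF jlt[OF that]] _ sgc]) (rule xc)
    then show ?thesis by (simp only: case_prod_unfold)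
  qed
  then obtain z where z: "\<And>c. c < q ^ N \<Longrightarrow> z c \<in> K"
      "\<And>c. c < q ^ N \<Longrightarrow> singular (affine k (fst (z c)) (snd (z c)) (?x c))" by metis
  \<comment> \<open>Records a generator singular at the preimage and the common root to which it
    sends the preimage. Affine maps being injective, this pair determines the preimage and hence
    c.\<close>
  define F where "F c = (z c, tuple (affine k (fst (z c)) (snd (z c)) (?x c)))" for c
  have "inj_on F {..<q ^ N}"
  proof (rule inj_onI)
    fix c c' assume c: "c \<in> {..<q ^ N}" "c' \<in> {..<q ^ N}" and eq: "F c = F c'"
    have "?x c 1 - ?x c' 1 \<in> padic_null (p 1)"
      using eq by (intro affine_cancel[OF k xc xc _ one_in_R, of "fst (z c)" "snd (z c)"]) (auto simp: F_def)
    moreover have "?x c 1 - ?x c' 1 = (\<lambda>_. (of_nat (?j c') - of_nat (?j c)) * (1 / of_nat (k ^ N)))"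
      by (rule preimage_diff)
    ultimately have "(\<lambda>_. (of_nat (?j c') - of_nat (?j c)) * (1 / of_nat (k ^ N))) \<in> padic_null (p 1)"
      by (simp only:)
    then have "(of_nat (?j c') - of_nat (?j c)) * (1 / of_nat (k ^ N)) = (0::rat)"
      by (simp only: const_padic_null_iff)
    then have "?j c' = ?j c" using k by (simp del: of_nat_add of_nat_mult of_nat_prod)
    moreover have "?P > 0" using prime by (intro prod_pos) (auto simp: prime_gt_0_nat)
    ultimately show "c = c'" by auto
  qed
  moreover have "F ` {..<q ^ N} \<subseteq> K \<times> roots_b s p f"
    using z tuple_in_roots by (auto simp: F_def)
  ultimately have "card {..<q ^ N} \<le> N"
    unfolding N_def using card_inj_on_le finite_cartesian_product[OF K(1) finite_roots_b] by blast
  then have "q ^ N \<le> N" by simp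
  moreover have "N < q ^ N" using power_gt_expt[of q N] prime_gt_1_nat[OF q(1)] by simp
  ultimately show False by simp
qed

lemma prod_multiplicity:
  assumes k: "k \<ge> 1" and q: "\<And>q. prime q \<Longrightarrow> q dvd k \<Longrightarrow> q \<in> p ` R"
  shows "(\<Prod>r\<in>R. p r ^ multiplicity (p r) k) = k"
proof -
  have "k = (\<Prod>q\<in>prime_factors k. q ^ multiplicity q k)"
    using k by (intro prime_factorization_nat) simp
  also have "\<dots> = (\<Prod>q\<in>p ` R. q ^ multiplicity q k)"
  proof (rule prod.mono_neutral_left)
    show "prime_factors k \<subseteq> p ` R" using q by (auto simp: in_prime_factors_iff)
    show "\<forall>q\<in>p ` R - prime_factors k. q ^ multiplicity q k = 1"
    proof
      fix q assume "q \<in> p ` R - prime_factors k"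
      then have "\<not> q dvd k" using prime k by (auto simp: in_prime_factors_iff)
      then show "q ^ multiplicity q k = 1" by (simp add: not_dvd_imp_multiplicity_0)
    qed
  qed simp
  also have "\<dots> = (\<Prod>r\<in>R. p r ^ multiplicity (p r) k)"
    using prod.reindex[OF distinct] by simp
  finally show ?thesis ..
qed

text \<open>
  Only finitely many singularities are available, so infinitely many powers of \<open>k\<close> map the same
  point to \<open>x\<close>; two of these relations already make both points rational.
\<close>

lemma regular_singular_point:
  assumes reg: "k_regular k a" and k: "k \<ge> 2" and x: "\<And>r. r \<in> R \<Longrightarrow> x r \<in> int_seqs (p r)"
    and sg: "singular x"
  shows "\<exists>q \<rho>. (\<forall>r\<in>R. x r - (\<lambda>_. q) \<in> padic_null (p r)) \<and> (\<forall>r\<in>R. \<rho> \<in> rball (p r) 0) \<and>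
    infinite {i. \<exists>j<k ^ i. of_nat (k ^ i) * \<rho> + of_nat j = q}"
proof -
  have k1: "k \<ge> 1" using k by simp
  obtain K where K: "finite K" "K \<subseteq> {(i, j). j < k ^ i}"
    "\<And>i j. j < k ^ i \<Longrightarrow> kernel_seq k a (i, j) \<in> int_seq.span (kernel_seq k a ` K)"
    using k_regularD[OF reg k1] by blast
  let ?e = "\<lambda>r. multiplicity (p r) k"
  have prod: "(\<Prod>r\<in>R. p r ^ (i * ?e r)) = k ^ i" for i
  proof -
    have "(\<Prod>r\<in>R. p r ^ (i * ?e r)) = (\<Prod>r\<in>R. p r ^ ?e r) ^ i"
      by (simp only: prod_power_distrib power_mult[symmetric] mult.commute)
    then show ?thesis using prod_multiplicity[OF k1 k_regular_prime_factors[OF reg k1 x sg]] by simp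
  qed
  \<comment> \<open>All prime factors of k are among the p_r, so the modulus of the simultaneous
    approximation is exactly k^i and j is an admissible kernel index.\<close>
  have "\<exists>j<k ^ i. \<forall>r\<in>R. of_nat j - x r \<in> sball (p r) (int (i * ?e r))" for i
  proof -
    obtain j where "j < k ^ i" "\<forall>c. \<forall>r\<in>R. of_nat (j + c * k ^ i) - x r \<in> sball (p r) (int (i * ?e r))"
      using simultaneous_approx[of x "\<lambda>r. i * ?e r"] x unfolding prod by blast
    from this(2)[rule_format, of _ 0] this(1) show ?thesis by auto
  qed
  then obtain j where j: "\<And>i. j i < k ^ i"
      "\<And>i r. r \<in> R \<Longrightarrow> of_nat (j i) - x r \<in> sball (p r) (int (i * ?e r))" by metis
  define X where "X i = preimage k i (j i) x" for i
  have XI: "X i r \<in> int_seqs (p r)" if "r \<in> R" for i r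
    unfolding X_def by (rule preimage_int_seqs[where x = x, OF k1 that x[OF that] j(2)[OF that]])
  have Xx: "x r = of_nat (k ^ i) * X i r + of_nat (j i)" for i r
    using affine_preimage[OF k1, of i "j i" x] affine_eq[of k i "j i" "X i" r] by (simp only: X_def)
  have "\<exists>z\<in>K. singular (affine k (fst z) (snd z) (X i))" for i
  proof -
    have sgi: "singular (affine k i (j i) (X i))" using sg by (simp only: X_def affine_preimage[OF k1])
    have "\<exists>(i', j')\<in>K. singular (affine k i' j' (X i))"
      by (rule singular_transfer[OF k1 K(1) K(3)[OF j(1)] _ sgi]) (rule XI)
    then show ?thesis by (simp only: case_prod_unfold)
  qed
  then obtain z where z: "\<And>i. z i \<in> K" "\<And>i. singular (affine k (fst (z i)) (snd (z i)) (X i))" by metis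
  define F where "F i = (z i, tuple (affine k (fst (z i)) (snd (z i)) (X i)))" for i
  have "range F \<subseteq> K \<times> roots_b s p f"
    using z tuple_in_roots by (auto simp: F_def)
  then have "finite (range F)"
    by (rule finite_subset) (intro finite_cartesian_product K(1) finite_roots_b)
  then obtain i0 where i0: "infinite {i. F i = F i0}"
    using pigeonhole_infinite[of UNIV F] by auto
  have same: "X i r - X i0 r \<in> padic_null (p r)" if "F i = F i0" "r \<in> R" for i r
    using that(1) by (intro affine_cancel[OF k1 XI XI _ that(2), of "fst (z i)" "snd (z i)"]) (auto simp: F_def)
  obtain i1 where i1: "F i1 = F i0" "i1 \<noteq> i0"
    using infinite_imp_nonempty[OF infinite_remove[OF i0, of i0]] by auto
  define D where "D = of_nat (k ^ i1) - (of_nat (k ^ i0) :: rat)"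
  have "k ^ i1 \<noteq> k ^ i0" using i1(2) k by (simp add: power_inject_exp)
  then have D: "D \<noteq> 0" unfolding D_def by (simp del: of_nat_power)
  \<comment> \<open>The solution of k^i1 \<rho> + j_i1 = k^i0 \<rho> + j_i0.\<close>
  define \<rho> where "\<rho> = (of_nat (j i0) - of_nat (j i1)) / D"
  define q where "q = of_nat (k ^ i0) * \<rho> + of_nat (j i0)"
  have rho: "X i r - (\<lambda>_. \<rho>) \<in> padic_null (p r)" if "F i = F i0" and r: "r \<in> R" for i r
  proof -
    have pr: "Factorial_Ring.prime (p r)" by (rule prime[OF r])
    have "(X i1 r - X i0 r) * (\<lambda>_. - (of_nat (k ^ i1) / D)) \<in> padic_null (p r)"
      by (rule padic_null_mult[OF pr same[OF i1(1) r] padic_Cauchy_const])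
    moreover have "(X i1 r - X i0 r) * (\<lambda>_. - (of_nat (k ^ i1) / D)) = X i0 r - (\<lambda>_. \<rho>)"
    proof (rule ext)
      fix n
      have "of_nat (k ^ i1) * X i1 r n + of_nat (j i1) = of_nat (k ^ i0) * X i0 r n + of_nat (j i0)"
        using fun_cong[OF Xx[of r i1], of n] fun_cong[OF Xx[of r i0], of n] by (simp del: of_nat_power)
      then have "- of_nat (k ^ i1) * (X i1 r n - X i0 r n) = D * X i0 r n - (of_nat (j i0) - of_nat (j i1))"
        unfolding D_def by (simp add: algebra_simps del: of_nat_power)
      then have "- of_nat (k ^ i1) * (X i1 r n - X i0 r n) / D = X i0 r n - \<rho>"
        using D by (simp add: \<rho>_def diff_divide_distrib del: of_nat_power)
      then show "((X i1 r - X i0 r) * (\<lambda>_. - (of_nat (k ^ i1) / D))) n = (X i0 r - (\<lambda>_. \<rho>)) n"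
        by (simp add: mult.commute del: of_nat_power)
    qed
    ultimately have "X i0 r - (\<lambda>_. \<rho>) \<in> padic_null (p r)" by simp
    then show ?thesis using same[OF that] padic_null_diff_trans[OF pr] by blast
  qed
  have diff: "x r - (\<lambda>_. of_nat (k ^ i) * \<rho> + of_nat (j i)) \<in> padic_null (p r)"
    if "F i = F i0" and r: "r \<in> R" for i r
  proof -
    have "(X i r - (\<lambda>_. \<rho>)) * of_nat (k ^ i) \<in> padic_null (p r)"
      by (rule padic_null_mult[OF prime[OF r] rho[OF that] padic_Cauchy_of_nat])
    moreover have "(X i r - (\<lambda>_. \<rho>)) * of_nat (k ^ i) = x r - (\<lambda>_. of_nat (k ^ i) * \<rho> + of_nat (j i))"
      unfolding Xx[of r i] by (rule ext) (simp add: algebra_simps flip: of_nat_power)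
    ultimately show ?thesis by simp
  qed
  have "of_nat (k ^ i) * \<rho> + of_nat (j i) = q" if "F i = F i0" for i
  proof -
    have p1: "Factorial_Ring.prime (p 1)" by (rule prime[OF one_in_R])
    have "x 1 - (\<lambda>_. q) \<in> padic_null (p 1)" unfolding q_def by (rule diff[OF refl one_in_R])
    then have "(\<lambda>_. of_nat (k ^ i) * \<rho> + of_nat (j i)) - (\<lambda>_. q) \<in> padic_null (p 1)"
      using diff[OF that one_in_R] padic_null_diff_swap[OF p1] padic_null_diff_trans[OF p1] by blast
    moreover have "(\<lambda>_. of_nat (k ^ i) * \<rho> + of_nat (j i)) - (\<lambda>_. q)
        = (\<lambda>_::nat. of_nat (k ^ i) * \<rho> + of_nat (j i) - q)" by (rule ext) simp
    ultimately have "(\<lambda>_::nat. of_nat (k ^ i) * \<rho> + of_nat (j i) - q) \<in> padic_null (p 1)" by (simp only:)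
    then show ?thesis unfolding const_padic_null_iff by simp
  qed
  \<comment> \<open>Infinitely many exponents share the same \<rho>; the comparison of slopes needs
    arbitrarily large ones.\<close>
  then have "{i. F i = F i0} \<subseteq> {i. \<exists>j<k ^ i. of_nat (k ^ i) * \<rho> + of_nat j = q}" using j(1) by blast
  then have "infinite {i. \<exists>j<k ^ i. of_nat (k ^ i) * \<rho> + of_nat j = q}" using i0 infinite_super by blast
  moreover have "\<rho> \<in> rball (p r) 0" if r: "r \<in> R" for r
    using sball_diff_iff[OF prime[OF r] padic_nullD[OF rho[OF refl r], of 0]] int_seqs_D(2)[OF XI[OF r]]
    by simp
  moreover have "x r - (\<lambda>_. q) \<in> padic_null (p r)" if "r \<in> R" for r
    unfolding q_def by (rule diff[OF refl that])
  ultimately show ?thesis by blast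
qed

lemma tuple_surj:
  assumes "y \<in> roots_b s p f"
  obtains x where "\<And>r. r \<in> R \<Longrightarrow> x r \<in> int_seqs (p r)" "tuple x = y"
proof -
  have y: "y r \<in> Zp (p r)" if "r \<in> R" for r
    using assms that unfolding roots_b_def roots_Zp_def by (auto simp: PiE_iff)
  have "\<exists>X\<in>int_seqs (p r). y r = cls (p r) X" if "r \<in> R" for r
    using y[OF that] Zp_eq[OF prime[OF that]] by blast
  then obtain x where x: "\<And>r. r \<in> R \<Longrightarrow> x r \<in> int_seqs (p r)" "\<And>r. r \<in> R \<Longrightarrow> y r = cls (p r) (x r)" by metis
  have "y \<in> extensional R" using assms unfolding roots_b_def by (auto simp: PiE_iff)
  then have "tuple x = y" unfolding tuple_def
    by (intro extensionalityI[of _ R]) (auto simp: x(2))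
  then show ?thesis using that x(1) by blast
qed

lemma tuple_eq_diag_iff: "tuple x = diag s p q \<longleftrightarrow> (\<forall>r\<in>R. x r - (\<lambda>_. q) \<in> padic_null (p r))"
proof -
  have "diag s p q = tuple (\<lambda>_ _. q)" by (simp add: diag_def tuple_def of_rat_Qp_eq)
  then show ?thesis by (simp only: tuple_eq_iff)
qed

text \<open>
  If \<open>diag q\<close> and \<open>diag q'\<close> are distinct singular points, exchanging one of their at least two
  coordinates produces a singular point off the diagonal.
\<close>

lemma not_regular:
  assumes ne: "roots_b s p f \<noteq> {}"
    and nd: "\<not> (\<exists>\<theta>. diag s p \<theta> \<in> Zb s p \<and> roots_b s p f = {diag s p \<theta>})"
  shows "\<not> regular a"
proof
  assume "regular a"
  then obtain k where k: "k \<ge> 2" "k_regular k a" unfolding regular_def by blast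
  have dg: "\<exists>q. y = diag s p q" if y: "y \<in> roots_b s p f" for y
  proof -
    obtain x where x: "\<And>r. r \<in> R \<Longrightarrow> x r \<in> int_seqs (p r)" "tuple x = y" using tuple_surj[OF y] by blast
    have "singular x" using tuple_in_roots x(2) y by simp
    then show ?thesis
      using regular_singular_point[OF k(2,1) x(1)] tuple_eq_diag_iff x(2) by metis
  qed
  obtain y where y: "y \<in> roots_b s p f" using ne by blast
  obtain q where q: "y = diag s p q" using dg[OF y] by blast
  have "y \<in> Zb s p" using y unfolding roots_b_def Zb_def roots_Zp_def by (auto simp: PiE_iff)
  then obtain y' where y': "y' \<in> roots_b s p f" "y' \<noteq> y" using nd q y by blast
  obtain q' where q': "y' = diag s p q'" using dg[OF y'(1)] by blast
  define w where "w = (\<lambda>r\<in>R. if r = 1 then y' r else y r)"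
  have "w \<in> roots_b s p f" using y y'(1) unfolding roots_b_def w_def by (auto simp: PiE_iff)
  then obtain q'' where q'': "w = diag s p q''" using dg by blast
  have two: "2 \<in> R" using s by simp
  have "w 1 = y' 1" "w 2 = y 2" using one_in_R two by (auto simp: w_def)
  then have "of_rat_Qp (p 1) q'' = of_rat_Qp (p 1) q'" "of_rat_Qp (p 2) q'' = of_rat_Qp (p 2) q"
    using one_in_R two unfolding q'' q q' diag_def by auto
  then have "q'' = q'" "q'' = q"
    using of_rat_Qp_eq_iff[OF prime[OF one_in_R]] of_rat_Qp_eq_iff[OF prime[OF two]] by auto
  then show False using y'(2) q q' by simp
qed

end

section \<open>A single rational root\<close>

text \<open>The data that the kernel computations use: \<open>m r\<close> is the multiplicity,
  \<open>h r\<close> the valuation of the cofactor and \<open>H r\<close> its value near \<theta>. N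
  is a precision at which every \<open>h r\<close> is locally constant, M a common bound.\<close>

locale single_root = val_seq +
  fixes \<theta> :: rat and m :: "nat \<Rightarrow> nat" and h :: "nat \<Rightarrow> nat \<Rightarrow> int" and H :: "nat \<Rightarrow> int"
    and M N :: nat
  assumes theta: "\<And>r. r \<in> {1..s} \<Longrightarrow> \<theta> \<in> rball (p r) 0"
    and theta_root: "\<And>r. r \<in> {1..s} \<Longrightarrow> of_rat_Qp (p r) \<theta> \<in> roots_Zp (p r) (f r)"
    and m: "\<And>r. r \<in> {1..s} \<Longrightarrow> m r \<ge> 1"
    and nat_val_eq: "\<And>r n v. r \<in> {1..s} \<Longrightarrow> val_rat (p r) (of_nat n - \<theta>) = Fin v \<Longrightarrow>
      nat_val (p r) (f r) n = Fin (int (m r) * v + h r n)"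
    and h_bound: "\<And>r n. r \<in> {1..s} \<Longrightarrow> \<bar>h r n\<bar> \<le> int M"
    and h_cong: "\<And>r n n'. r \<in> {1..s} \<Longrightarrow> of_nat n - of_nat n' \<in> rball (p r) (int N) \<Longrightarrow> h r n = h r n'"
    and h_H: "\<And>r n. r \<in> {1..s} \<Longrightarrow> of_nat n - \<theta> \<in> rball (p r) (int N) \<Longrightarrow> h r n = H r"
    and H_bound: "\<And>r. r \<in> {1..s} \<Longrightarrow> \<bar>H r\<bar> \<le> int M"
begin

lemma le_a_iff:
  assumes "of_nat n \<noteq> \<theta>"
  shows "B \<le> a n \<longleftrightarrow> (\<forall>r\<in>R. B * int (l r) \<le> int (m r) * nu (p r) (of_nat n - \<theta>) + h r n)"
proof -
  have u: "u r n = Fin (int (m r) * nu (p r) (of_nat n - \<theta>) + h r n)" if "r \<in> R" for r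
    unfolding u_def using assms by (intro nat_val_eq that val_rat_nu) simp
  then have fin: "u 1 n \<noteq> \<infinity>" using one_in_R by simp
  show ?thesis unfolding a_ge_iff[OF one_in_R fin] using u by simp
qed

text \<open>The r-th term at q^i n + j before division by \<open>l r\<close>, for q^i x + j =
  \<theta> and q^i n + j so close to \<theta> that \<open>h r\<close> has reached its local
  value.\<close>

abbreviation kernel_term :: "nat \<Rightarrow> nat \<Rightarrow> rat \<Rightarrow> nat \<Rightarrow> nat \<Rightarrow> int" where
  "kernel_term q i x r n \<equiv> int (m r) * (int (i * multiplicity (p r) q) + nu (p r) (of_nat n - x)) + H r"

lemma le_a_affine_iff:
  assumes q: "q \<ge> 1" and x: "of_nat (q ^ i) * x + of_nat j = \<theta>" and n: "of_nat n \<noteq> x"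
    and close: "\<And>r. r \<in> R \<Longrightarrow> of_nat (q ^ i) * (of_nat n - x) \<in> rball (p r) (int N)"
  shows "B \<le> a (q ^ i * n + j) \<longleftrightarrow>
    (\<forall>r\<in>R. B * int (l r) \<le> kernel_term q i x r n)"
proof -
  have eq: "of_nat (q ^ i * n + j) - \<theta> = of_nat (q ^ i) * (of_nat n - x)"
    unfolding x[symmetric] by (simp add: algebra_simps)
  have nz: "of_nat (q ^ i) \<noteq> (0::rat)" "of_nat n - x \<noteq> 0" using q n by auto
  then have ne: "of_nat (q ^ i * n + j) \<noteq> \<theta>" using eq by (metis eq_iff_diff_eq_0 mult_eq_0_iff)
  show ?thesis unfolding le_a_iff[OF ne]
  proof (rule ball_cong[OF refl])
    fix r assume r: "r \<in> R"
    have "nu (p r) (of_nat (q ^ i * n + j) - \<theta>) = int (i * multiplicity (p r) q) + nu (p r) (of_nat n - x)"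
      unfolding eq using nu_mult[OF prime[OF r] nz] nu_of_nat_power[OF prime[OF r], of q i] q by simp
    moreover have "h r (q ^ i * n + j) = H r" using h_H[OF r] close[OF r] eq by simp
    ultimately show "B * int (l r) \<le> int (m r) * nu (p r) (of_nat (q ^ i * n + j) - \<theta>) + h r (q ^ i * n + j) \<longleftrightarrow>
      B * int (l r) \<le> kernel_term q i x r n"
      by simp
  qed
qed

text \<open>At r2 the distance to x is prescribed exactly, at the other primes only bounded. This
  freezes the r2-term and leaves the other terms free to grow.\<close>

definition slab :: "nat \<Rightarrow> rat \<Rightarrow> nat \<Rightarrow> nat \<Rightarrow> nat set" where
  "slab r2 x \<sigma> T = {n. val_rat (p r2) (of_nat n - x) = Fin (int T) \<and>
     (\<forall>r\<in>R - {r2}. of_nat n - x \<in> rball (p r) (int \<sigma>))}"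

lemma slab_rball:
  assumes "n \<in> slab r2 x \<sigma> T" "t \<le> T" "t \<le> \<sigma>" "r \<in> R"
  shows "of_nat n - x \<in> rball (p r) (int t)"
proof (cases "r = r2")
  case True
  then have "of_nat n - x \<in> rball (p r) (int T)" using assms(1) by (simp add: slab_def val_rat_eq_Fin_iff)
  then show ?thesis by (rule rball_mono) (use assms in simp)
next
  case False
  then have "of_nat n - x \<in> rball (p r) (int \<sigma>)" using assms by (simp add: slab_def)
  then show ?thesis by (rule rball_mono) (use assms in simp)
qed

lemma scaled_rball:
  assumes "y \<in> rball (p r) (int t)" "r \<in> R" shows "of_nat c * y \<in> rball (p r) (int t)"
  using rball_mult[OF prime[OF assms(2)] rball_of_nat[OF prime[OF assms(2)]] assms(1)] by simp

text \<open>With y = q^i x + j - \<theta> nonzero, q^i n + j - \<theta> differs from y by something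
  smaller at every prime once n is close to x. All valuations are then those of y, and the
  \<open>h r\<close> agree by local constancy.\<close>

lemma constant_near_nonroot:
  assumes q: "q \<ge> 1" and x: "of_nat (q ^ i) * x + of_nat j \<noteq> \<theta>"
  shows "\<forall>\<^sub>F t in sequentially. \<forall>n n'.
    (\<forall>r\<in>R. of_nat n - x \<in> rball (p r) (int t)) \<longrightarrow> (\<forall>r\<in>R. of_nat n' - x \<in> rball (p r) (int t)) \<longrightarrow>
    a (q ^ i * n + j) = a (q ^ i * n' + j)"
proof -
  define y where "y = of_nat (q ^ i) * x + of_nat j - \<theta>"
  have y: "y \<noteq> 0" using x by (simp add: y_def)
  define t0 where "t0 = N + (\<Sum>r\<in>R. nat (nu (p r) y + 1))"
  have t0: "nu (p r) y + 1 \<le> int t0" if "r \<in> R" for r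
  proof -
    have "nat (nu (p r) y + 1) \<le> (\<Sum>r\<in>R. nat (nu (p r) y + 1))"
      using that by (intro member_le_sum) auto
    then show ?thesis unfolding t0_def by linarith
  qed
  have "a (q ^ i * n + j) = a (q ^ i * n' + j)"
    if t: "t \<ge> t0" and n: "\<forall>r\<in>R. of_nat n - x \<in> rball (p r) (int t)"
      and n': "\<forall>r\<in>R. of_nat n' - x \<in> rball (p r) (int t)" for t n n'
  proof -
    have main: "of_nat (q ^ i * n + j) \<noteq> \<theta> \<and> (\<forall>r\<in>R. nu (p r) (of_nat (q ^ i * n + j) - \<theta>) = nu (p r) y)"
      if n: "\<forall>r\<in>R. of_nat n - x \<in> rball (p r) (int t)" for n
    proof -
      have eq: "of_nat (q ^ i * n + j) - \<theta> = y + of_nat (q ^ i) * (of_nat n - x)"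
        by (simp add: y_def algebra_simps)
      have "of_nat (q ^ i) * (of_nat n - x) \<in> rball (p r) (nu (p r) y + 1)" if r: "r \<in> R" for r
        by (rule rball_mono[OF scaled_rball[OF n[rule_format, OF r] r]]) (use t0[OF r] t in linarith)
      then show ?thesis
        using nu_add_eq[OF prime y, of _ "of_nat (q ^ i) * (of_nat n - x)"] one_in_R
        unfolding eq[symmetric] by fastforce
    qed
    have hh: "h r (q ^ i * n + j) = h r (q ^ i * n' + j)" if r: "r \<in> R" for r
    proof (rule h_cong[OF r])
      have "(of_nat n - x) - (of_nat n' - x) \<in> rball (p r) (int t)"
        using n n' r rball_diff[OF prime[OF r]] by blast
      then have "of_nat (q ^ i) * ((of_nat n - x) - (of_nat n' - x)) \<in> rball (p r) (int t)"
        by (rule scaled_rball[OF _ r])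
      moreover have "of_nat (q ^ i) * ((of_nat n - x) - (of_nat n' - x)) =
          of_nat (q ^ i * n + j) - (of_nat (q ^ i * n' + j) :: rat)"
        by (simp add: algebra_simps)
      ultimately have "of_nat (q ^ i * n + j) - (of_nat (q ^ i * n' + j) :: rat) \<in> rball (p r) (int t)"
        by (simp only:)
      then show "of_nat (q ^ i * n + j) - of_nat (q ^ i * n' + j) \<in> rball (p r) (int N)"
        by (rule rball_mono) (use t in \<open>simp add: t0_def\<close>)
    qed
    show ?thesis
    proof (rule int_eq_if_same_lower_bounds)
      fix B show "B \<le> a (q ^ i * n + j) \<longleftrightarrow> B \<le> a (q ^ i * n' + j)"
        unfolding le_a_iff[OF conjunct1[OF main[OF n]]] le_a_iff[OF conjunct1[OF main[OF n']]]
        using main[OF n] main[OF n'] hh by simp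
    qed
  qed
  then show ?thesis unfolding eventually_sequentially by blast
qed

text \<open>The r2-term has a fixed value on the slab, and for large \<sigma> all other terms exceed
  it after division by \<open>l r\<close>, so the r2-term alone determines the minimum. The required
  \<sigma> depends on i and T.\<close>

lemma constant_on_slab:
  assumes q: "q \<ge> 1" and x: "of_nat (q ^ i) * x + of_nat j = \<theta>" and T: "T \<ge> N" and r2: "r2 \<in> R"
  shows "\<forall>\<^sub>F \<sigma> in sequentially. \<forall>n\<in>slab r2 x \<sigma> T. \<forall>n'\<in>slab r2 x \<sigma> T.
    a (q ^ i * n + j) = a (q ^ i * n' + j)"
proof -
  define c where "c = int (m r2) * (int (i * multiplicity (p r2) q) + int T) + H r2"
  define b0 where "b0 = c div int (l r2)"
  \<comment> \<open>N puts the indices where \<open>h r\<close> equals \<open>H r\<close>, M absorbs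
    \<open>H r\<close>, and the sum dominates b0 * \<open>l r\<close> for each r.\<close>
  define \<sigma>0 where "\<sigma>0 = N + M + (\<Sum>r\<in>R. nat \<bar>b0\<bar> * l r)"
  have "a (q ^ i * n + j) = b0" if s: "\<sigma> \<ge> \<sigma>0" and n: "n \<in> slab r2 x \<sigma> T" for \<sigma> n
  proof (rule int_eq_if_same_lower_bounds)
    fix B
    have v: "val_rat (p r2) (of_nat n - x) = Fin (int T)" using n by (simp add: slab_def)
    then have nx: "of_nat n \<noteq> x" by auto
    have close: "of_nat (q ^ i) * (of_nat n - x) \<in> rball (p r) (int N)" if "r \<in> R" for r
      using slab_rball[OF n T _ that] s by (intro scaled_rball that) (simp add: \<sigma>0_def)
    have term2: "B * int (l r2) \<le> kernel_term q i x r2 n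
        \<longleftrightarrow> B \<le> b0" for B
      using floor_div_ge_iff[OF l[OF r2], of "Fin c" B] nu_eqI[OF v]
      by (simp add: floor_div_def b0_def c_def)
    have other: "b0 * int (l r) \<le> kernel_term q i x r n"
      if r: "r \<in> R" "r \<noteq> r2" for r
    proof -
      have "of_nat n - x \<in> rball (p r) (int \<sigma>)" using n r by (simp add: slab_def)
      then have nu: "int \<sigma> \<le> nu (p r) (of_nat n - x)" using nx by (simp add: rball_nu_iff)
      have "nat \<bar>b0\<bar> * l r \<le> (\<Sum>r\<in>R. nat \<bar>b0\<bar> * l r)" using r(1) by (intro member_le_sum) auto
      then have "int (nat \<bar>b0\<bar> * l r) + int M \<le> int \<sigma>" using s unfolding \<sigma>0_def by linarith
      moreover have "b0 * int (l r) \<le> int (nat \<bar>b0\<bar> * l r)" by (simp add: mult_right_mono)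
      moreover have "int \<sigma> \<le> int (m r) * (int (i * multiplicity (p r) q) + nu (p r) (of_nat n - x))"
      proof -
        have "0 + int \<sigma> \<le> int (i * multiplicity (p r) q) + nu (p r) (of_nat n - x)"
          by (rule add_mono[OF of_nat_0_le_iff nu])
        then have "1 * (0 + int \<sigma>) \<le> int (m r) * (int (i * multiplicity (p r) q) + nu (p r) (of_nat n - x))"
          using m[OF r(1)] by (intro mult_mono) auto
        then show ?thesis by simp
      qed
      ultimately show ?thesis using H_bound[OF r(1)] by linarith
    qed
    have iff: "B \<le> a (q ^ i * n + j) \<longleftrightarrow>
      (\<forall>r\<in>R. B * int (l r) \<le> kernel_term q i x r n)"
      by (rule le_a_affine_iff[OF q x nx]) (rule close)
    show "B \<le> a (q ^ i * n + j) \<longleftrightarrow> B \<le> b0"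
    proof
      assume "B \<le> a (q ^ i * n + j)"
      then have "B * int (l r2) \<le> kernel_term q i x r2 n"
        unfolding iff using r2 by (rule bspec)
      then show "B \<le> b0" unfolding term2 .
    next
      assume B: "B \<le> b0"
      show "B \<le> a (q ^ i * n + j)" unfolding iff
      proof
        fix r assume r: "r \<in> R"
        show "B * int (l r) \<le> kernel_term q i x r n"
        proof (cases "r = r2")
          case True
          then show ?thesis using term2 B by simp
        next
          case False
          have "B * int (l r) \<le> b0 * int (l r)" using B by (intro mult_right_mono) auto
          then show ?thesis using other[OF r False] by linarith
        qed
      qed
    qed
  qed
  then show ?thesis unfolding eventually_sequentially by (metis (no_types, lifting))
qed

lemma theta_singular: "singular (\<lambda>_ _. \<theta>)"
  using theta_root by (simp add: singular_def of_rat_Qp_eq)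

lemma theta_int_seqs: "r \<in> R \<Longrightarrow> (\<lambda>_. \<theta>) \<in> int_seqs (p r)"
  using theta by (simp add: const_int_seqs)

lemma regular_base_preimage:
  assumes reg: "k_regular q a" and q: "q \<ge> 2"
  obtains \<rho> where "\<And>r. r \<in> R \<Longrightarrow> \<rho> \<in> rball (p r) 0"
    "infinite {i. \<exists>j<q ^ i. of_nat (q ^ i) * \<rho> + of_nat j = \<theta>}"
proof -
  obtain q0 \<rho> where *: "\<forall>r\<in>R. (\<lambda>_. \<theta>) - (\<lambda>_. q0) \<in> padic_null (p r)" "\<forall>r\<in>R. \<rho> \<in> rball (p r) 0"
    "infinite {i. \<exists>j<q ^ i. of_nat (q ^ i) * \<rho> + of_nat j = q0}"
    using regular_singular_point[OF reg q theta_int_seqs theta_singular] by blast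
  have "(\<lambda>_. \<theta>) - (\<lambda>_. q0) = (\<lambda>_::nat. \<theta> - q0)" by (rule ext) simp
  then have "\<theta> = q0" using bspec[OF *(1) one_in_R] by (simp add: const_padic_null_iff)
  then show ?thesis using that *(2,3) by blast
qed

text \<open>Approximating \<rho> gives only a lower bound on the valuation of n - \<rho>; aiming at
  \<rho> + p^t with one more digit pins it down.\<close>

lemma exact_val:
  assumes r: "r \<in> R" and n: "of_nat n - (\<rho> + of_nat (p r) ^ t) \<in> rball (p r) (int (t + 1))"
  shows "val_rat (p r) (of_nat n - \<rho>) = Fin (int t)"
proof -
  let ?z = "of_nat (p r) ^ t :: rat"
  have z: "val_rat (p r) ?z = Fin (int t)" using rball_prime_powi[OF prime[OF r], of "int t"] by simp
  have "?z \<noteq> 0" using prime_gt_0_nat[OF prime[OF r]] by simp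
  moreover have "of_nat n - (\<rho> + ?z) \<in> rball (p r) (nu (p r) ?z + 1)" using n nu_eqI[OF z] by (simp add: add.commute)
  ultimately have "?z + (of_nat n - (\<rho> + ?z)) \<noteq> 0 \<and> nu (p r) (?z + (of_nat n - (\<rho> + ?z))) = nu (p r) ?z"
    using nu_add_eq[OF prime[OF r]] by blast
  moreover have "?z + (of_nat n - (\<rho> + ?z)) = of_nat n - \<rho>" by simp
  ultimately show ?thesis using val_rat_nu[of "of_nat n - \<rho>" "p r"] nu_eqI[OF z] by simp
qed

text \<open>
  Near \<open>\<rho>\<close> and with \<open>T\<close> fixed, the term at \<open>r2\<close> eventually caps the minimum, so all kernel sequences
  are constant on a common slab. If the slope at \<open>r1\<close> were smaller, the term at \<open>r1\<close> would still be
  active on that slab for large \<open>i\<close>.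
\<close>

lemma regular_slopes_not_less:
  assumes reg: "k_regular q a" and q: "q \<ge> 2" and r1: "r1 \<in> R" and r2: "r2 \<in> R"
  shows "\<not> m r1 * multiplicity (p r1) q * l r2 < m r2 * multiplicity (p r2) q * l r1"
proof
  let ?e = "\<lambda>r. multiplicity (p r) q"
  assume less: "m r1 * ?e r1 * l r2 < m r2 * ?e r2 * l r1"
  have q1: "q \<ge> 1" using q by simp
  have r12: "r1 \<noteq> r2" using less by auto
  obtain \<rho> where rho: "\<And>r. r \<in> R \<Longrightarrow> \<rho> \<in> rball (p r) 0"
    "infinite {i. \<exists>j<q ^ i. of_nat (q ^ i) * \<rho> + of_nat j = \<theta>}"
    using regular_base_preimage[OF reg q] by blast
  obtain K where K: "finite K" "K \<subseteq> {(i, j). j < q ^ i}"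
    "\<And>i j. j < q ^ i \<Longrightarrow> kernel_seq q a (i, j) \<in> int_seq.span (kernel_seq q a ` K)"
    using k_regularD[OF reg q1] by blast
  let ?y = "\<lambda>z. of_nat (q ^ fst z) * \<rho> + of_nat (snd z)"
  define co where "co z U \<longleftrightarrow> (\<forall>n\<in>U. \<forall>n'\<in>U. a (q ^ fst z * n + snd z) = a (q ^ fst z * n' + snd z))"
    for z :: "nat \<times> nat" and U
  have co_mono: "co z V \<Longrightarrow> U \<subseteq> V \<Longrightarrow> co z U" for z U V unfolding co_def by blast
  define nb where "nb t = {n. \<forall>r\<in>R. of_nat n - \<rho> \<in> rball (p r) (int t)}" for t
  have nbco: "\<forall>\<^sub>F t in sequentially. ?y z \<noteq> \<theta> \<longrightarrow> co z (nb t)" for z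
  proof (cases "?y z = \<theta>")
    case False
    show ?thesis using constant_near_nonroot[OF q1 False]
      by (rule eventually_mono) (unfold co_def nb_def, blast)
  qed simp
  \<comment> \<open>The order of choices is T, \<sigma>, i: T serves the generators regular at
    \<rho>, \<sigma> depends on T and serves those singular there, and i may depend on both because
    the generators are fixed.\<close>
  have "\<forall>\<^sub>F t in sequentially. t \<ge> N \<and> (\<forall>z\<in>K. ?y z \<noteq> \<theta> \<longrightarrow> co z (nb t))"
    by (intro eventually_conj eventually_ge_at_top eventually_ball_finite[OF K(1)] ballI nbco)
  then obtain T where T: "T \<ge> N" "\<And>z. z \<in> K \<Longrightarrow> ?y z \<noteq> \<theta> \<Longrightarrow> co z (nb T)"
    unfolding eventually_sequentially by blast
  have slab_nb: "slab r2 \<rho> \<sigma> T \<subseteq> nb T" if "\<sigma> \<ge> T" for \<sigma>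
    unfolding nb_def using slab_rball[OF _ order_refl that] by blast
  have slabco: "\<forall>\<^sub>F \<sigma> in sequentially. co z (slab r2 \<rho> \<sigma> T)" if z: "z \<in> K" for z
  proof (cases "?y z = \<theta>")
    case True
    show ?thesis unfolding co_def by (rule constant_on_slab[OF q1 True T(1) r2])
  next
    case False
    have "co z (slab r2 \<rho> \<sigma> T)" if "\<sigma> \<ge> T" for \<sigma>
      by (rule co_mono[OF T(2)[OF z False] slab_nb[OF that]])
    then show ?thesis unfolding eventually_sequentially by blast
  qed
  have "\<forall>\<^sub>F \<sigma> in sequentially. \<sigma> \<ge> T \<and> (\<forall>z\<in>K. co z (slab r2 \<rho> \<sigma> T))"
    by (intro eventually_conj eventually_ge_at_top eventually_ball_finite[OF K(1)] ballI slabco)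
  then obtain \<sigma> where sig: "\<sigma> \<ge> T" "\<And>z. z \<in> K \<Longrightarrow> co z (slab r2 \<rho> \<sigma> T)"
    unfolding eventually_sequentially by blast
  define S where "S = {g :: nat \<Rightarrow> int. \<forall>n\<in>slab r2 \<rho> \<sigma> T. \<forall>n'\<in>slab r2 \<rho> \<sigma> T. g n = g n'}"
  have sub: "int_seq.subspace S"
  proof (rule int_seq.subspaceI)
    fix c g assume "g \<in> S"
    then have "c * g n = c * g n'" if "n \<in> slab r2 \<rho> \<sigma> T" "n' \<in> slab r2 \<rho> \<sigma> T" for n n'
      using that unfolding S_def by (intro arg_cong[where f = "\<lambda>x. c * x"]) blast
    then show "(\<lambda>n. c * g n) \<in> S" unfolding S_def by blast
  next
    fix g h assume "g \<in> S" "h \<in> S"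
    then have "(g + h) n = (g + h) n'" if "n \<in> slab r2 \<rho> \<sigma> T" "n' \<in> slab r2 \<rho> \<sigma> T" for n n'
      using that unfolding S_def plus_fun_apply by (intro arg_cong2[where f = "(+)"]) blast+
    then show "g + h \<in> S" unfolding S_def by blast
  qed (simp add: S_def)
  have "kernel_seq q a ` K \<subseteq> S"
  proof
    fix g assume "g \<in> kernel_seq q a ` K"
    then obtain z where z: "z \<in> K" "g = kernel_seq q a z" by blast
    then have "g = (\<lambda>n. a (q ^ fst z * n + snd z))" by (simp add: kernel_seq_def case_prod_unfold)
    then show "g \<in> S" using sig(2)[OF z(1)] unfolding S_def co_def by blast
  qed
  then have KS: "int_seq.span (kernel_seq q a ` K) \<subseteq> S" by (rule int_seq.span_minimal[OF _ sub])
  \<comment> \<open>c1 and c2 are the parts independent of i when the r2-term, lowered by the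
    rounding loss \<open>l r2\<close>, and the r1-term at depth \<sigma> are cross-multiplied. The
    gap between the slopes is at least 1 per unit of i, so i > |c2 - c1| decides the
    comparison.\<close>
  define c1 where "c1 = int (l r1) * (int (m r2) * int T + H r2 - int (l r2))"
  define c2 where "c2 = int (l r2) * (int (m r1) * int \<sigma> + H r1)"
  obtain i j where i: "nat \<bar>c2 - c1\<bar> < i" and j: "j < q ^ i" "of_nat (q ^ i) * \<rho> + of_nat j = \<theta>"
    using rho(2) unfolding infinite_nat_iff_unbounded by blast
  have g: "kernel_seq q a (i, j) \<in> S" using K(3)[OF j(1)] KS by blast
  define c where "c = int (m r2) * (int (i * ?e r2) + int T) + H r2"
  \<comment> \<open>The value at which the r2-term caps the minimum on the slab; n' will attain it,
    while at n the r1-term is smaller.\<close>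
  define B where "B = c div int (l r2)"
  have l2: "int (l r2) > 0" "int (l r1) > 0" using l[OF r1] l[OF r2] by auto
  have B2: "B * int (l r2) \<le> c" "c - int (l r2) < B * int (l r2)"
  proof -
    have "B * int (l r2) = c - c mod int (l r2)" unfolding B_def by (simp add: minus_mod_eq_div_mult)
    moreover have "0 \<le> c mod int (l r2)" "c mod int (l r2) < int (l r2)" using l2 by auto
    ultimately show "B * int (l r2) \<le> c" "c - int (l r2) < B * int (l r2)" by linarith+
  qed
  have B1: "\<not> B * int (l r1) \<le> int (m r1) * (int (i * ?e r1) + int \<sigma>) + H r1"
  proof
    assume A: "B * int (l r1) \<le> int (m r1) * (int (i * ?e r1) + int \<sigma>) + H r1"
    define X where "X = int (m r2 * ?e r2 * l r1)"
    define Y where "Y = int (m r1 * ?e r1 * l r2)"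
    have "Y + 1 \<le> X" using less unfolding X_def Y_def by linarith
    then have "(Y + 1) * int i \<le> X * int i" by (rule mult_right_mono) simp
    moreover have "int (l r1) * (c - int (l r2)) = X * int i + c1"
      unfolding c_def X_def c1_def by (simp add: algebra_simps)
    moreover have "int (l r2) * (int (m r1) * (int (i * ?e r1) + int \<sigma>) + H r1) = Y * int i + c2"
      unfolding Y_def c2_def by (simp add: algebra_simps)
    moreover have "int (l r2) * (B * int (l r1)) \<le> int (l r2) * (int (m r1) * (int (i * ?e r1) + int \<sigma>) + H r1)"
      by (rule mult_left_mono[OF A]) simp
    moreover have "int (l r1) * (c - int (l r2)) < int (l r1) * (B * int (l r2))"
      by (rule mult_strict_left_mono[OF B2(2) l2(2)])
    moreover have "int (l r1) * (B * int (l r2)) = int (l r2) * (B * int (l r1))" by simp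
    moreover have "(Y + 1) * int i = Y * int i + int i" by (simp add: algebra_simps)
    ultimately have "int i < c2 - c1" by linarith
    then show False using i by linarith
  qed
  \<comment> \<open>Depth at which every term other than the one at r2 reaches B: the sum dominates
    B * \<open>l r\<close>, M absorbs \<open>H r\<close>, and \<sigma> keeps the index in the
    slab.\<close>
  define S0 where "S0 = \<sigma> + M + (\<Sum>r\<in>R. nat \<bar>B\<bar> * l r)"
  have pow: "of_nat (p r) ^ t \<in> rball (p r) 0" if "r \<in> R" for r t
    using rball_of_nat[OF prime[OF that], of "p r ^ t"] by simp
  have mem: "n \<in> slab r2 \<rho> \<sigma> T"
    if "of_nat n - (\<rho> + of_nat (p r2) ^ T) \<in> rball (p r2) (int (T + 1))"
      "\<And>r. r \<in> R \<Longrightarrow> r \<noteq> r2 \<Longrightarrow> of_nat n - \<rho> \<in> rball (p r) (int \<sigma>)" for n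
    unfolding slab_def using that exact_val[OF r2] by blast
  have close: "of_nat (q ^ i) * (of_nat n - \<rho>) \<in> rball (p r) (int N)" if "n \<in> slab r2 \<rho> \<sigma> T" "r \<in> R" for n r
    by (rule scaled_rball[OF slab_rball[OF that(1) _ _ that(2)] that(2)]) (use T(1) sig(1) in auto)
  have ne: "of_nat n \<noteq> \<rho>" if "n \<in> slab r2 \<rho> \<sigma> T" for n using that by (auto simp: slab_def)
  have iff: "B \<le> a (q ^ i * n + j) \<longleftrightarrow>
      (\<forall>r\<in>R. B * int (l r) \<le> kernel_term q i \<rho> r n)"
    if "n \<in> slab r2 \<rho> \<sigma> T" for n
    by (rule le_a_affine_iff[OF q1 j(2) ne[OF that]]) (rule close[OF that])
  \<comment> \<open>At r1 the index n has exactly depth \<sigma>, the least that the slab allows,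
    which makes the r1-term as small as possible; n' is deep at every prime other than r2.\<close>
  obtain n :: nat where n: "\<And>r. r \<in> R \<Longrightarrow>
      of_nat n - (if r = r1 then \<rho> + of_nat (p r) ^ \<sigma> else if r = r2 then \<rho> + of_nat (p r) ^ T else \<rho>)
      \<in> rball (p r) (int (if r = r1 then \<sigma> + 1 else if r = r2 then T + 1 else \<sigma>))"
    by (rule simultaneous_approx_rat[where y = "\<lambda>r. if r = r1 then \<rho> + of_nat (p r) ^ \<sigma> else if r = r2 then \<rho> + of_nat (p r) ^ T else \<rho>"
        and t = "\<lambda>r. if r = r1 then \<sigma> + 1 else if r = r2 then T + 1 else \<sigma>"])
      (use rho(1) pow rball_add[OF prime] in auto)
  have n1: "val_rat (p r1) (of_nat n - \<rho>) = Fin (int \<sigma>)"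
    using n[OF r1] by (intro exact_val r1) simp
  have nslab: "n \<in> slab r2 \<rho> \<sigma> T"
  proof (rule mem)
    show "of_nat n - (\<rho> + of_nat (p r2) ^ T) \<in> rball (p r2) (int (T + 1))" using n[OF r2] r12 by simp
    fix r assume r: "r \<in> R" "r \<noteq> r2"
    show "of_nat n - \<rho> \<in> rball (p r) (int \<sigma>)"
    proof (cases "r = r1")
      case True
      then show ?thesis using n1 by (simp add: val_rat_eq_Fin_iff)
    next
      case False
      then show ?thesis using n[OF r(1)] r by simp
    qed
  qed
  obtain n' :: nat where n': "\<And>r. r \<in> R \<Longrightarrow> of_nat n' - (if r = r2 then \<rho> + of_nat (p r) ^ T else \<rho>)
      \<in> rball (p r) (int (if r = r2 then T + 1 else S0))"
    by (rule simultaneous_approx_rat[where y = "\<lambda>r. if r = r2 then \<rho> + of_nat (p r) ^ T else \<rho>"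
        and t = "\<lambda>r. if r = r2 then T + 1 else S0"])
      (use rho(1) pow rball_add[OF prime] in auto)
  have n'2: "val_rat (p r2) (of_nat n' - \<rho>) = Fin (int T)"
    using n'[OF r2] by (intro exact_val r2) simp
  have n'S: "of_nat n' - \<rho> \<in> rball (p r) (int S0)" if "r \<in> R" "r \<noteq> r2" for r
    using n'[OF that(1)] that(2) by simp
  have n'slab: "n' \<in> slab r2 \<rho> \<sigma> T"
  proof (rule mem)
    show "of_nat n' - (\<rho> + of_nat (p r2) ^ T) \<in> rball (p r2) (int (T + 1))" using n'[OF r2] by simp
    fix r assume r: "r \<in> R" "r \<noteq> r2"
    show "of_nat n' - \<rho> \<in> rball (p r) (int \<sigma>)"
      by (rule rball_mono[OF n'S[OF r]]) (use le_add1 in \<open>simp only: S0_def of_nat_le_iff add.assoc\<close>)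
  qed
  have "\<not> B \<le> a (q ^ i * n + j)"
    unfolding iff[OF nslab] using B1 nu_eqI[OF n1] by (intro notI) (drule bspec[OF _ r1], simp)
  moreover have "B \<le> a (q ^ i * n' + j)"
    unfolding iff[OF n'slab]
  proof
    fix r assume r: "r \<in> R"
    show "B * int (l r) \<le> kernel_term q i \<rho> r n'"
    proof (cases "r = r2")
      case True
      then show ?thesis using B2(1) nu_eqI[OF n'2] by (simp add: c_def)
    next
      case False
      have nu: "int S0 \<le> nu (p r) (of_nat n' - \<rho>)"
        using n'S[OF r False] ne[OF n'slab] by (simp add: rball_nu_iff)
      have "nat \<bar>B\<bar> * l r \<le> (\<Sum>r\<in>R. nat \<bar>B\<bar> * l r)" using r by (intro member_le_sum) auto
      then have "int (nat \<bar>B\<bar> * l r) + int M \<le> int S0" unfolding S0_def by linarith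
      moreover have "B * int (l r) \<le> int (nat \<bar>B\<bar> * l r)" by (simp add: mult_right_mono)
      moreover have "int S0 \<le> int (m r) * (int (i * ?e r) + nu (p r) (of_nat n' - \<rho>))"
      proof -
        have "0 + int S0 \<le> int (i * ?e r) + nu (p r) (of_nat n' - \<rho>)"
          by (rule add_mono[OF of_nat_0_le_iff nu])
        then have "1 * (0 + int S0) \<le> int (m r) * (int (i * ?e r) + nu (p r) (of_nat n' - \<rho>))"
          using m[OF r] by (intro mult_mono) auto
        then show ?thesis by simp
      qed
      ultimately show ?thesis using H_bound[OF r] by linarith
    qed
  qed
  moreover have "a (q ^ i * n + j) = a (q ^ i * n' + j)"
    using g nslab n'slab unfolding S_def kernel_seq_def prod.case by blast
  ultimately show False by simp
qed

text \<open>Applying the slope inequality to both orders of two primes gives equal slopes. The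
  exponents of q and those of the stated base are then both proportional to \<open>l r\<close> /
  \<open>m r\<close>.\<close>

lemma regular_base_dependent:
  assumes reg: "k_regular q a" and q: "q \<ge> 2"
    and w: "\<And>r. r \<in> R \<Longrightarrow> w r \<ge> 1" "\<And>r r'. r \<in> R \<Longrightarrow> r' \<in> R \<Longrightarrow> w r * m r = w r' * m r'"
  shows "\<not> mult_indep (\<Prod>r\<in>R. (p r ^ l r) ^ w r) q"
proof -
  let ?e = "\<lambda>r. multiplicity (p r) q"
  have q1: "q \<ge> 1" using q by simp
  have slopes: "m r * ?e r * l r' = m r' * ?e r' * l r" if "r \<in> R" "r' \<in> R" for r r'
    using regular_slopes_not_less[OF reg q that] regular_slopes_not_less[OF reg q that(2,1)] by linarith
  note pf = k_regular_prime_factors[OF reg q1 theta_int_seqs theta_singular]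
  obtain q' where q': "Factorial_Ring.prime q'" "q' dvd q" using q prime_factor_nat[of q] by auto
  then obtain r0 where r0: "r0 \<in> R" "p r0 dvd q" using pf by blast
  then have e0: "?e r0 \<ge> 1"
    using prime[OF r0(1)] q by (simp add: Suc_le_eq prime_multiplicity_gt_zero_iff)
  \<comment> \<open>A and C clear the denominators in this proportionality; A is positive because
    p_r0 divides q.\<close>
  define A where "A = m r0 * ?e r0"
  define C where "C = w r0 * m r0 * l r0"
  have ex: "l r * w r * A = ?e r * C" if r: "r \<in> R" for r
  proof -
    have "l r * w r * A = w r * (m r0 * ?e r0 * l r)" by (simp add: A_def)
    also have "\<dots> = w r * (m r * ?e r * l r0)" using slopes[OF r0(1) r] by simp
    also have "\<dots> = (w r * m r) * (?e r * l r0)" by simp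
    also have "\<dots> = (w r0 * m r0) * (?e r * l r0)" using w(2)[OF r r0(1)] by simp
    finally show ?thesis by (simp add: C_def)
  qed
  have "(\<Prod>r\<in>R. (p r ^ l r) ^ w r) ^ A = (\<Prod>r\<in>R. p r ^ (l r * w r * A))"
    by (simp only: prod_power_distrib power_mult)
  also have "\<dots> = (\<Prod>r\<in>R. p r ^ (?e r * C))" using ex by (intro prod.cong) simp_all
  also have "\<dots> = (\<Prod>r\<in>R. p r ^ ?e r) ^ C" by (simp only: prod_power_distrib power_mult)
  also have "(\<Prod>r\<in>R. p r ^ ?e r) = q" by (rule prod_multiplicity[OF q1 pf])
  finally have "(\<Prod>r\<in>R. (p r ^ l r) ^ w r) ^ A = q ^ C" .
  moreover have "A \<ge> 1" "C \<ge> 1"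
    using e0 m[OF r0(1)] l[OF r0(1)] w(1)[OF r0(1)] by (auto simp: A_def C_def Suc_le_eq)
  ultimately show ?thesis unfolding mult_indep_def by blast
qed

section \<open>Regularity to the stated base\<close>

context
  fixes w :: "nat \<Rightarrow> nat" and W :: nat and E :: "nat \<Rightarrow> nat" and k :: nat
  assumes w: "\<And>r. r \<in> {1..s} \<Longrightarrow> w r \<ge> 1"
    and W: "\<And>r. r \<in> {1..s} \<Longrightarrow> w r * m r = W"
    and E: "\<And>r. E r = l r * w r"
    and k: "k = (\<Prod>r\<in>{1..s}. (p r ^ l r) ^ w r)"
begin

lemma k_ge_1: "k \<ge> 1"
  unfolding k using prime by (auto simp: Suc_le_eq intro!: prod_pos prime_gt_0_nat)

text \<open>Multiplying n - \<theta> by k raises the r-th numerator by \<open>m r\<close> *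
  \<open>E r\<close>. Being W times \<open>l r\<close>, this increment passes through the floor and
  raises every term by the same W.\<close>

lemma mE: assumes r: "r \<in> R" shows "int (m r) * int (E r) = int W * int (l r)"
  unfolding E W[OF r, symmetric] of_nat_mult by (simp only: ac_simps)

lemma E_ge_1: "r \<in> R \<Longrightarrow> E r \<ge> 1"
  using w l by (simp add: E Suc_le_eq)

lemma k_eq: "k = (\<Prod>r\<in>R. p r ^ E r)"
  by (simp add: k E power_mult)

lemma multiplicity_k:
  assumes r: "r \<in> R" shows "multiplicity (p r) k = E r"
proof -
  have "multiplicity (p r) k = (\<Sum>r'\<in>R. multiplicity (p r) (p r' ^ E r'))"
    unfolding k_eq
  proof (rule prime_elem_multiplicity_prod_distrib)
    show "prime_elem (p r)" using prime[OF r] by simp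
    show "0 \<notin> (\<lambda>r'. p r' ^ E r') ` R" using prime_gt_0_nat[OF prime] by fastforce
  qed simp
  also have "\<dots> = (\<Sum>r'\<in>R. if r' = r then E r else 0)"
  proof (rule sum.cong[OF refl])
    fix r' assume r': "r' \<in> R"
    show "multiplicity (p r) (p r' ^ E r') = (if r' = r then E r else 0)"
    proof (cases "r' = r")
      case True
      then show ?thesis using prime[OF r] by (simp add: multiplicity_same_power)
    next
      case False
      then have "p r \<noteq> p r'" using inj_on_eq_iff[OF distinct r r'] by blast
      then show ?thesis using multiplicity_distinct_prime_power[OF prime[OF r] prime[OF r']] False by simp
    qed
  qed
  also have "\<dots> = E r" using r by simp
  finally show ?thesis .
qed

lemma power_k_rball: "r \<in> R \<Longrightarrow> of_nat (k ^ i) \<in> rball (p r) (int (i * E r))"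
  using rball_of_nat_power[OF prime, of r k i] multiplicity_k k_ge_1 by simp

text \<open>
  If \<open>\<theta>\<close> is not congruent to \<open>j\<close> modulo \<open>k ^ i\<close>, let \<open>k ^ i'\<close> be the largest power modulo which it
  is; up to the constant \<open>i' W\<close>, only boundedly many digits of \<open>n\<close> influence the value.
\<close>

lemma kernel_periodic:
  assumes r0: "r0 \<in> R" and far: "of_nat j - \<theta> \<notin> rball (p r0) (int (i * E r0))"
    and C: "C = int W + int M" and L: "L = N + M + (\<Sum>r\<in>R. nat C * l r)"
  shows "\<exists>c. \<exists>g\<in>periodic_seqs C (k ^ L). \<forall>n. a (k ^ i * n + j) = c + g n"
proof -
  define \<delta> where "\<delta> = of_nat j - \<theta>"
  define G where "G i' \<longleftrightarrow> (\<forall>r\<in>R. \<delta> \<in> rball (p r) (int (i' * E r)))" for i'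
  have G0: "G 0" unfolding G_def \<delta>_def using rball_diff[OF prime rball_of_nat[OF prime] theta] by simp
  have Gi: "\<not> G i" using r0 far unfolding G_def \<delta>_def by blast
  have G_bound: "y \<le> i" if "G y" for y
  proof (rule ccontr)
    assume "\<not> y \<le> i"
    then have "i * E r0 \<le> y * E r0" by (intro mult_le_mono1) simp
    then have "\<delta> \<in> rball (p r0) (int (i * E r0))"
      using that r0 rball_mono unfolding G_def by (metis of_nat_mono)
    then show False using far by (simp add: \<delta>_def)
  qed
  define i' where "i' = (GREATEST y. G y)"
  have Gi': "G i'" unfolding i'_def by (rule GreatestI_nat[of G 0, OF G0]) (rule G_bound)
  have "\<not> G (Suc i')"
  proof
    assume "G (Suc i')"
    then have "Suc i' \<le> i'" unfolding i'_def by (rule Greatest_le_nat) (rule G_bound)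
    then show False by simp
  qed
  then obtain r1 where r1: "r1 \<in> R" "\<delta> \<notin> rball (p r1) (int (Suc i' * E r1))" unfolding G_def by blast
  have "i' \<noteq> i" using Gi Gi' by blast
  then have i'i: "Suc i' \<le> i" using G_bound[OF Gi'] by simp
  have dnz: "\<delta> \<noteq> 0" using r1(2) by auto
  define x where "x n = of_nat (k ^ i * n + j) - \<theta>" for n
  have x: "x n = \<delta> + of_nat (k ^ i) * of_nat n" for n by (simp add: x_def \<delta>_def)
  have step: "of_nat (k ^ i) * of_nat n \<in> rball (p r) (int (i * E r))" if "r \<in> R" for n r
    using rball_mult[OF prime[OF that] power_k_rball[OF that] rball_of_nat[OF prime[OF that]]] by simp
  have nu1: "x n \<noteq> 0" "nu (p r1) (x n) < int (Suc i' * E r1)" for n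
  proof -
    have n1: "nu (p r1) \<delta> < int (Suc i' * E r1)" using r1(2) rball_nu_iff[OF dnz] by (simp add: not_le)
    have "Suc i' * E r1 \<le> i * E r1" by (intro mult_le_mono1 i'i)
    then have "of_nat (k ^ i) * of_nat n \<in> rball (p r1) (nu (p r1) \<delta> + 1)"
      using n1 by (intro rball_mono[OF step[OF r1(1)]]) linarith
    then show "x n \<noteq> 0" "nu (p r1) (x n) < int (Suc i' * E r1)"
      unfolding x using nu_add_eq[OF prime[OF r1(1)] dnz, of "of_nat (k ^ i) * of_nat n"] n1 by auto
  qed
  then have ne: "of_nat (k ^ i * n + j) \<noteq> \<theta>" for n unfolding x_def by simp
  have nu_lower: "int (i' * E r) \<le> nu (p r) (x n)" if r: "r \<in> R" for r n
  proof -
    have "i' * E r \<le> i * E r" using i'i by (intro mult_le_mono1) simp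
    then have "x n \<in> rball (p r) (int (i' * E r))"
      unfolding x using Gi' r unfolding G_def
      by (intro rball_add[OF prime[OF r]] rball_mono[OF step[OF r]]) (auto simp only: of_nat_le_iff)
    then show ?thesis using rball_nu_iff[OF nu1(1)] by simp
  qed
  have mEi: "int (m r) * int (y * E r) = int y * int W * int (l r)" if "r \<in> R" for r y
    using mE[OF that] by (simp add: algebra_simps)
  have le_iff: "B \<le> a (k ^ i * n + j) \<longleftrightarrow>
      (\<forall>r\<in>R. B * int (l r) \<le> int (m r) * nu (p r) (x n) + h r (k ^ i * n + j))" for B n
    unfolding le_a_iff[OF ne] x_def ..
  \<comment> \<open>At r1 the valuation stays below (i' + 1) \<open>E r1\<close>, which is worth (i'
    + 1) W after division by \<open>l r1\<close>; the summand M of C accounts for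
    \<open>h r1\<close>.\<close>
  have upper: "a (k ^ i * n + j) \<le> int i' * int W + C" for n
  proof (rule ccontr)
    assume "\<not> ?thesis"
    then have "int i' * int W + C + 1 \<le> a (k ^ i * n + j)" by simp
    then have "(int i' * int W + C + 1) * int (l r1) \<le> int (m r1) * nu (p r1) (x n) + h r1 (k ^ i * n + j)"
      unfolding le_iff using r1(1) by blast
    also have "\<dots> \<le> int (m r1) * int (Suc i' * E r1) + int M"
      using nu1(2)[of n] h_bound[OF r1(1), of "k ^ i * n + j"]
      by (intro add_mono mult_left_mono) (auto simp: abs_le_iff)
    also have "\<dots> = (int i' * int W + int W) * int (l r1) + int M"
      unfolding mEi[OF r1(1)] by (simp add: algebra_simps)
    finally have "(int M + 1) * int (l r1) \<le> int M" by (simp add: C algebra_simps)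
    moreover have "(int M + 1) * 1 \<le> (int M + 1) * int (l r1)"
      using l[OF r1(1)] by (intro mult_left_mono) auto
    ultimately have "(int M + 1) * 1 \<le> int M" by (rule order_trans[rotated])
    then show False by simp
  qed
  have lower: "int i' * int W - C \<le> a (k ^ i * n + j)" for n
    unfolding le_iff
  proof
    fix r assume r: "r \<in> R"
    have "C * 1 \<le> C * int (l r)" using l[OF r] by (intro mult_left_mono) (auto simp: C)
    then have "(int i' * int W - C) * int (l r) \<le> int i' * int W * int (l r) - int M"
      by (simp add: algebra_simps C)
    also have "\<dots> = int (m r) * int (i' * E r) - int M" by (simp only: mEi[OF r])
    also have "\<dots> \<le> int (m r) * nu (p r) (x n) + h r (k ^ i * n + j)"
      using mult_left_mono[OF nu_lower[OF r, of n], of "int (m r)"] h_bound[OF r, of "k ^ i * n + j"] by linarith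
    finally show "(int i' * int W - C) * int (l r) \<le> int (m r) * nu (p r) (x n) + h r (k ^ i * n + j)" .
  qed
  have Cnn: "0 \<le> C" by (simp add: C)
  have periodic: "a (k ^ i * (n + k ^ L) + j) = a (k ^ i * n + j)" for n
  proof (rule int_eq_if_same_lower_bounds)
    fix B
    let ?n' = "n + k ^ L"
    show "B \<le> a (k ^ i * ?n' + j) \<longleftrightarrow> B \<le> a (k ^ i * n + j)"
    proof (cases "B \<le> int i' * int W + C")
      case False
      then show ?thesis using upper[of n] upper[of ?n'] by linarith
    next
      case B: True
      show ?thesis unfolding le_iff
      proof (rule ball_cong[OF refl])
        fix r assume r: "r \<in> R"
        have xd: "x ?n' = x n + of_nat (k ^ (i + L))"
          unfolding x by (simp add: algebra_simps power_add)
        have d: "of_nat (k ^ (i + L)) \<in> rball (p r) (int ((i + L) * E r))" by (rule power_k_rball[OF r])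
        have LE: "L \<le> L * E r" "i' * E r \<le> i * E r" "(i + L) * E r = i * E r + L * E r"
          using E_ge_1[OF r] i'i mult_le_mono1[of i' i "E r"] by (simp_all add: algebra_simps)
        have "N \<le> (i + L) * E r" using LE unfolding L by linarith
        then have dN: "of_nat (k ^ (i + L)) \<in> rball (p r) (int N)" by (intro rball_mono[OF d]) (simp only: of_nat_le_iff)
        have "of_nat (k ^ i * ?n' + j) - of_nat (k ^ i * n + j) = (of_nat (k ^ (i + L)) :: rat)"
          by (simp add: algebra_simps power_add)
        then have hh: "h r (k ^ i * ?n' + j) = h r (k ^ i * n + j)" using dN by (intro h_cong[OF r]) (simp only:)
        \<comment> \<open>L extra digits lift the r-th term to at least i' W + C, the upper bound of
          the sequence, so it imposes no condition on the thresholds B in question; the sum and M in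
          L are chosen for this.\<close>
        have big: "B * int (l r) \<le> int (m r) * nu (p r) (x y) + h r (k ^ i * y + j)"
          if "int (i' * E r) + int L \<le> nu (p r) (x y)" for y
        proof -
          have "nat C * l r \<le> (\<Sum>r\<in>R. nat C * l r)" using r by (intro member_le_sum) auto
          then have "int (nat C * l r) + int M \<le> int L" unfolding L by linarith
          then have CL: "C * int (l r) + int M \<le> int L" using Cnn by simp
          have "B * int (l r) \<le> (int i' * int W + C) * int (l r)" by (rule mult_right_mono[OF B]) simp
          also have "\<dots> = int (m r) * int (i' * E r) + C * int (l r)" unfolding mEi[OF r] by (simp add: algebra_simps)
          also have "\<dots> \<le> int (m r) * int (i' * E r) + int (m r) * int L - int M"
          proof -
            have "1 * int L \<le> int (m r) * int L" using m[OF r] by (intro mult_right_mono) auto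
            then show ?thesis using CL by linarith
          qed
          also have "\<dots> = int (m r) * (int (i' * E r) + int L) - int M" by (simp add: algebra_simps)
          also have "\<dots> \<le> int (m r) * nu (p r) (x y) + h r (k ^ i * y + j)"
            using mult_left_mono[OF that, of "int (m r)"] h_bound[OF r, of "k ^ i * y + j"] by linarith
          finally show ?thesis .
        qed
        \<comment> \<open>Either the r-th term is irrelevant at both indices, or their difference
          k^(i + L) is too divisible by p_r to change the valuation.\<close>
        show "B * int (l r) \<le> int (m r) * nu (p r) (x ?n') + h r (k ^ i * ?n' + j) \<longleftrightarrow>
          B * int (l r) \<le> int (m r) * nu (p r) (x n) + h r (k ^ i * n + j)"
        proof (cases "int (i' * E r) + int L \<le> nu (p r) (x n)")
          case True
          have "x n \<in> rball (p r) (int (i' * E r) + int L)" using True rball_nu_iff[OF nu1(1)] by simp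
          moreover have "of_nat (k ^ (i + L)) \<in> rball (p r) (int (i' * E r) + int L)"
            by (rule rball_mono[OF d]) (use LE in linarith)
          ultimately have "x ?n' \<in> rball (p r) (int (i' * E r) + int L)"
            unfolding xd by (rule rball_add[OF prime[OF r]])
          then have "int (i' * E r) + int L \<le> nu (p r) (x ?n')" using rball_nu_iff[OF nu1(1)] by simp
          then show ?thesis using big True by blast
        next
          case False
          then have "of_nat (k ^ (i + L)) \<in> rball (p r) (nu (p r) (x n) + 1)"
            by (intro rball_mono[OF d]) (use LE in linarith)
          then have "nu (p r) (x ?n') = nu (p r) (x n)"
            unfolding xd by (rule nu_add_eq(2)[OF prime[OF r] nu1(1)])
          then show ?thesis using hh by simp
        qed
      qed
    qed
  qed
  let ?g = "\<lambda>n. a (k ^ i * n + j) - int i' * int W"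
  have "?g \<in> periodic_seqs C (k ^ L)"
    unfolding periodic_seqs_def using upper lower periodic by (auto simp: abs_le_iff diff_le_eq le_diff_eq algebra_simps)
  then show ?thesis by (intro exI[of _ "int i' * int W"] bexI[of _ ?g]) auto
qed

lemma le_div_iff_mult_le: "L \<ge> 1 \<Longrightarrow> B \<le> z div int L \<longleftrightarrow> B * int L \<le> z"
  using floor_div_ge_iff[of L "Fin z" B] by (simp add: floor_div_def)

text \<open>What remains of n \<mapsto> a (k^i n + j) after subtracting i W when k^i \<tau> + j =
  \<theta>: it depends on \<tau> alone. The 0 at \<tau> is a placeholder, corrected by a multiple of
  \<open>delta_seq\<close>.\<close>

definition local_val :: "rat \<Rightarrow> nat \<Rightarrow> int" where
  "local_val \<tau> n = (if of_nat n = \<tau> then 0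
    else Min ((\<lambda>r. (int (m r) * nu (p r) (of_nat n - \<tau>) + H r) div int (l r)) ` R))"

definition delta_seq :: "rat \<Rightarrow> nat \<Rightarrow> int" where
  "delta_seq \<tau> n = (if of_nat n = \<tau> then 1 else 0)"

text \<open>Alignment and i \<ge> N place every k^i n + j where \<open>h r\<close> equals
  \<open>H r\<close>, and each term splits off i W. If \<tau> is a natural number, then k^i \<tau> +
  j = \<theta> is a common zero where \<open>a\<close> is arbitrary, and c records that
  value.\<close>

lemma kernel_aligned:
  assumes i: "i \<ge> N" and j: "\<And>r. r \<in> R \<Longrightarrow> of_nat j - \<theta> \<in> rball (p r) (int (i * E r))"
    and tau: "\<tau> = (\<theta> - of_nat j) * (1 / of_nat (k ^ i))"
  shows "\<exists>c. \<forall>n. a (k ^ i * n + j) = int i * int W + local_val \<tau> n + c * delta_seq \<tau> n"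
proof -
  have x: "of_nat (k ^ i) * \<tau> + of_nat j = \<theta>" using k_ge_1 by (simp add: tau)
  have tau0: "\<tau> \<in> rball (p r) 0" if r: "r \<in> R" for r
  proof -
    have "1 / of_nat (k ^ i) \<in> rball (p r) (- int (i * E r))"
      using val_rat_power_of_nat(2)[OF prime[OF r], of k i] k_ge_1
      by (simp add: rball_def multiplicity_k[OF r] del: of_nat_power)
    then have "\<tau> \<in> rball (p r) (int (i * E r) + - int (i * E r))"
      unfolding tau by (intro rball_mult[OF prime[OF r]] rball_diff_swap[OF prime[OF r] j[OF r]])
    then show ?thesis by simp
  qed
  have close: "of_nat (k ^ i) * (of_nat n - \<tau>) \<in> rball (p r) (int N)" if r: "r \<in> R" for n r
  proof -
    have "of_nat (k ^ i) * (of_nat n - \<tau>) \<in> rball (p r) (int (i * E r) + 0)"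
      by (intro rball_mult[OF prime[OF r]] power_k_rball[OF r] rball_diff[OF prime[OF r]]
          rball_of_nat[OF prime[OF r]] tau0[OF r])
    moreover have "N \<le> i * E r" using i mult_le_mono2[OF E_ge_1[OF r], of i] by linarith
    ultimately show ?thesis by (elim rball_mono) (simp only: add_0_right of_nat_le_iff)
  qed
  have main: "a (k ^ i * n + j) = int i * int W + local_val \<tau> n" if n: "of_nat n \<noteq> \<tau>" for n
  proof (rule int_eq_if_same_lower_bounds)
    fix B
    have "B \<le> a (k ^ i * n + j) \<longleftrightarrow>
      (\<forall>r\<in>R. B * int (l r) \<le> kernel_term k i \<tau> r n)"
      by (rule le_a_affine_iff[OF k_ge_1 x n]) (rule close)
    also have "\<dots> \<longleftrightarrow> (\<forall>r\<in>R. B - int i * int W \<le> (int (m r) * nu (p r) (of_nat n - \<tau>) + H r) div int (l r))"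
    proof (rule ball_cong[OF refl])
      fix r assume r: "r \<in> R"
      have "int (m r) * int (i * E r) = int i * int W * int (l r)" using mE[OF r] by (simp add: algebra_simps)
      then show "B * int (l r) \<le> kernel_term k i \<tau> r n \<longleftrightarrow>
        B - int i * int W \<le> (int (m r) * nu (p r) (of_nat n - \<tau>) + H r) div int (l r)"
        unfolding le_div_iff_mult_le[OF l[OF r]] multiplicity_k[OF r] distrib_left left_diff_distrib by linarith
    qed
    also have "\<dots> \<longleftrightarrow> B - int i * int W \<le>
        Min ((\<lambda>r. (int (m r) * nu (p r) (of_nat n - \<tau>) + H r) div int (l r)) ` R)"
      using R_ne by (subst Min_ge_iff) auto
    also have "Min ((\<lambda>r. (int (m r) * nu (p r) (of_nat n - \<tau>) + H r) div int (l r)) ` R) = local_val \<tau> n"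
      using n by (simp only: local_val_def if_False)
    also have "B - int i * int W \<le> local_val \<tau> n \<longleftrightarrow> B \<le> int i * int W + local_val \<tau> n" by linarith
    finally show "B \<le> a (k ^ i * n + j) \<longleftrightarrow> B \<le> int i * int W + local_val \<tau> n" .
  qed
  show ?thesis
  proof (cases "\<exists>n0::nat. of_nat n0 = \<tau>")
    case True
    then obtain n0 :: nat where n0: "of_nat n0 = \<tau>" by blast
    have "a (k ^ i * n + j) = int i * int W + local_val \<tau> n + (a (k ^ i * n0 + j) - int i * int W) * delta_seq \<tau> n" for n
    proof (cases "of_nat n = \<tau>")
      case True
      then have "n = n0" using n0 by simp
      then show ?thesis using n0 by (simp add: local_val_def delta_seq_def)
    next
      case False
      then show ?thesis using main by (simp add: delta_seq_def)
    qed
    then show ?thesis by blast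
  next
    case False
    then have "a (k ^ i * n + j) = int i * int W + local_val \<tau> n + 0 * delta_seq \<tau> n" for n
      using main[of n] by simp
    then show ?thesis by blast
  qed
qed

text \<open>For \<theta> = v / d alignment makes k^i divide d j - v, and j < k^i bounds the quotient
  y by |v| + |d|. The preimage is - y / d, with a denominator independent of i and j.\<close>

lemma aligned_preimages_finite:
  "\<exists>T. finite T \<and> (\<forall>i j. j < k ^ i \<longrightarrow> (\<forall>r\<in>R. of_nat j - \<theta> \<in> rball (p r) (int (i * E r))) \<longrightarrow>
    (\<theta> - of_nat j) * (1 / of_nat (k ^ i)) \<in> T)"
proof -
  obtain v d where vd: "\<theta> = of_int v / of_int d" "d \<noteq> 0" by (rule rat_fracE)
  define Z where "Z = \<bar>v\<bar> + \<bar>d\<bar>"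
  have "(\<theta> - of_nat j) * (1 / of_nat (k ^ i)) \<in> (\<lambda>z. of_int z / of_int d) ` {- Z..Z}"
    if j: "j < k ^ i" and al: "\<forall>r\<in>R. of_nat j - \<theta> \<in> rball (p r) (int (i * E r))" for i j
  proof -
    let ?D = "d * int j - v"
    have eq: "of_int ?D = of_int d * (of_nat j - \<theta>)" using vd by (simp add: field_simps)
    have "(\<Prod>r\<in>R. p r ^ (i * E r)) dvd nat \<bar>?D\<bar>"
    proof (rule prod_coprime_dvd)
      fix r assume r: "r \<in> R"
      have "of_int ?D \<in> rball (p r) (0 + int (i * E r))"
        unfolding eq by (intro rball_mult[OF prime[OF r]] rball_of_int[OF prime[OF r]] bspec[OF al r])
      then have "int (p r) ^ (i * E r) dvd ?D"
        using rball_of_int_iff[OF prime[OF r], of ?D "i * E r"] by (simp only: add_0_left)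
      then have "int (p r ^ (i * E r)) dvd ?D" by simp
      then show "p r ^ (i * E r) dvd nat \<bar>?D\<bar>" by (simp only: dvd_nat_abs_iff)
    qed (use coprime_p in auto)
    moreover have "(\<Prod>r\<in>R. p r ^ (i * E r)) = k ^ i"
      unfolding k_eq prod_power_distrib power_mult[symmetric] by (simp only: mult.commute)
    ultimately have "int (k ^ i) dvd ?D" by (simp only: dvd_nat_abs_iff)
    then obtain y where y: "?D = int (k ^ i) * y" by (rule dvdE)
    have kp: "int (k ^ i) > 0" using k_ge_1 by simp
    have "int (k ^ i) * \<bar>y\<bar> = \<bar>?D\<bar>" unfolding y using kp by (simp add: abs_mult)
    also have "\<dots> \<le> \<bar>d\<bar> * int j + \<bar>v\<bar> * 1" by (rule order_trans[OF abs_triangle_ineq4]) (simp add: abs_mult)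
    also have "\<dots> \<le> \<bar>d\<bar> * int (k ^ i) + \<bar>v\<bar> * int (k ^ i)"
      using j kp by (intro add_mono mult_left_mono) auto
    also have "\<dots> = int (k ^ i) * Z" by (simp add: Z_def algebra_simps)
    finally have "\<bar>y\<bar> \<le> Z" using kp by simp
    moreover have "(\<theta> - of_nat j) * (1 / of_nat (k ^ i)) = of_int (- y) / of_int d"
    proof -
      have kr: "of_nat (k ^ i) \<noteq> (0::rat)" using k_ge_1 by simp
      have "of_int d * (of_nat j - \<theta>) = of_nat (k ^ i) * of_int y"
        using arg_cong[OF y, of "of_int :: int \<Rightarrow> rat"] eq by (simp del: of_nat_power add: of_nat_power[symmetric])
      then have "\<theta> - of_nat j = - (of_nat (k ^ i) * of_int y) / of_int d"
        using vd(2) by (simp add: field_simps)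
      then show ?thesis using kr by (simp del: of_nat_power)
    qed
    ultimately show ?thesis by (intro image_eqI[of _ _ "- y"]) auto
  qed
  then show ?thesis by (intro exI[of _ "(\<lambda>z. of_int z / of_int d) ` {- Z..Z}"]) auto
qed

text \<open>Unaligned kernel sequences are a constant plus a bounded periodic sequence. Aligned ones
  with i \<ge> N combine a constant, a local value and a delta sequence at one of finitely many
  \<tau>. Those with i < N are finite in number.\<close>

lemma k_regular_k: "k_regular k a"
proof -
  define C where "C = int W + int M"
  define L where "L = N + M + (\<Sum>r\<in>R. nat C * l r)"
  obtain T where T: "finite T" "\<And>i j. j < k ^ i \<Longrightarrow> \<forall>r\<in>R. of_nat j - \<theta> \<in> rball (p r) (int (i * E r)) \<Longrightarrow>
      (\<theta> - of_nat j) * (1 / of_nat (k ^ i)) \<in> T"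
    using aligned_preimages_finite by blast
  define one :: "nat \<Rightarrow> int" where "one = (\<lambda>_. 1)"
  define B where "B = insert one (periodic_seqs C (k ^ L) \<union> local_val ` T \<union> delta_seq ` T \<union>
      kernel_seq k a ` (SIGMA i:{..<N}. {..<k ^ i}))"
  have fB: "finite B"
    unfolding B_def using T(1) k_ge_1 by (intro finite.insertI finite_UnI finite_periodic_seqs finite_imageI) auto
  have in1: "(\<lambda>n. c * g n) \<in> int_seq.span B" if "g \<in> B" for c g
    by (rule int_seq.span_scale[OF int_seq.span_base[OF that]])
  have "kernel_seq k a (i, j) \<in> int_seq.span B" if j: "j < k ^ i" for i j
  proof (cases "\<forall>r\<in>R. of_nat j - \<theta> \<in> rball (p r) (int (i * E r))")
    case False
    then obtain r0 where "r0 \<in> R" "of_nat j - \<theta> \<notin> rball (p r0) (int (i * E r0))" by blast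
    then obtain c g where g: "g \<in> periodic_seqs C (k ^ L)" "\<And>n. a (k ^ i * n + j) = c + g n"
      using kernel_periodic[OF _ _ C_def L_def] by blast
    have "kernel_seq k a (i, j) = (\<lambda>n. c * one n) + (\<lambda>n. 1 * g n)"
      by (rule ext) (simp add: kernel_seq_def g(2) one_def)
    also have "\<dots> \<in> int_seq.span B"
      by (intro int_seq.span_add in1) (use g(1) in \<open>simp_all add: B_def\<close>)
    finally show ?thesis .
  next
    case True
    show ?thesis
    proof (cases "i < N")
      case True
      then show ?thesis using j by (intro int_seq.span_base) (auto simp: B_def)
    next
      case False
      define \<tau> where "\<tau> = (\<theta> - of_nat j) * (1 / of_nat (k ^ i))"
      have \<tau>: "\<tau> \<in> T" unfolding \<tau>_def by (rule T(2)[OF j True])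
      obtain c where c: "\<And>n. a (k ^ i * n + j) = int i * int W + local_val \<tau> n + c * delta_seq \<tau> n"
        using kernel_aligned[OF _ _ \<tau>_def] False True by (metis not_less)
      have "kernel_seq k a (i, j) = (\<lambda>n. (int i * int W) * one n) + (\<lambda>n. 1 * local_val \<tau> n) + (\<lambda>n. c * delta_seq \<tau> n)"
        by (rule ext) (simp add: kernel_seq_def c one_def)
      also have "\<dots> \<in> int_seq.span B"
        by (intro int_seq.span_add in1) (use \<tau> in \<open>simp_all add: B_def\<close>)
      finally show ?thesis .
    qed
  qed
  then have "kernel k a \<subseteq> int_seq.span B" unfolding kernel_eq[OF k_ge_1] by auto
  then show ?thesis by (rule k_regularI[OF fB])
qed

end

end

section \<open>From a single common root to the normal form at each prime\<close>

context val_seq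
begin

text \<open>Replacing one coordinate of the unique common root by another root of that component
  would give a second common root, so each \<open>f r\<close> has \<theta> as its only root.\<close>

lemma single_root_exists:
  assumes rt: "roots_b s p f = {diag s p \<theta>}"
  shows "\<exists>h H M N. single_root s p l f a \<theta> (\<lambda>r. root_mult (p r) (f r) (of_rat_Qp (p r) \<theta>)) h H M N"
proof -
  let ?m = "\<lambda>r. root_mult (p r) (f r) (of_rat_Qp (p r) \<theta>)"
  have mem: "of_rat_Qp (p r) \<theta> \<in> roots_Zp (p r) (f r)" if "r \<in> R" for r
  proof -
    have "diag s p \<theta> \<in> roots_b s p f" using rt by simp
    then have "diag s p \<theta> r \<in> roots_Zp (p r) (f r)" using that unfolding roots_b_def by (rule PiE_mem)
    then show ?thesis using that by (simp add: diag_def)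
  qed
  have roots: "roots_Zp (p r) (f r) = {of_rat_Qp (p r) \<theta>}" if r: "r \<in> R" for r
  proof -
    have "y = of_rat_Qp (p r) \<theta>" if y: "y \<in> roots_Zp (p r) (f r)" for y
    proof -
      have "(diag s p \<theta>)(r := y) \<in> roots_b s p f"
        unfolding roots_b_def diag_def using y r mem by (auto simp: PiE_iff extensional_def)
      then have "(diag s p \<theta>)(r := y) = diag s p \<theta>" using rt by blast
      from fun_cong[OF this, of r] show ?thesis using r by (simp add: diag_def)
    qed
    then show ?thesis using mem[OF r] by blast
  qed
  have th: "\<theta> \<in> rball (p r) 0" if "r \<in> R" for r
    using mem[OF that] of_rat_Qp_in_Zp_iff[OF prime[OF that]] by (auto simp: roots_Zp_def)
  have "\<forall>r\<in>R. \<exists>h (M::nat) t.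
      (\<forall>n v. val_rat (p r) (of_nat n - \<theta>) = Fin v \<longrightarrow> nat_val (p r) (f r) n = Fin (int (?m r) * v + h n)) \<and>
      (\<forall>n. \<bar>h n\<bar> \<le> int M) \<and> (\<forall>n n'. [n = n'] (mod p r ^ t) \<longrightarrow> h n = h n')"
    using single_root_nat_val(2)[OF prime analytic nonzero roots refl] by blast
  then obtain h and M t :: "nat \<Rightarrow> nat" where h: "\<And>r n v. r \<in> R \<Longrightarrow> val_rat (p r) (of_nat n - \<theta>) = Fin v \<Longrightarrow>
        nat_val (p r) (f r) n = Fin (int (?m r) * v + h r n)"
      "\<And>r n. r \<in> R \<Longrightarrow> \<bar>h r n\<bar> \<le> int (M r)"
      "\<And>r n n'. r \<in> R \<Longrightarrow> [n = n'] (mod p r ^ t r) \<Longrightarrow> h r n = h r n'"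
    by metis
  define N where "N = sum t R"
  \<comment> \<open>\<theta> need not be a natural number, so the local value is read off at some
    natural within precision N; by \<open>hN\<close> all such naturals give the same value.\<close>
  define H where "H r = h r (SOME n. of_nat n - \<theta> \<in> rball (p r) (int N))" for r
  have hN: "h r n = h r n'" if r: "r \<in> R" and nn: "of_nat n - of_nat n' \<in> rball (p r) (int N)" for r n n'
  proof (rule h(3)[OF r])
    have "t r \<le> N" unfolding N_def using r by (intro member_le_sum) auto
    then have "of_nat n - of_nat n' \<in> rball (p r) (int (t r))" using nn by (elim rball_mono) simp
    then have "of_int (int n - int n') \<in> rball (p r) (int (t r))" by simp
    then have "int (p r) ^ t r dvd int n - int n'" using rball_of_int_iff[OF prime[OF r]] by blast
    then have "[int n = int n'] (mod int (p r ^ t r))" by (simp add: cong_iff_dvd_diff)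
    then show "[n = n'] (mod p r ^ t r)" by (simp only: cong_int_iff)
  qed
  have "single_root s p l f a \<theta> ?m h H (sum M R) N"
  proof (unfold_locales)
    fix r n assume r: "r \<in> R"
    have "M r \<le> sum M R" using r by (intro member_le_sum) auto
    then have b: "\<bar>h r n\<bar> \<le> int (sum M R)" for n using h(2)[OF r, of n] by linarith
    show "\<bar>h r n\<bar> \<le> int (sum M R)" "\<bar>H r\<bar> \<le> int (sum M R)" using b by (auto simp only: H_def)
    show "?m r \<ge> 1" by (rule single_root_nat_val(1)[OF prime[OF r] analytic[OF r] nonzero[OF r] roots[OF r] refl])
  next
    fix r n assume r: "r \<in> R" and n: "of_nat n - \<theta> \<in> rball (p r) (int N)"
    define n0 where "n0 = (SOME n. of_nat n - \<theta> \<in> rball (p r) (int N))"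
    have "of_nat n0 - \<theta> \<in> rball (p r) (int N)" unfolding n0_def by (rule someI[of _ n]) (rule n)
    then have "(of_nat n - \<theta>) - (of_nat n0 - \<theta>) \<in> rball (p r) (int N)" by (rule rball_diff[OF prime[OF r] n])
    then have "of_nat n - of_nat n0 \<in> rball (p r) (int N)" by simp
    then show "h r n = H r" unfolding H_def n0_def[symmetric] by (rule hN[OF r])
  qed (use th mem h(1) hN in auto)
  then show ?thesis by blast
qed

end

theorem theorem2p4:
  fixes s b :: nat
    and p l :: "nat \<Rightarrow> nat"
    and f :: "nat \<Rightarrow> padic \<Rightarrow> padic"
    and a :: "nat \<Rightarrow> int"
  assumes s: "s \<ge> 2"
    and prime: "\<And>i. i \<in> {1..s} \<Longrightarrow> prime (p i)"
    and distinct: "inj_on p {1..s}"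
    and l: "\<And>i. i \<in> {1..s} \<Longrightarrow> l i \<ge> 1"
    and b: "b = (\<Prod>i=1..s. p i ^ l i)"
    and analytic: "\<And>i. i \<in> {1..s} \<Longrightarrow> analytic_Zp (p i) (f i)"
    and nonzero: "\<And>i. i \<in> {1..s} \<Longrightarrow> \<exists>x\<in>Zp (p i). f i x \<noteq> \<zero>\<^bsub>Qp (p i)\<^esub>"
    \<comment> \<open>\<open>a\<close> takes arbitrary integer values at the \<open>n\<close> with \<open>f(n) = 0\<close>\<close>
    and a: "\<And>n. val_b s p l (eval_b s f (diag s p (of_nat n))) \<noteq> \<infinity> \<Longrightarrow>
              Fin (a n) = val_b s p l (eval_b s f (diag s p (of_nat n)))"
  shows "(roots_b s p f = {} \<longrightarrow> (\<exists>N. has_period (b ^ N) a)) \<and>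
    (\<forall>\<theta>::rat. diag s p \<theta> \<in> Zb s p \<and> roots_b s p f = {diag s p \<theta>} \<longrightarrow>
       (\<forall>w::nat \<Rightarrow> nat.
          (\<forall>i\<in>{1..s}. w i \<ge> 1) \<and>
          (\<forall>i\<in>{1..s}. \<forall>j\<in>{1..s}.
             w i * root_mult (p i) (f i) (of_rat_Qp (p i) \<theta>) =
             w j * root_mult (p j) (f j) (of_rat_Qp (p j) \<theta>)) \<longrightarrow>
          strictly_k_regular (\<Prod>i=1..s. (p i ^ l i) ^ w i) a)) \<and>
    (roots_b s p f \<noteq> {} \<and>
     \<not> (\<exists>\<theta>::rat. diag s p \<theta> \<in> Zb s p \<and> roots_b s p f = {diag s p \<theta>}) \<longrightarrow>
       \<not> regular a)"
proof -
  interpret val_seq s p l f a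
    by unfold_locales (fact s prime distinct l analytic nonzero a)+
  have periodic: "\<exists>N. has_period (b ^ N) a" if empty: "roots_b s p f = {}"
  proof -
    obtain i where i: "i \<in> {1..s}" "roots_Zp (p i) (f i) = {}"
      using empty unfolding roots_b_def PiE_eq_empty_iff by (elim bexE)
    show ?thesis unfolding b by (rule periodic_if_no_root[OF i])
  qed
  have strict: "strictly_k_regular (\<Prod>i=1..s. (p i ^ l i) ^ w i) a"
    if rt: "roots_b s p f = {diag s p \<theta>}" and w: "\<forall>i\<in>{1..s}. w i \<ge> 1"
      "\<forall>i\<in>{1..s}. \<forall>j\<in>{1..s}. w i * root_mult (p i) (f i) (of_rat_Qp (p i) \<theta>) =
             w j * root_mult (p j) (f j) (of_rat_Qp (p j) \<theta>)" for \<theta> :: rat and w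
  proof -
    let ?m = "\<lambda>r. root_mult (p r) (f r) (of_rat_Qp (p r) \<theta>)"
    obtain h H M N where "single_root s p l f a \<theta> ?m h H M N" using single_root_exists[OF rt] by blast
    then interpret sr: single_root s p l f a \<theta> ?m h H M N .
    have w1: "w r \<ge> 1" if "r \<in> {1..s}" for r by (rule bspec[OF w(1) that])
    have wm: "w r * ?m r = w r' * ?m r'" if "r \<in> {1..s}" "r' \<in> {1..s}" for r r'
      by (rule bspec[OF bspec[OF w(2) that(1)] that(2)])
    \<comment> \<open>The common product W is taken to be its value at index 1.\<close>
    have "k_regular (\<Prod>i=1..s. (p i ^ l i) ^ w i) a"
      by (rule sr.k_regular_k[OF w1 wm[OF _ one_in_R] refl refl])
    moreover have "\<not> k_regular q a" if "q \<ge> 2" "mult_indep (\<Prod>i=1..s. (p i ^ l i) ^ w i) q" for q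
    proof
      assume "k_regular q a"
      then have "\<not> mult_indep (\<Prod>i=1..s. (p i ^ l i) ^ w i) q"
        by (rule sr.regular_base_dependent[OF _ that(1) w1 wm])
      then show False using that(2) by (rule notE)
    qed
    ultimately show ?thesis unfolding strictly_k_regular_def by blast
  qed
  show ?thesis
  proof (intro conjI allI impI)
    fix \<theta> :: rat and w
    assume "diag s p \<theta> \<in> Zb s p \<and> roots_b s p f = {diag s p \<theta>}"
      and "(\<forall>i\<in>{1..s}. w i \<ge> 1) \<and> (\<forall>i\<in>{1..s}. \<forall>j\<in>{1..s}.
             w i * root_mult (p i) (f i) (of_rat_Qp (p i) \<theta>) =
             w j * root_mult (p j) (f j) (of_rat_Qp (p j) \<theta>))"
    then show "strictly_k_regular (\<Prod>i=1..s. (p i ^ l i) ^ w i) a" by (elim conjE) (rule strict)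
  next
    assume "roots_b s p f \<noteq> {} \<and>
      \<not> (\<exists>\<theta>. diag s p \<theta> \<in> Zb s p \<and> roots_b s p f = {diag s p \<theta>})"
    then show "\<not> regular a" by (elim conjE) (rule not_regular)
  qed (rule periodic)
qed

end
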